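(* For $s\in(0,3)$ let \[ f_s(x,t) = \frac{1}{(x^4+t^2)^{s/4}}, \qquad (x,t)\in\mathbb{R}^2. \] Then $\phi\mapsto\int_{\mathbb{R}^2}\phi f_s$ defines a tempered distribution $f_s\in\mathcal{S}'(\mathbb{R}^2)$. Moreover, if $s\in(1,3)$, then the Euclidean (distributional) Fourier transform $\widehat{f_s}$ of $f_s$ is a locally integrable function on $\mathbb{R}^2$, which is given for $(\xi_1,\xi_2)\in\mathbb{R}^2$ with $\xi_2\neq 0$ by \[ \widehat{f_s}(\xi_1,\xi_2) = \frac{2\pi^{s/4}|\xi_2|^{\frac{s-2}{4}}}{\Gamma(s/4)}\int_{\mathbb{R}} e^{-2\pi i x\xi_1}|x|^{1-\frac{s}{2}}K_{\frac{s-2}{4}}\left(2\pi|\xi_2|x^2\right)\,dx, \] and there is a positive constant $C_s$ depending only on $s$ such that \[ 0<\widehat{f_s}(\xi_1,\xi_2)\leq C_s f_{3-s}(\xi_1,\xi_2) \] for all $(\xi_1,\xi_2)\in\mathbb{R}^2$ with $\xi_2\neq0$.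
   Context: The Fourier transform of $\phi\in\mathcal{S}(\mathbb{R}^2)$ is $\widehat{\phi}(\xi)=\int_{\mathbb{R}^2}e^{-2\pi i\langle x,\xi\rangle}\phi(x)\,dx$, and the Fourier transform of a tempered distribution $f$ is defined by $\langle\widehat{f},\phi\rangle=\langle f,\widehat{\phi}\rangle$ for $\phi\in\mathcal{S}(\mathbb{R}^2)$. Saying that $\widehat{f_s}$ is a locally integrable function $g$ means $\langle \widehat{f_s},\phi\rangle=\int_{\mathbb{R}^2} g\phi$ for all $\phi\in\mathcal{S}(\mathbb{R}^2)$. $K_\nu$ is the modified Bessel function of the second kind of order $\nu$: for $x>0$ and non-integer $\nu$, \[ K_\nu(x)=\frac{\pi}{2\sin(\nu\pi)}\left(I_{-\nu}(x)-I_\nu(x)\right), \qquad I_\nu(x)=\sum_{n=0}^\infty\frac{(x/2)^{\nu+2n}}{n!\,\Gamma(n+\nu+1)}, \] and for $n\in\mathbb{Z}$, $K_n(x)=\lim_{\nu\to n}K_\nu(x)$. $\Gamma$ is the Gamma function. *)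

theory Defs
  imports "HOL-Analysis.Analysis"
begin

text \<open>Iterated partial derivatives are indexed by lists of coordinate directions (elements
  of \<^term>\<open>Basis\<close>); the multi-index of such a derivative is given by the multiplicities in the
  list. \<^const>\<open>frechet_derivative\<close> is a meaningful value only at points of differentiability, which
  \<open>smooth\<close> below requires at every order.\<close>

definition partial_deriv ::
  "'a::euclidean_space \<Rightarrow> ('a \<Rightarrow> complex) \<Rightarrow> 'a \<Rightarrow> complex" where
  "partial_deriv b \<phi> = (\<lambda>z. frechet_derivative \<phi> (at z) b)"

definition partial_derivs ::
  "'a::euclidean_space list \<Rightarrow> ('a \<Rightarrow> complex) \<Rightarrow> 'a \<Rightarrow> complex" where
  "partial_derivs bs \<phi> = foldr partial_deriv bs \<phi>"

text \<open>Differentiability of all iterated partial derivatives makes each of them continuous, so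
  this is the usual class of infinitely differentiable functions.\<close>

definition smooth :: "('a::euclidean_space \<Rightarrow> complex) \<Rightarrow> bool" where
  "smooth \<phi> \<longleftrightarrow>
    (\<forall>bs. set bs \<subseteq> Basis \<longrightarrow> (\<forall>z. partial_derivs bs \<phi> differentiable (at z)))"

definition schwartz_space :: "('a::euclidean_space \<Rightarrow> complex) set" where
  "schwartz_space = {\<phi>. smooth \<phi> \<and>
    (\<forall>k bs. set bs \<subseteq> Basis \<longrightarrow> bounded (range (\<lambda>z. norm z ^ k *\<^sub>R partial_derivs bs \<phi> z)))}"

definition schwartz_seminorm ::
  "nat \<Rightarrow> 'a::euclidean_space list \<Rightarrow> ('a \<Rightarrow> complex) \<Rightarrow> real" where
  "schwartz_seminorm k bs \<phi> = (SUP z. norm z ^ k * norm (partial_derivs bs \<phi> z))"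

text \<open>The locally convex topology defined by the seminorms; the balls around all centres form a
  subbase.\<close>

definition schwartz_topology :: "('a::euclidean_space \<Rightarrow> complex) topology" where
  "schwartz_topology = topology_generated_by
    {{\<psi> \<in> schwartz_space. schwartz_seminorm k bs (\<lambda>z. \<psi> z - \<phi> z) < e} | k bs \<phi> e.
      set bs \<subseteq> Basis \<and> \<phi> \<in> schwartz_space \<and> e > 0}"

text \<open>Distributions are functions on all of \<^typ>\<open>'a \<Rightarrow> complex\<close>; only their values on
  \<^term>\<open>schwartz_space\<close> matter.\<close>

definition tempered_distribution ::
  "(('a::euclidean_space \<Rightarrow> complex) \<Rightarrow> complex) \<Rightarrow> bool" where
  "tempered_distribution T \<longleftrightarrow>
    (\<forall>\<phi>\<in>schwartz_space. \<forall>\<psi>\<in>schwartz_space. T (\<lambda>z. \<phi> z + \<psi> z) = T \<phi> + T \<psi>) \<and>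
    (\<forall>c. \<forall>\<phi>\<in>schwartz_space. T (\<lambda>z. c * \<phi> z) = c * T \<phi>) \<and>
    continuous_map schwartz_topology euclidean T"

definition distribution_of ::
  "('a::euclidean_space \<Rightarrow> complex) \<Rightarrow> ('a \<Rightarrow> complex) \<Rightarrow> complex" where
  "distribution_of g \<phi> = (LINT z|lborel. g z * \<phi> z)"

definition locally_integrable :: "('a::euclidean_space \<Rightarrow> complex) \<Rightarrow> bool" where
  "locally_integrable g \<longleftrightarrow> (\<forall>K. compact K \<longrightarrow> set_integrable lborel K g)"

text \<open>The integrability clause is needed because the integral of a
  non-integrable function is \<open>0\<close> by convention.\<close>

definition is_function ::
  "(('a::euclidean_space \<Rightarrow> complex) \<Rightarrow> complex) \<Rightarrow> ('a \<Rightarrow> complex) \<Rightarrow> bool" where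
  "is_function T g \<longleftrightarrow>
    (\<forall>\<phi>\<in>schwartz_space. integrable lborel (\<lambda>z. g z * \<phi> z) \<and> T \<phi> = distribution_of g \<phi>)"

definition fourier :: "('a::euclidean_space \<Rightarrow> complex) \<Rightarrow> 'a \<Rightarrow> complex" where
  "fourier \<phi> \<xi> = (LINT x|lborel. exp (- 2 * pi * \<i> * complex_of_real (x \<bullet> \<xi>)) * \<phi> x)"

definition distr_fourier ::
  "(('a::euclidean_space \<Rightarrow> complex) \<Rightarrow> complex) \<Rightarrow> ('a \<Rightarrow> complex) \<Rightarrow> complex" where
  "distr_fourier T \<phi> = T (fourier \<phi>)"

text \<open>Both functions are intended for positive arguments.\<close>

definition bessel_I :: "real \<Rightarrow> real \<Rightarrow> real" where
  "bessel_I \<nu> x = (\<Sum>n. (x / 2) powr (\<nu> + 2 * real n) / (fact n * Gamma (real n + \<nu> + 1)))"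

definition bessel_K_nonint :: "real \<Rightarrow> real \<Rightarrow> real" where
  "bessel_K_nonint \<nu> x = pi / (2 * sin (\<nu> * pi)) * (bessel_I (- \<nu>) x - bessel_I \<nu> x)"

definition bessel_K :: "real \<Rightarrow> real \<Rightarrow> real" where
  "bessel_K \<nu> x =
    (if \<nu> \<in> \<int> then Lim (at \<nu>) (\<lambda>\<mu>. bessel_K_nonint \<mu> x) else bessel_K_nonint \<nu> x)"

text \<open>At the origin, where the kernel is singular, \<open>fs s\<close> takes the value \<open>0\<close>, since division by zero yields zero.\<close>

definition fs :: "real \<Rightarrow> real \<times> real \<Rightarrow> real" where
  "fs s = (\<lambda>(x, t). 1 / (x ^ 4 + t ^ 2) powr (s / 4))"

definition fs_hat_integrand :: "real \<Rightarrow> real \<Rightarrow> real \<Rightarrow> real \<Rightarrow> complex" where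
  "fs_hat_integrand s \<xi>\<^sub>1 \<xi>\<^sub>2 x =
    exp (- 2 * pi * \<i> * x * \<xi>\<^sub>1) *
    complex_of_real (\<bar>x\<bar> powr (1 - s / 2) * bessel_K ((s - 2) / 4) (2 * pi * \<bar>\<xi>\<^sub>2\<bar> * x ^ 2))"

end

theory Submission
  imports Defs "HOL-Probability.Probability" "HOL-Real_Asymp.Real_Asymp"
begin

text \<open>
Write \<open>a = s / 4\<close> and \<open>\<nu> = a - 1 / 2\<close>. The Gamma integral presents \<open>(x^4 + t^2) powr (- a)\<close> as a
superposition, with the positive weight \<open>\<tau> powr (a - 1)\<close>, of the integrable functions
\<open>exp (- \<tau> x^4) exp (- \<tau> t^2)\<close>. For each of these the Fourier transform can be moved to the test
function by Fubini, and it is a product of a Gaussian in \<open>\<eta>\<close> with the transform of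
\<open>exp (- \<tau> x^4)\<close>. The latter is bounded by its value at frequency 0, and with this bound the
superposition is a multiple of \<open>\<bar>\<eta>\<bar> powr (2 * a - 3 / 2)\<close>: the superposition converges because
\<open>a < 3 / 4\<close>, and the power is locally integrable because \<open>a > 1 / 4\<close>. So the transforms may be
superposed too (\<open>distr_fourier_fs\<close>), and the result is the function \<open>fs_transform\<close> below.

Integrating over \<open>\<tau>\<close> first turns \<open>fs_transform\<close> into the Fourier transform in \<open>x\<close> of
\<open>\<integral> \<tau> powr (\<nu> - 1) exp (- A / \<tau> - x^4 \<tau>) d\<tau>\<close>, which is Macdonald's integral for \<open>K\<^sub>\<nu>\<close>. To match
it with the series definition of \<open>K\<^sub>\<nu>\<close> one uses that the integral and the two series solve the same
first order system, so that their Wronskians are constant; the constants are read off at the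
origin (\<open>macdonald_eq_bessel_series\<close>). The integer order \<open>\<nu> = 0\<close> follows by continuity in \<open>\<nu>\<close>.

Positivity cannot be seen from this formula, because the transform of \<open>exp (- x^4)\<close> changes sign.
But Macdonald's integral is also a positive multiple of
\<open>\<integral>\<^sub>1\<^sup>\<infinity> exp (- z u) (u^2 - 1) powr (a - 1) du\<close> with \<open>z\<close> proportional to \<open>x^2\<close>
(\<open>macdonald_eq_const_bessel_laplace\<close>, again by a constant Wronskian, now evaluated at infinity). This
is a positive superposition of Gaussians in \<open>x\<close>, hence so is its Fourier transform. The outcome,
\<open>fs_transform_eq_profile\<close>, is a power of \<open>\<bar>\<eta>\<bar>\<close> times a positive function of \<open>\<xi>^2 / \<bar>\<eta>\<bar>\<close> which is bounded
and decays with the power \<open>2 * a - 3 / 2\<close>; these two bounds are exactly what the comparison with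
the function \<open>fs (3 - s)\<close>, which has the same anisotropic homogeneity, requires.

On the side of the test functions, a Schwartz function and its Fourier transform are both bounded by
a multiple of \<open>1 / ((1 + x^2) (1 + t^2))\<close>, and every integrability question reduces to integrating
\<open>fs\<close>, or a power of \<open>\<bar>\<eta>\<bar>\<close>, against this weight.

All integrals over \<open>\<tau> > 0\<close> are written in the variable \<open>v = ln \<tau>\<close>. They then run over the whole
line, and dilations and the inversion of \<open>\<tau>\<close> become translations and a reflection.
\<close>

section \<open>Integrals of Laplace type\<close>

lemma power_mult_exp_le:
  fixes y :: real assumes "0 \<le> y" shows "y ^ k * exp (- y) \<le> fact k"
proof -
  have s: "summable (\<lambda>n. y ^ n /\<^sub>R fact n)" by (rule summable_exp_generic)
  have "y ^ k / fact k = (\<Sum>n\<in>{k}. y ^ n /\<^sub>R fact n)" by (simp add: divide_inverse)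
  also have "\<dots> \<le> exp y"
    unfolding exp_def by (rule sum_le_suminf[OF s]) (use assms in auto)
  finally show ?thesis by (simp add: exp_minus field_simps)
qed

text \<open>Integrability at all \<open>q > 0\<close> already provides the majorants for differentiating under the integral
sign: a difference quotient at \<open>q\<close> is dominated by \<open>y exp (- (q / 2) y)\<close>, and a factor \<open>y\<close> costs
only another halving of the exponent.\<close>

lemma DERIV_laplace_integral:
  fixes w y :: "'a \<Rightarrow> real"
  assumes [measurable]: "w \<in> borel_measurable M" "y \<in> borel_measurable M"
    and y: "\<And>x. 0 \<le> y x"
    and int: "\<And>q. 0 < q \<Longrightarrow> integrable M (\<lambda>x. w x * exp (- q * y x))"
    and q: "0 < q"
  shows "integrable M (\<lambda>x. y x * w x * exp (- q * y x))" (is ?I)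
    and "((\<lambda>q. LINT x|M. w x * exp (- q * y x)) has_real_derivative
           - (LINT x|M. y x * w x * exp (- q * y x))) (at q)" (is ?D)
proof -
  have bound: "y x * exp (- p * y x) \<le> 2 / p * exp (- (p / 2) * y x)" if "p > 0" for x p
  proof -
    have "p / 2 * y x * exp (- (p / 2 * y x)) \<le> 1"
      using power_mult_exp_le[of "p / 2 * y x" 1] y[of x] that by simp
    then have "p / 2 * y x * exp (- (p / 2 * y x)) * exp (- (p / 2 * y x)) \<le> exp (- (p / 2 * y x))"
      by (intro mult_left_le_one_le) (use that y in auto)
    then show ?thesis using that by (simp add: field_simps flip: exp_add)
  qed
  have I: "integrable M (\<lambda>x. y x * w x * exp (- p * y x))" if "p > 0" for p
  proof (rule Bochner_Integration.integrable_bound)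
    show "integrable M (\<lambda>x. 2 / p * (w x * exp (- (p / 2) * y x)))"
      by (intro integrable_mult_right int) (use that in auto)
    show "AE x in M. norm (y x * w x * exp (- p * y x)) \<le> norm (2 / p * (w x * exp (- (p / 2) * y x)))"
      using mult_left_mono[OF bound[OF that], of "\<bar>w x\<bar>" for x] that y
      by (intro AE_I2) (simp add: abs_mult mult_ac)
  qed measurable
  show ?I using I q .
  have "((\<lambda>h. ((LINT x|M. w x * exp (- (q + h) * y x)) - (LINT x|M. w x * exp (- q * y x))) / h)
          \<longlongrightarrow> - (LINT x|M. y x * w x * exp (- q * y x))) (at 0)"
    unfolding tendsto_at_iff_sequentially comp_def
  proof (intro allI impI)
    fix X :: "nat \<Rightarrow> real" assume X: "\<forall>i. X i \<in> UNIV - {0}" "X \<longlonglongrightarrow> 0"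
    from X(2) q obtain N where N: "\<And>n. n \<ge> N \<Longrightarrow> \<bar>X n\<bar> < q / 2"
      using LIMSEQ_D[OF X(2), of "q / 2"] by auto
    define D where "D n x = (w x * exp (- (q + X n) * y x) - w x * exp (- q * y x)) / X n" for n x
    have "(\<lambda>n. LINT x|M. D (n + N) x) \<longlonglongrightarrow> (LINT x|M. - (y x * w x * exp (- q * y x)))"
    proof (rule integral_dominated_convergence[where w = "\<lambda>x. \<bar>y x * w x * exp (- (q / 2) * y x)\<bar>"])
      show "integrable M (\<lambda>x. \<bar>y x * w x * exp (- (q / 2) * y x)\<bar>)"
        using I[of "q / 2"] q by (intro integrable_abs) auto
      show "AE x in M. (\<lambda>n. D (n + N) x) \<longlonglongrightarrow> - (y x * w x * exp (- q * y x))"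
      proof (intro AE_I2)
        fix x
        have "((\<lambda>q. w x * exp (- q * y x)) has_real_derivative - (y x * w x * exp (- q * y x))) (at q)"
          by (auto intro!: derivative_eq_intros)
        then have "(\<lambda>n. D n x) \<longlonglongrightarrow> - (y x * w x * exp (- q * y x))"
          using X unfolding DERIV_def tendsto_at_iff_sequentially comp_def D_def by blast
        then show "(\<lambda>n. D (n + N) x) \<longlonglongrightarrow> - (y x * w x * exp (- q * y x))"
          by (rule LIMSEQ_ignore_initial_segment)
      qed
      show "AE x in M. norm (D (n + N) x) \<le> \<bar>y x * w x * exp (- (q / 2) * y x)\<bar>" for n
      proof (intro AE_I2)
        fix x
        (* From N on, the increments are smaller than q / 2, so all exponents involved are at least q / 2. *)
        define h where "h = X (n + N)"
        have h: "h \<noteq> 0" "\<bar>h\<bar> < q / 2" using X(1) N[of "n + N"] by (auto simp: h_def)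
        have "norm (exp (- (q + h) * y x) - exp (- q * y x)) \<le> y x * exp (- (q / 2) * y x) * norm ((q + h) - q)"
        proof (rule field_differentiable_bound[where S = "{q / 2..}" and f' = "\<lambda>r. - y x * exp (- r * y x)"])
          fix r assume "r \<in> {q / 2..}"
          then have "- r * y x \<le> - (q / 2) * y x" using y[of x] by (intro mult_right_mono) auto
          then show "norm (- y x * exp (- r * y x)) \<le> y x * exp (- (q / 2) * y x)"
            using y[of x] by (auto simp: abs_mult intro!: mult_left_mono)
        qed (use h q in \<open>auto intro!: derivative_eq_intros\<close>)
        from mult_left_mono[OF this, of "\<bar>w x\<bar>"]
        have "\<bar>w x\<bar> * \<bar>exp (- (q + h) * y x) - exp (- q * y x)\<bar> / \<bar>h\<bar> \<le> \<bar>w x\<bar> * (y x * exp (- (q / 2) * y x))"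
          using h by (simp add: divide_le_eq mult_ac)
        then show "norm (D (n + N) x) \<le> \<bar>y x * w x * exp (- (q / 2) * y x)\<bar>"
          using y[of x] unfolding D_def h_def[symmetric] right_diff_distrib[symmetric]
          by (simp add: abs_mult mult_ac)
      qed
    qed (auto simp: D_def)
    then have "(\<lambda>n. LINT x|M. D n x) \<longlonglongrightarrow> (LINT x|M. - (y x * w x * exp (- q * y x)))"
      by (rule LIMSEQ_offset)
    then have "(\<lambda>n. LINT x|M. D n x) \<longlonglongrightarrow> - (LINT x|M. y x * w x * exp (- q * y x))"
      by simp
    moreover have "\<forall>\<^sub>F n in sequentially. (LINT x|M. D n x) =
      ((LINT x|M. w x * exp (- (q + X n) * y x)) - (LINT x|M. w x * exp (- q * y x))) / X n"
      using eventually_ge_at_top[of N]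
    proof eventually_elim
      case (elim n)
      then have "q + X n > 0" using N[of n] by (auto simp: abs_if split: if_splits)
      then show ?case unfolding D_def using int[of "q + X n"] int[OF q] by simp
    qed
    ultimately show "(\<lambda>n. ((LINT x|M. w x * exp (- (q + X n) * y x)) - (LINT x|M. w x * exp (- q * y x))) / X n)
       \<longlonglongrightarrow> - (LINT x|M. y x * w x * exp (- q * y x))"
      by (rule Lim_transform_eventually)
  qed
  then show ?D unfolding DERIV_def .
qed

lemma exp_substitution:
  fixes f :: "real \<Rightarrow> real"
  assumes [measurable]: "f \<in> borel_measurable borel"
  shows "integrable lborel (\<lambda>v. exp v * f (exp v)) \<longleftrightarrow> integrable lborel (\<lambda>u. indicator {0<..} u * f u)" (is ?A)
    and "(LINT v|lborel. exp v * f (exp v)) = (LINT u|lborel. indicator {0<..} u * f u)" (is ?B)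
proof -
  have r: "range exp = {0::real<..}" by (auto simp: image_iff intro!: exp_ln[symmetric])
  have sub: "(\<lambda>v. exp v * f (exp v)) absolutely_integrable_on UNIV \<and> integral UNIV (\<lambda>v. exp v * f (exp v)) = b
      \<longleftrightarrow> f absolutely_integrable_on {0<..} \<and> integral {0<..} f = b" for b
    using has_absolute_integral_change_of_variables_1'[of UNIV exp exp f b] unfolding r
    by (auto intro!: inj_onI derivative_eq_intros)
  have 1: "(\<lambda>v. exp v * f (exp v)) absolutely_integrable_on UNIV \<longleftrightarrow> integrable lborel (\<lambda>v. exp v * f (exp v))"
    by (simp add: set_integrable_def integrable_completion)
  have 2: "f absolutely_integrable_on {0<..} \<longleftrightarrow> integrable lborel (\<lambda>u. indicator {0<..} u * f u)"
    by (simp add: set_integrable_def integrable_completion)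
  show ?A using sub 1 2 by blast
  show ?B
  proof (cases "integrable lborel (\<lambda>u. indicator {0<..} u * f u)")
    case True
    then have L: "integrable lborel (\<lambda>v. exp v * f (exp v))" using \<open>?A\<close> by simp
    have "integral {0<..} f = integral UNIV (\<lambda>u. indicator {0<..} u * f u)"
      by (subst integral_restrict_UNIV[symmetric]) (auto intro!: arg_cong[where f = "integral UNIV"] simp: indicator_def)
    then show ?thesis using sub 1 2 integral_lborel[OF L] integral_lborel[OF True] L True by metis
  next
    case False
    then show ?thesis using \<open>?A\<close> by (simp add: not_integrable_integral_eq)
  qed
qed

lemma integrable_powr_exp:
  fixes b z :: real assumes "0 < b" "0 < z"
  shows "integrable lborel (\<lambda>u. indicator {0<..} u * u powr (b - 1) * exp (- z * u))"
proof -
  have "(\<lambda>t. complex_of_real t powr (of_real b - 1) / of_real (exp (z * t))) absolutely_integrable_on {0<..}"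
    using absolutely_integrable_Gamma_integral[of "of_real b" z] assms by simp
  then have "integrable lebesgue (\<lambda>t. norm (indicator {0<..} t *\<^sub>R (complex_of_real t powr (of_real b - 1) / of_real (exp (z * t)))))"
    unfolding set_integrable_def by (rule integrable_norm)
  then have "integrable lebesgue (\<lambda>u. indicator {0<..} u * u powr (b - 1) * exp (- z * u))"
    by (rule Bochner_Integration.integrable_cong[THEN iffD1, rotated -1])
       (auto simp: indicator_def norm_divide norm_powr_real_powr norm_mult exp_minus divide_inverse norm_inverse)
  then show ?thesis by (subst (asm) integrable_completion) auto
qed

lemma Gamma_exp_integral:
  fixes \<nu> :: real assumes "0 < \<nu>"
  shows "integrable lborel (\<lambda>v. exp (\<nu> * v - exp v))"
    and "(LINT v|lborel. exp (\<nu> * v - exp v)) = Gamma \<nu>"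
proof -
  let ?f = "\<lambda>t::real. t powr (\<nu> - 1) / exp t"
  have I: "integrable lborel (\<lambda>t. indicator {0<..} t * ?f t)"
    using integrable_powr_exp[OF assms zero_less_one] by (simp add: exp_minus field_simps)
  have "(?f has_integral Gamma \<nu>) {0<..}"
    using Gamma_integral_real[OF assms] by (subst has_integral_spike_set_eq[where T = "{0..}"])
      (auto intro!: negligible_subset[of "{0}"] negligible_sing)
  then have "((\<lambda>t. if t \<in> {0<..} then ?f t else 0) has_integral Gamma \<nu>) UNIV"
    by (simp only: has_integral_restrict_UNIV)
  moreover have "(\<lambda>t. if t \<in> {0<..} then ?f t else 0) = (\<lambda>t. indicator {0<..} t * ?f t)"
    by (auto simp: fun_eq_iff)
  ultimately have val: "(LINT t|lborel. indicator {0<..} t * ?f t) = Gamma \<nu>"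
    using has_integral_integral_lborel[OF I] has_integral_unique by metis
  have eq: "(\<lambda>v. exp v * ?f (exp v)) = (\<lambda>v. exp (\<nu> * v - exp v))"
    by (auto simp: powr_def exp_diff left_diff_distrib exp_minus field_simps)
  show "integrable lborel (\<lambda>v. exp (\<nu> * v - exp v))"
    using exp_substitution(1)[of ?f] I unfolding eq by simp
  show "(LINT v|lborel. exp (\<nu> * v - exp v)) = Gamma \<nu>"
    using exp_substitution(2)[of ?f] val unfolding eq by simp
qed

section \<open>Macdonald's integral\<close>

text \<open>In the variable \<open>\<tau> = exp v\<close> this is \<open>\<integral>\<^sub>0\<^sup>\<infinity> \<tau> powr (\<nu> - 1) exp (- \<tau> - q / \<tau>) d\<tau>\<close>, that is
\<open>2 q powr (\<nu> / 2) K\<^sub>\<nu> (2 sqrt q)\<close>. The power of \<open>q\<close> is left in the function because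
then both the derivative and the reflection \<open>\<nu> \<mapsto> - \<nu>\<close> take a simple form.\<close>

definition macdonald :: "real \<Rightarrow> real \<Rightarrow> real" where
  "macdonald \<nu> q = (LINT v|lborel. exp (\<nu> * v - exp v - q * exp (- v)))"

lemma macdonald_integrable:
  fixes \<nu> q :: real
  assumes "0 < q" shows "integrable lborel (\<lambda>v. exp (\<nu> * v - exp v - q * exp (- v)))"
proof -
  (* For nonpositive order the decay of exp (- q exp (- v)) as v tends to minus infinity has to be
     used; it beats exp (k v) for every k, which raises the order by k. *)
  obtain k :: nat where "- \<nu> < k" using reals_Archimedean2 by blast
  then have k: "\<nu> + k > 0" by simp
  show ?thesis
  proof (rule Bochner_Integration.integrable_bound)
    show "integrable lborel (\<lambda>v. fact k / q ^ k * exp ((\<nu> + k) * v - exp v))"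
      by (intro integrable_mult_right Gamma_exp_integral k)
    have "exp (\<nu> * v - exp v - q * exp (- v)) \<le> fact k / q ^ k * exp ((\<nu> + k) * v - exp v)" for v
    proof -
      have "(q * exp (- v)) ^ k * exp (- (q * exp (- v))) \<le> fact k"
        using assms by (intro power_mult_exp_le) auto
      moreover have "exp (- v) ^ k = inverse (exp (k * v))"
        by (simp add: exp_minus exp_of_nat_mult power_inverse)
      ultimately have "exp (- (q * exp (- v))) \<le> fact k / q ^ k * exp (k * v)"
        using assms by (simp add: power_mult_distrib field_simps)
      then have "exp (\<nu> * v - exp v) * exp (- (q * exp (- v))) \<le> exp (\<nu> * v - exp v) * (fact k / q ^ k * exp (k * v))"
        by (rule mult_left_mono) simp
      moreover have "exp (\<nu> * v - exp v) * exp (- (q * exp (- v))) = exp (\<nu> * v - exp v - q * exp (- v))"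
        "exp (\<nu> * v - exp v) * exp (k * v) = exp ((\<nu> + k) * v - exp v)"
        by (simp_all add: algebra_simps flip: exp_add)
      ultimately show ?thesis by (simp add: mult_ac)
    qed
    then show "AE v in lborel. norm (exp (\<nu> * v - exp v - q * exp (- v))) \<le> norm (fact k / q ^ k * exp ((\<nu> + k) * v - exp v))"
      using assms by (intro AE_I2) simp
  qed measurable
qed

lemma macdonald_pos: assumes "0 < q" shows "0 < macdonald \<nu> q"
proof -
  have "0 \<noteq> macdonald \<nu> q" unfolding macdonald_def
    using integral_nonneg_eq_0_iff_AE[OF macdonald_integrable[OF assms, of \<nu>]]
    by (auto simp: trivial_limit_def[symmetric] ae_filter_eq_bot_iff)
  moreover have "0 \<le> macdonald \<nu> q" unfolding macdonald_def by (rule integral_nonneg_AE) simp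
  ultimately show ?thesis by simp
qed

lemma macdonald_antimono: assumes "0 < p" "p \<le> q" shows "macdonald \<nu> q \<le> macdonald \<nu> p"
  unfolding macdonald_def using assms by (intro integral_mono macdonald_integrable) (auto intro!: mult_right_mono)

lemma DERIV_macdonald [derivative_intros]: assumes "0 < q" shows "(macdonald \<nu> has_real_derivative - macdonald (\<nu> - 1) q) (at q)"
proof -
  have "((\<lambda>q. LINT v|lborel. exp (\<nu> * v - exp v) * exp (- q * exp (- v))) has_real_derivative
     - (LINT v|lborel. exp (- v) * exp (\<nu> * v - exp v) * exp (- q * exp (- v)))) (at q)"
    by (rule DERIV_laplace_integral(2)) (use assms macdonald_integrable[of _ \<nu>] in \<open>auto simp flip: exp_add\<close>)
  moreover have "(\<lambda>q. LINT v|lborel. exp (\<nu> * v - exp v) * exp (- q * exp (- v))) = macdonald \<nu>"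
    by (auto simp: macdonald_def simp flip: exp_add)
  moreover have "(LINT v|lborel. exp (- v) * exp (\<nu> * v - exp v) * exp (- q * exp (- v))) = macdonald (\<nu> - 1) q"
    by (auto simp: macdonald_def left_diff_distrib simp flip: exp_add intro!: Bochner_Integration.integral_cong)
  ultimately show ?thesis by simp
qed

text \<open>This is the substitution \<open>\<tau> \<mapsto> q / \<tau>\<close>, which exchanges the two exponentials.\<close>

lemma macdonald_reflect: assumes "0 < q" shows "macdonald \<nu> q = q powr \<nu> * macdonald (- \<nu>) q"
proof -
  have eq: "exp (\<nu> * (ln q + - 1 * v) - exp (ln q + - 1 * v) - q * exp (- (ln q + - 1 * v))) =
      q powr \<nu> * exp (- \<nu> * v - exp v - q * exp (- v))" for v
  proof -
    have "exp (ln q + - 1 * v) = q * exp (- v)" "q * exp (- (ln q + - 1 * v)) = exp v"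
      using assms by (simp_all add: exp_add exp_diff exp_minus divide_inverse)
    then show ?thesis using assms by (simp add: powr_def algebra_simps flip: exp_add)
  qed
  show ?thesis
    unfolding macdonald_def by (subst lborel_integral_real_affine[of "-1" _ "ln q"]) (simp_all only: eq, simp_all)
qed

text \<open>Translating \<open>v\<close> by \<open>ln B\<close> removes one of the two parameters.\<close>

lemma macdonald_two_parameters:
  assumes "0 < A" "0 < B"
  shows "integrable lborel (\<lambda>v. exp (\<nu> * v - A * exp (- v) - B * exp v))"
    and "(LINT v|lborel. exp (\<nu> * v - A * exp (- v) - B * exp v)) = B powr (- \<nu>) * macdonald \<nu> (A * B)"
proof -
  have eq: "exp (\<nu> * (- ln B + 1 * v) - A * exp (- (- ln B + 1 * v)) - B * exp (- ln B + 1 * v)) =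
     B powr (- \<nu>) * exp (\<nu> * v - exp v - (A * B) * exp (- v))" for v
  proof -
    have "exp (- ln B + 1 * v) = exp v / B" "A * exp (- (- ln B + 1 * v)) = A * B * exp (- v)"
      using assms by (simp_all add: exp_add exp_diff exp_minus divide_inverse)
    then show ?thesis using assms by (simp add: powr_def algebra_simps flip: exp_add)
  qed
  have "integrable lborel (\<lambda>v. exp (\<nu> * (- ln B + 1 * v) - A * exp (- (- ln B + 1 * v)) - B * exp (- ln B + 1 * v)))"
    unfolding eq using assms by (intro integrable_mult_right macdonald_integrable mult_pos_pos)
  then show "integrable lborel (\<lambda>v. exp (\<nu> * v - A * exp (- v) - B * exp v))"
    by (subst (asm) lborel_integrable_real_affine_iff) auto
  show "(LINT v|lborel. exp (\<nu> * v - A * exp (- v) - B * exp v)) = B powr (- \<nu>) * macdonald \<nu> (A * B)"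
    by (subst lborel_integral_real_affine[of 1 _ "- ln B"]) (simp_all only: eq macdonald_def, simp_all)
qed

lemma tendsto_macdonald_0: assumes "0 < \<nu>" shows "(macdonald \<nu> \<longlongrightarrow> Gamma \<nu>) (at_right 0)"
  unfolding tendsto_at_iff_sequentially comp_def
proof (intro allI impI)
  fix X :: "nat \<Rightarrow> real" assume X: "\<forall>i. X i \<in> {0<..} - {0}" "X \<longlonglongrightarrow> 0"
  have "(\<lambda>n. LINT v|lborel. exp (\<nu> * v - exp v - X n * exp (- v))) \<longlonglongrightarrow> (LINT v|lborel. exp (\<nu> * v - exp v))"
  proof (rule integral_dominated_convergence[OF _ _ Gamma_exp_integral(1)[OF assms]])
    have "(\<lambda>n. exp (\<nu> * v - exp v - X n * exp (- v))) \<longlonglongrightarrow> exp (\<nu> * v - exp v - 0 * exp (- v))" for v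
      by (intro tendsto_intros X)
    then show "AE v in lborel. (\<lambda>n. exp (\<nu> * v - exp v - X n * exp (- v))) \<longlonglongrightarrow> exp (\<nu> * v - exp v)"
      by simp
  qed (use X in \<open>auto simp: less_imp_le\<close>)
  then show "(\<lambda>n. macdonald \<nu> (X n)) \<longlonglongrightarrow> Gamma \<nu>"
    unfolding macdonald_def Gamma_exp_integral(2)[OF assms] .
qed

text \<open>Continuity in the order: near \<open>\<nu>\<close> the integrand is dominated by the sum of the integrands of
orders \<open>\<nu> + 1\<close> and \<open>\<nu> - 1\<close>.\<close>

lemma tendsto_macdonald_order: assumes "0 < q" shows "((\<lambda>\<mu>. macdonald \<mu> q) \<longlongrightarrow> macdonald \<nu> q) (at \<nu>)"
  unfolding tendsto_at_iff_sequentially comp_def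
proof (intro allI impI)
  fix X :: "nat \<Rightarrow> real" assume X: "\<forall>i. X i \<in> UNIV - {\<nu>}" "X \<longlonglongrightarrow> \<nu>"
  from X(2) obtain N where N: "\<And>n. n \<ge> N \<Longrightarrow> \<bar>X n - \<nu>\<bar> < 1"
    using LIMSEQ_D[OF X(2), of 1] by auto
  let ?e = "\<lambda>\<mu> v::real. exp (\<mu> * v - exp v - q * exp (- v))"
  have "(\<lambda>n. LINT v|lborel. ?e (X (n + N)) v) \<longlonglongrightarrow> (LINT v|lborel. ?e \<nu> v)"
  proof (rule integral_dominated_convergence[where w = "\<lambda>v. ?e (\<nu> + 1) v + ?e (\<nu> - 1) v"])
    show "integrable lborel (\<lambda>v. ?e (\<nu> + 1) v + ?e (\<nu> - 1) v)"
      by (intro Bochner_Integration.integrable_add macdonald_integrable assms)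
    have "(\<lambda>n. ?e (X (n + N)) v) \<longlonglongrightarrow> ?e \<nu> v" for v
      by (intro tendsto_intros LIMSEQ_ignore_initial_segment X)
    then show "AE v in lborel. (\<lambda>n. ?e (X (n + N)) v) \<longlonglongrightarrow> ?e \<nu> v" by simp
    have "?e (X (n + N)) v \<le> ?e (\<nu> + 1) v + ?e (\<nu> - 1) v" for n v
    proof -
      have b: "\<nu> - 1 \<le> X (n + N)" "X (n + N) \<le> \<nu> + 1" using N[of "n + N"] by auto
      show ?thesis
      proof (cases "v \<ge> 0")
        case True
        then have "?e (X (n + N)) v \<le> ?e (\<nu> + 1) v" using b by (simp add: mult_right_mono)
        then show ?thesis by (simp add: add_increasing2)
      next
        case False
        then have "?e (X (n + N)) v \<le> ?e (\<nu> - 1) v" using b by (simp add: mult_right_mono_neg)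
        then show ?thesis by (simp add: add_increasing)
      qed
    qed
    then show "AE v in lborel. norm (?e (X (n + N)) v) \<le> ?e (\<nu> + 1) v + ?e (\<nu> - 1) v" for n by simp
  qed measurable
  then show "(\<lambda>n. macdonald (X n) q) \<longlonglongrightarrow> macdonald \<nu> q"
    unfolding macdonald_def by (rule LIMSEQ_offset)
qed

section \<open>The Bessel series and the identification of Macdonald's integral\<close>

definition bessel_coeff :: "real \<Rightarrow> nat \<Rightarrow> real" where
  "bessel_coeff c n = rGamma (real n + 1 + c) / fact n"

text \<open>The entire factor of the Bessel function: \<open>I\<^sub>c z = (z / 2) powr c * bessel_series c (z^2 / 4)\<close>.
The reciprocal Gamma function keeps the coefficients regular at the poles of Gamma.\<close>

definition bessel_series :: "real \<Rightarrow> real \<Rightarrow> real" where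
  "bessel_series c q = (\<Sum>n. bessel_coeff c n * q ^ n)"

lemma bessel_coeff_Suc: "bessel_coeff c (Suc n) * (real n + 1) * (real n + 1 + c) = bessel_coeff c n"
proof -
  have "(real n + 1 + c) * rGamma (real n + 1 + c + 1) = rGamma (real n + 1 + c)"
    by (rule rGamma_plus1)
  moreover have "real (Suc n) + 1 + c = real n + 1 + c + 1" by simp
  moreover have "(fact (Suc n) :: real) = (real n + 1) * fact n" by simp
  ultimately show ?thesis unfolding bessel_coeff_def
    by (simp only: times_divide_eq_left) (simp add: mult_ac)
qed

lemma summable_bessel_coeff:
  assumes "- 1 < c" shows "summable (\<lambda>n. bessel_coeff c n * q ^ n)"
proof -
  obtain N :: nat where N: "2 * \<bar>q\<bar> < N" using reals_Archimedean2 by blast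
  show ?thesis
  proof (rule summable_ratio_test[of "1 / 2" "Suc N"])
    fix n assume n: "Suc N \<le> n"
    define d where "d = (real n + 1) * (real n + 1 + c)"
    have "1 \<le> real n" using n by simp
    have "2 * \<bar>q\<bar> \<le> real n + 1" using N n by simp
    also have "\<dots> \<le> d" using assms \<open>1 \<le> real n\<close> unfolding d_def
      using mult_left_mono[of 1 "real n + 1 + c" "real n + 1"] by simp
    finally have d: "2 * \<bar>q\<bar> \<le> d" .
    have "\<bar>bessel_coeff c (Suc n)\<bar> * d = \<bar>bessel_coeff c n\<bar>"
      using bessel_coeff_Suc[of c n, symmetric] assms \<open>1 \<le> real n\<close> by (simp add: d_def abs_mult)
    then have "2 * (\<bar>bessel_coeff c (Suc n)\<bar> * \<bar>q\<bar>) \<le> \<bar>bessel_coeff c n\<bar>"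
      using mult_left_mono[OF d, of "\<bar>bessel_coeff c (Suc n)\<bar>"] by simp
    from mult_right_mono[OF this, of "\<bar>q\<bar> ^ n"]
    show "norm (bessel_coeff c (Suc n) * q ^ Suc n) \<le> 1 / 2 * norm (bessel_coeff c n * q ^ n)"
      by (simp add: abs_mult power_abs mult_ac)
  qed simp
qed

lemma diffs_bessel_coeff: "diffs (bessel_coeff c) = bessel_coeff (c + 1)"
  by (auto simp: diffs_def bessel_coeff_def fun_eq_iff add_ac)

lemma DERIV_bessel_series [derivative_intros]:
  assumes "- 1 < c" shows "(bessel_series c has_real_derivative bessel_series (c + 1) q) (at q)"
proof -
  have "((\<lambda>x. \<Sum>n. bessel_coeff c n * x ^ n) has_real_derivative (\<Sum>n. diffs (bessel_coeff c) n * q ^ n)) (at q)"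
    by (rule termdiffs_strong_converges_everywhere) (rule summable_bessel_coeff[OF assms])
  then show ?thesis by (simp add: bessel_series_def[abs_def] diffs_bessel_coeff)
qed

text \<open>Together with \<open>DERIV_bessel_series\<close> this says that \<open>q powr c * bessel_series c q\<close> has the
derivative \<open>q powr (c - 1) * bessel_series (c - 1) q\<close>, so differentiation lowers the order,
as it does, up to the sign, for Macdonald's integral.\<close>

lemma bessel_series_recurrence:
  assumes "0 < c" shows "bessel_series (c - 1) q = c * bessel_series c q + q * bessel_series (c + 1) q"
proof -
  have s: "(\<lambda>n. bessel_coeff c n * q ^ n) sums bessel_series c q"
    unfolding bessel_series_def using assms by (intro summable_sums summable_bessel_coeff) simp
  have "(\<lambda>n. diffs (bessel_coeff c) n * q ^ n) sums bessel_series (c + 1) q"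
    unfolding diffs_bessel_coeff bessel_series_def using assms by (intro summable_sums summable_bessel_coeff) simp
  then have "(\<lambda>n. q * (diffs (bessel_coeff c) n * q ^ n)) sums (q * bessel_series (c + 1) q)"
    by (rule sums_mult)
  then have "(\<lambda>n. real (Suc n) * bessel_coeff c (Suc n) * q ^ Suc n) sums (q * bessel_series (c + 1) q)"
    by (simp add: diffs_def mult_ac)
  then have "(\<lambda>n. real n * bessel_coeff c n * q ^ n) sums (q * bessel_series (c + 1) q)"
    by (subst (asm) sums_Suc_iff) simp
  from sums_add[OF sums_mult[OF s, of c] this]
  have "(\<lambda>n. (real n + c) * bessel_coeff c n * q ^ n) sums (c * bessel_series c q + q * bessel_series (c + 1) q)"
    by (simp add: algebra_simps)
  moreover have "(real n + c) * bessel_coeff c n = bessel_coeff (c - 1) n" for n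
    using rGamma_plus1[of "real n + c"] by (simp add: bessel_coeff_def add_ac)
  ultimately show ?thesis by (simp add: bessel_series_def sums_iff)
qed

lemma DERIV_powr_bessel_series:
  assumes "0 < c" "0 < q"
  shows "((\<lambda>q. q powr c * bessel_series c q) has_real_derivative q powr (c - 1) * bessel_series (c - 1) q) (at q)"
proof -
  have q: "q powr c = q * q powr (c - 1)" using assms by (simp add: powr_mult_base)
  have "((\<lambda>q. q powr c * bessel_series c q) has_real_derivative
      q powr c * bessel_series (c + 1) q + c * q powr (c - 1) * bessel_series c q) (at q)"
    using assms by (intro DERIV_mult' DERIV_bessel_series has_real_derivative_powr) auto
  moreover have "q powr c * bessel_series (c + 1) q + c * q powr (c - 1) * bessel_series c q = q powr (c - 1) * bessel_series (c - 1) q"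
    unfolding bessel_series_recurrence[OF assms(1)] q by (simp only: algebra_simps)
  ultimately show ?thesis by simp
qed

lemma bessel_series_0: "bessel_series c 0 = rGamma (1 + c)"
proof -
  have "(\<lambda>n. bessel_coeff c n * 0 ^ n) = (\<lambda>n. if n = 0 then rGamma (1 + c) else 0)"
    by (auto simp: bessel_coeff_def fun_eq_iff)
  then show ?thesis unfolding bessel_series_def using sums_single[of 0 "\<lambda>_. rGamma (1 + c)"] by (simp add: sums_iff)
qed

lemma tendsto_bessel_series: assumes "- 1 < c" shows "(bessel_series c \<longlongrightarrow> rGamma (1 + c)) (at_right 0)"
proof -
  have "(bessel_series c \<longlongrightarrow> bessel_series c 0) (at 0)"
    using DERIV_bessel_series[OF assms] DERIV_isCont isCont_def by blast
  then show ?thesis unfolding bessel_series_0 by (rule tendsto_within_subset) simp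
qed

lemma rGamma_reflection_real: "rGamma x * rGamma (1 - x) = sin (pi * x) / pi" for x :: real
proof -
  have "complex_of_real (rGamma x * rGamma (1 - x)) = complex_of_real (sin (pi * x) / pi)"
    using rGamma_reflection_complex[of "of_real x"]
    by (simp flip: rGamma_complex_of_real sin_of_real)
  then show ?thesis by (simp only: of_real_eq_iff)
qed

lemma const_of_DERIV_0_tendsto:
  fixes f :: "real \<Rightarrow> real"
  assumes "\<And>q. 0 < q \<Longrightarrow> (f has_real_derivative 0) (at q)" "(f \<longlongrightarrow> c) (at_right 0)" "0 < q"
  shows "f q = c"
proof -
  have "f x = f q" if "0 < x" for x
  proof -
    obtain k where "\<And>x. x \<in> {0<..} \<Longrightarrow> f x = k"
      using has_field_derivative_zero_constant[of "{0<..}" f] assms(1)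
      by (meson convex_real_interval(3) greaterThan_iff has_field_derivative_at_within)
    then show ?thesis using that assms(3) by simp
  qed
  then have "(f \<longlongrightarrow> f q) (at_right 0)"
    by (intro tendsto_eventually eventually_mono[OF eventually_at_right_less])
  then show ?thesis using assms(2) tendsto_unique trivial_limit_at_right_real by blast
qed

text \<open>The functions \<open>y1 = bessel_series (- \<nu>) q\<close>, \<open>y2 = q powr \<nu> * bessel_series \<nu> q\<close> and
Macdonald's integral all solve \<open>(q powr (1 - \<nu>) y')' = q powr (- \<nu>) y\<close>. Hence the three
Wronskians multiplied by \<open>q powr (1 - \<nu>)\<close> are constant, and the values of the functions and of
their weighted derivatives at \<open>0\<close> determine them; the reflection formula of the Gamma function
enters there. A solution is recovered from its Wronskians with a fundamental system.\<close>

lemma macdonald_eq_bessel_series: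
  assumes \<nu>: "0 < \<nu>" "\<nu> < 1" and q: "0 < q"
  shows "macdonald \<nu> q = pi / sin (pi * \<nu>) * (bessel_series (- \<nu>) q - q powr \<nu> * bessel_series \<nu> q)"
proof -
  define y1 y1' y2 where "y1 = bessel_series (- \<nu>)" and "y1' = (\<lambda>q. q powr (1 - \<nu>) * bessel_series (1 - \<nu>) q)"
    and "y2 = (\<lambda>q. q powr \<nu> * bessel_series \<nu> q)"
  have pw: "q powr (1 - \<nu>) * bessel_series (1 - \<nu>) q * q powr (\<nu> - 1) = bessel_series (1 - \<nu>) q" if "q > 0" for q
    using that by (simp add: mult_ac flip: powr_add)
  have dy1: "(y1 has_real_derivative q powr (\<nu> - 1) * y1' q) (at q)" if "q > 0" for q
    unfolding y1_def y1'_def using DERIV_bessel_series[of "- \<nu>" q] \<nu> that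
    by (simp add: mult_ac flip: powr_add)
  have dy1': "(y1' has_real_derivative q powr (- \<nu>) * y1 q) (at q)" if "q > 0" for q
    unfolding y1_def y1'_def using DERIV_powr_bessel_series[of "1 - \<nu>" q] \<nu> that by simp
  have dy2: "(y2 has_real_derivative q powr (\<nu> - 1) * bessel_series (\<nu> - 1) q) (at q)" if "q > 0" for q
    unfolding y2_def using DERIV_powr_bessel_series[of \<nu> q] \<nu> that by simp
  have dy2': "(bessel_series (\<nu> - 1) has_real_derivative q powr (- \<nu>) * y2 q) (at q)" if "q > 0" for q
    unfolding y2_def using DERIV_bessel_series[of "\<nu> - 1" q] \<nu> that by (simp add: mult.assoc[symmetric] flip: powr_add)
  have dF: "(macdonald \<nu> has_real_derivative - (q powr (\<nu> - 1) * macdonald (1 - \<nu>) q)) (at q)" if "q > 0" for q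
    using DERIV_macdonald[OF that, of \<nu>] macdonald_reflect[OF that, of "\<nu> - 1"] by simp
  have dF': "(macdonald (1 - \<nu>) has_real_derivative - (q powr (- \<nu>) * macdonald \<nu> q)) (at q)" if "q > 0" for q
    using DERIV_macdonald[OF that, of "1 - \<nu>"] macdonald_reflect[OF that, of "- \<nu>"] by simp
  have p0: "((\<lambda>q. q powr r) \<longlongrightarrow> 0) (at_right 0)" if "r > 0" for r :: real
    using that by real_asymp
  have ty1: "(y1 \<longlongrightarrow> rGamma (1 - \<nu>)) (at_right 0)" "(bessel_series (\<nu> - 1) \<longlongrightarrow> rGamma \<nu>) (at_right 0)"
    using tendsto_bessel_series[of "- \<nu>"] tendsto_bessel_series[of "\<nu> - 1"] \<nu> by (auto simp: y1_def)
  have ty1': "(y1' \<longlongrightarrow> 0) (at_right 0)" "(y2 \<longlongrightarrow> 0) (at_right 0)"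
    using tendsto_mult[OF p0 tendsto_bessel_series, of "1 - \<nu>" "1 - \<nu>"] tendsto_mult[OF p0 tendsto_bessel_series, of \<nu> \<nu>] \<nu>
    by (auto simp: y1'_def y2_def)
  have tF: "(macdonald \<nu> \<longlongrightarrow> Gamma \<nu>) (at_right 0)" "(macdonald (1 - \<nu>) \<longlongrightarrow> Gamma (1 - \<nu>)) (at_right 0)"
    using tendsto_macdonald_0 \<nu> by auto
  have G: "Gamma \<nu> \<noteq> 0" "Gamma (1 - \<nu>) \<noteq> 0" using Gamma_real_pos[of \<nu>] Gamma_real_pos[of "1 - \<nu>"] \<nu> by linarith+
  note lims = tendsto_add tendsto_minus tendsto_diff tendsto_mult ty1 ty1' tF
  (* The weighted derivatives are: y1' for y1, bessel_series (nu - 1) for y2, and minus the integral of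
     order 1 - nu for Macdonald's integral. *)
  have W1: "- y1 q * macdonald (1 - \<nu>) q - y1' q * macdonald \<nu> q = - 1"
  proof (rule const_of_DERIV_0_tendsto[OF _ _ q])
    show "((\<lambda>q. - y1 q * macdonald (1 - \<nu>) q - y1' q * macdonald \<nu> q) has_real_derivative 0) (at q)" if "q > 0" for q
      by (rule derivative_eq_intros dy1 dy1' dF dF' that refl)+ (simp add: algebra_simps)
    have "((\<lambda>q. - y1 q * macdonald (1 - \<nu>) q - y1' q * macdonald \<nu> q) \<longlongrightarrow> - rGamma (1 - \<nu>) * Gamma (1 - \<nu>) - 0 * Gamma \<nu>) (at_right 0)"
      by (intro lims)
    then show "((\<lambda>q. - y1 q * macdonald (1 - \<nu>) q - y1' q * macdonald \<nu> q) \<longlongrightarrow> - 1) (at_right 0)"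
      using G by (simp add: rGamma_inverse_Gamma)
  qed
  have W2: "- y2 q * macdonald (1 - \<nu>) q - bessel_series (\<nu> - 1) q * macdonald \<nu> q = - 1"
  proof (rule const_of_DERIV_0_tendsto[OF _ _ q])
    show "((\<lambda>q. - y2 q * macdonald (1 - \<nu>) q - bessel_series (\<nu> - 1) q * macdonald \<nu> q) has_real_derivative 0) (at q)" if "q > 0" for q
      by (rule derivative_eq_intros dy2 dy2' dF dF' that refl)+ (simp add: algebra_simps)
    have "((\<lambda>q. - y2 q * macdonald (1 - \<nu>) q - bessel_series (\<nu> - 1) q * macdonald \<nu> q) \<longlongrightarrow> - 0 * Gamma (1 - \<nu>) - rGamma \<nu> * Gamma \<nu>) (at_right 0)"
      by (intro lims)
    then show "((\<lambda>q. - y2 q * macdonald (1 - \<nu>) q - bessel_series (\<nu> - 1) q * macdonald \<nu> q) \<longlongrightarrow> - 1) (at_right 0)"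
      using G by (simp add: rGamma_inverse_Gamma)
  qed
  have W12: "y1 q * bessel_series (\<nu> - 1) q - y1' q * y2 q = sin (pi * \<nu>) / pi"
  proof (rule const_of_DERIV_0_tendsto[OF _ _ q])
    show "((\<lambda>q. y1 q * bessel_series (\<nu> - 1) q - y1' q * y2 q) has_real_derivative 0) (at q)" if "q > 0" for q
      by (rule derivative_eq_intros dy1 dy1' dy2 dy2' that refl)+ (simp add: algebra_simps)
    have "((\<lambda>q. y1 q * bessel_series (\<nu> - 1) q - y1' q * y2 q) \<longlongrightarrow> rGamma (1 - \<nu>) * rGamma \<nu> - 0 * 0) (at_right 0)"
      by (intro lims)
    then show "((\<lambda>q. y1 q * bessel_series (\<nu> - 1) q - y1' q * y2 q) \<longlongrightarrow> sin (pi * \<nu>) / pi) (at_right 0)"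
      using rGamma_reflection_real[of \<nu>] by (simp add: mult.commute)
  qed
  have "macdonald \<nu> q * (y1 q * bessel_series (\<nu> - 1) q - y1' q * y2 q) =
      y2 q * (- y1 q * macdonald (1 - \<nu>) q - y1' q * macdonald \<nu> q) - y1 q * (- y2 q * macdonald (1 - \<nu>) q - bessel_series (\<nu> - 1) q * macdonald \<nu> q)"
    by (simp add: algebra_simps)
  then have "macdonald \<nu> q * (sin (pi * \<nu>) / pi) = y1 q - y2 q" unfolding W1 W2 W12 by simp
  moreover have "sin (pi * \<nu>) > 0" using \<nu> by (intro sin_gt_zero) auto
  ultimately show ?thesis by (simp add: y1_def y2_def field_simps)
qed

lemma bessel_I_eq_bessel_series:
  assumes "- 1 < \<nu>" "0 < z"
  shows "bessel_I \<nu> z = (z / 2) powr \<nu> * bessel_series \<nu> (z\<^sup>2 / 4)"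
proof -
  have "(z / 2) powr (\<nu> + 2 * real n) / (fact n * Gamma (real n + \<nu> + 1)) =
      (z / 2) powr \<nu> * (bessel_coeff \<nu> n * (z\<^sup>2 / 4) ^ n)" for n
  proof -
    have "(z / 2) powr (2 * real n) = (z / 2) ^ (2 * n)"
      using assms powr_realpow[of "z / 2" "2 * n"] by simp
    also have "\<dots> = (z\<^sup>2 / 4) ^ n" by (simp add: power_mult power_divide)
    finally have "(z / 2) powr (\<nu> + 2 * real n) = (z / 2) powr \<nu> * (z\<^sup>2 / 4) ^ n"
      by (simp add: powr_add)
    moreover have "bessel_coeff \<nu> n = 1 / (fact n * Gamma (real n + \<nu> + 1))"
      unfolding bessel_coeff_def rGamma_inverse_Gamma by (simp add: add_ac field_simps)
    ultimately show ?thesis by (simp only:) simp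
  qed
  then show ?thesis
    unfolding bessel_I_def bessel_series_def using summable_bessel_coeff[OF assms(1)] by (simp add: suminf_mult)
qed

text \<open>For positive order this is \<open>macdonald_eq_bessel_series\<close>; both sides are compatible with
\<open>\<nu> \<mapsto> - \<nu>\<close>, which gives negative orders.\<close>

lemma bessel_K_nonint_eq_macdonald:
  assumes "\<bar>\<nu>\<bar> < 1" "\<nu> \<noteq> 0" "0 < z"
  shows "bessel_K_nonint \<nu> z = (z / 2) powr (- \<nu>) * macdonald \<nu> (z\<^sup>2 / 4) / 2"
proof -
  have sq: "(z\<^sup>2 / 4) powr \<mu> = (z / 2) powr \<mu> * (z / 2) powr \<mu>" for \<mu> :: real
    using assms by (simp add: power2_eq_square flip: powr_mult)
  have pos: "bessel_K_nonint \<nu> z = (z / 2) powr (- \<nu>) * macdonald \<nu> (z\<^sup>2 / 4) / 2" if "0 < \<nu>" "\<nu> < 1" for \<nu>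
  proof -
    have "(z / 2) powr \<nu> = (z / 2) powr (- \<nu>) * (z\<^sup>2 / 4) powr \<nu>"
      unfolding sq using assms by (simp flip: powr_add mult.assoc)
    then have "bessel_K_nonint \<nu> z = pi / (2 * sin (\<nu> * pi)) * ((z / 2) powr (- \<nu>) * (bessel_series (- \<nu>) (z\<^sup>2 / 4) - (z\<^sup>2 / 4) powr \<nu> * bessel_series \<nu> (z\<^sup>2 / 4)))"
      unfolding bessel_K_nonint_def using bessel_I_eq_bessel_series[of \<nu> z] bessel_I_eq_bessel_series[of "- \<nu>" z] that assms
      by (simp add: algebra_simps)
    also have "\<dots> = (z / 2) powr (- \<nu>) * macdonald \<nu> (z\<^sup>2 / 4) / 2"
      using assms by (subst macdonald_eq_bessel_series[OF that]) (auto simp: mult_ac)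
    finally show ?thesis .
  qed
  show ?thesis
  proof (cases "\<nu> > 0")
    case True
    then show ?thesis using pos assms by simp
  next
    case False
    have "bessel_K_nonint \<nu> z = bessel_K_nonint (- \<nu>) z"
      by (cases "sin (\<nu> * pi) = 0") (auto simp: bessel_K_nonint_def field_simps)
    also have "\<dots> = (z / 2) powr \<nu> * macdonald (- \<nu>) (z\<^sup>2 / 4) / 2"
      using pos[of "- \<nu>"] False assms by simp
    also have "macdonald (- \<nu>) (z\<^sup>2 / 4) = (z\<^sup>2 / 4) powr (- \<nu>) * macdonald \<nu> (z\<^sup>2 / 4)"
      using macdonald_reflect[of "z\<^sup>2 / 4" "- \<nu>"] assms by simp
    finally show ?thesis unfolding sq using assms by (simp flip: powr_add mult.assoc)
  qed
qed

lemma bessel_K_eq_macdonald: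
  assumes "\<bar>\<nu>\<bar> < 1" "0 < z"
  shows "bessel_K \<nu> z = (z / 2) powr (- \<nu>) * macdonald \<nu> (z\<^sup>2 / 4) / 2"
proof (cases "\<nu> = 0")
  case False
  then have "\<nu> \<notin> \<int>" using assms by (auto elim!: Ints_cases)
  then show ?thesis using bessel_K_nonint_eq_macdonald assms False by (simp add: bessel_K_def)
next
  case True
  have "((\<lambda>\<mu>. (z / 2) powr (- \<mu>) * macdonald \<mu> (z\<^sup>2 / 4) / 2) \<longlongrightarrow> (z / 2) powr (- 0) * macdonald 0 (z\<^sup>2 / 4) / 2) (at 0)"
    using assms by (intro tendsto_intros tendsto_macdonald_order) auto
  moreover have "\<forall>\<^sub>F \<mu> in at 0. (z / 2) powr (- \<mu>) * macdonald \<mu> (z\<^sup>2 / 4) / 2 = bessel_K_nonint \<mu> z"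
    unfolding eventually_at by (rule exI[of _ 1]) (use assms bessel_K_nonint_eq_macdonald in auto)
  ultimately have "((\<lambda>\<mu>. bessel_K_nonint \<mu> z) \<longlongrightarrow> (z / 2) powr (- 0) * macdonald 0 (z\<^sup>2 / 4) / 2) (at 0)"
    by (rule Lim_transform_eventually)
  then show ?thesis unfolding bessel_K_def True by (simp add: tendsto_Lim)
qed

section \<open>A Laplace representation with positive density\<close>

text \<open>The moments \<open>\<integral>\<^sub>1\<^sup>\<infinity> u^k (u^2 - 1) powr (a - 1) exp (- z u) du\<close>. For \<open>k = 0\<close> this is, up to a
constant factor, \<open>z powr (1 / 2 - a) * K (a - 1 / 2) z\<close>; the higher moments are its derivatives.\<close>

definition bessel_laplace :: "nat \<Rightarrow> real \<Rightarrow> real \<Rightarrow> real" where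
  "bessel_laplace k a z = (LINT u|lborel. u ^ k * (indicator {1<..} u * (u\<^sup>2 - 1) powr (a - 1)) * exp (- z * u))"

lemma bessel_laplace_integrable_0:
  fixes a z :: real
  assumes "0 < a" "a < 1" "0 < z"
  shows "integrable lborel (\<lambda>u. (indicator {1<..} u * (u\<^sup>2 - 1) powr (a - 1)) * exp (- z * u))"
proof (rule Bochner_Integration.integrable_bound)
  have "integrable lborel (\<lambda>u::real. indicator {0<..} (- 1 + 1 * u) * (- 1 + 1 * u) powr (a - 1) * exp (- z * (- 1 + 1 * u)) :: real)"
    using integrable_powr_exp[of a z] assms by (subst lborel_integrable_real_affine_iff) auto
  then show "integrable lborel (\<lambda>u. indicator {1<..} u * (u - 1) powr (a - 1) * exp (- z * (u - 1)))"
    by (rule Bochner_Integration.integrable_cong[THEN iffD1, rotated -1]) (auto simp: indicator_def)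
  have "(indicator {1<..} u * (u\<^sup>2 - 1) powr (a - 1)) * exp (- z * u) \<le>
      indicator {1<..} u * (u - 1) powr (a - 1) * exp (- z * (u - 1))" for u :: real
  proof (cases "u > 1")
    case True
    have "u - 1 \<le> u\<^sup>2 - 1" using True by (simp add: power2_eq_square)
    then have "(u\<^sup>2 - 1) powr (a - 1) \<le> (u - 1) powr (a - 1)"
      using True assms by (intro powr_mono2') auto
    then show ?thesis using True assms by (auto intro!: mult_mono)
  qed simp
  then show "AE u in lborel. norm ((indicator {1<..} u * (u\<^sup>2 - 1) powr (a - 1)) * exp (- z * u)) \<le>
      norm (indicator {1<..} u * (u - 1) powr (a - 1) * exp (- z * (u - 1)) :: real)"
    by (intro AE_I2) (simp add: abs_mult)
qed measurable

lemma bessel_laplace_deriv: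
  assumes "0 < a" "a < 1" "0 < z"
  shows bessel_laplace_integrable: "integrable lborel (\<lambda>u. u ^ k * (indicator {1<..} u * (u\<^sup>2 - 1) powr (a - 1)) * exp (- z * u))"
    and DERIV_bessel_laplace: "(bessel_laplace k a has_real_derivative - bessel_laplace (Suc k) a z) (at z)"
proof -
  (* The lemma on Laplace integrals asks for a nonnegative exponent on the whole line, so u is
     replaced by max u 0, which changes nothing on the support of w. *)
  define w where "w k u = u ^ k * (indicator {1<..} u * (u\<^sup>2 - 1) powr (a - 1))" for k and u :: real
  have [measurable]: "w k \<in> borel_measurable lborel" for k
    unfolding w_def by measurable
  have shift: "max u 0 * w k u = w (Suc k) u" for k u
    by (auto simp: w_def max_def indicator_def)
  have cut: "w k u * exp (- z * max u 0) = w k u * exp (- z * u)" for k z u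
    by (auto simp: w_def indicator_def max_def)
  have int: "integrable lborel (\<lambda>u. w k u * exp (- z * u))" if "0 < z" for k z
    using that
  proof (induction k arbitrary: z)
    case 0 then show ?case using bessel_laplace_integrable_0 assms by (simp add: w_def)
  next
    case (Suc k)
    have "integrable lborel (\<lambda>u. w k u * exp (- z * max u 0))" if "0 < z" for z
      using Suc.IH[OF that] by (simp only: cut)
    from DERIV_laplace_integral(1)[of "w k" lborel "\<lambda>u. max u 0", OF _ _ _ this Suc.prems]
    have "integrable lborel (\<lambda>u. max u 0 * w k u * exp (- z * max u 0))" by simp
    then show ?case by (simp only: shift cut)
  qed
  show "integrable lborel (\<lambda>u. u ^ k * (indicator {1<..} u * (u\<^sup>2 - 1) powr (a - 1)) * exp (- z * u))"
    using int[OF assms(3), of k] by (simp add: w_def)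
  show "(bessel_laplace k a has_real_derivative - bessel_laplace (Suc k) a z) (at z)"
    using DERIV_laplace_integral(2)[of "w k" lborel "\<lambda>u. max u 0" z] int[of _ k] assms
    unfolding shift cut by (simp add: bessel_laplace_def[abs_def] w_def)
qed

lemma bessel_laplace_pos: assumes "0 < a" "a < 1" "0 < z" shows "0 < bessel_laplace 0 a z"
proof -
  let ?f = "\<lambda>u. indicator {1<..} u * (u\<^sup>2 - 1) powr (a - 1) * exp (- z * u) :: real"
  have "bessel_laplace 0 a z \<noteq> 0"
  proof
    assume "bessel_laplace 0 a z = 0"
    then have "AE u in lborel. ?f u = 0"
      using integral_nonneg_eq_0_iff_AE[of lborel ?f] bessel_laplace_integrable[OF assms, of 0] by (auto simp: bessel_laplace_def)
    then have "AE u in lborel. u \<notin> {1<..<2::real}"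
    proof (eventually_elim, intro notI)
      fix u :: real assume u: "?f u = 0" "u \<in> {1<..<2}"
      then show False by (auto simp: power2_eq_1_iff)
    qed
    then have "emeasure lborel {1<..<2::real} = 0"
      by (subst (asm) AE_iff_measurable[of "{1<..<2}"]) auto
    then show False by simp
  qed
  moreover have "0 \<le> bessel_laplace 0 a z" unfolding bessel_laplace_def by (rule integral_nonneg_AE) (auto simp: indicator_def)
  ultimately show ?thesis by simp
qed

lemma bessel_laplace_le:
  assumes "0 < a" "a < 1" "1 \<le> z"
  shows "bessel_laplace k a z \<le> exp (1 - z) * bessel_laplace k a 1" "0 \<le> bessel_laplace k a z"
proof -
  let ?f = "\<lambda>z u. u ^ k * (indicator {1<..} u * (u\<^sup>2 - 1) powr (a - 1)) * exp (- z * u) :: real"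
  have "bessel_laplace k a z \<le> (LINT u|lborel. exp (1 - z) * ?f 1 u)" unfolding bessel_laplace_def
  proof (intro integral_mono bessel_laplace_integrable integrable_mult_right)
    fix u :: real
    show "?f z u \<le> exp (1 - z) * ?f 1 u"
    proof (cases "u > 1")
      case True
      have "0 \<le> (z - 1) * (u - 1)" using True assms by simp
      then have "- z * u \<le> 1 - z + - 1 * u" by (simp add: algebra_simps)
      then have "exp (- z * u) \<le> exp (1 - z) * exp (- 1 * u)"
        unfolding exp_add[symmetric] by simp
      then have "u ^ k * (u\<^sup>2 - 1) powr (a - 1) * exp (- z * u) \<le> u ^ k * (u\<^sup>2 - 1) powr (a - 1) * (exp (1 - z) * exp (- 1 * u))"
        using True by (intro mult_left_mono) auto
      then show ?thesis using True by (simp add: mult_ac)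
    qed simp
  qed (use assms in auto)
  then show "bessel_laplace k a z \<le> exp (1 - z) * bessel_laplace k a 1" by (simp add: bessel_laplace_def)
  show "0 \<le> bessel_laplace k a z" unfolding bessel_laplace_def by (rule integral_nonneg_AE) (auto simp: indicator_def)
qed

text \<open>The differential equation of \<open>bessel_laplace 0 a\<close>, obtained by integrating the derivative of
\<open>(u^2 - 1) powr a * exp (- z u)\<close> over \<open>u > 1\<close>; the boundary terms vanish since \<open>a > 0\<close>.\<close>

lemma bessel_laplace_recurrence:
  assumes "0 < a" "a < 1" "0 < z"
  shows "z * (bessel_laplace 2 a z - bessel_laplace 0 a z) = 2 * a * bessel_laplace 1 a z"
proof -
  define f where "f u = 2 * a * (u * (u\<^sup>2 - 1) powr (a - 1) * exp (- z * u)) - z * (u\<^sup>2 * (u\<^sup>2 - 1) powr (a - 1) * exp (- z * u)) + z * ((u\<^sup>2 - 1) powr (a - 1) * exp (- z * u))" for u :: real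
  define I where "I k u = u ^ k * (indicator {1<..} u * (u\<^sup>2 - 1) powr (a - 1)) * exp (- z * u)" for k and u :: real
  have I: "integrable lborel (I k)" "bessel_laplace k a z = (LINT u|lborel. I k u)" for k
    using bessel_laplace_integrable[OF assms, of k] by (simp_all add: I_def[abs_def] bessel_laplace_def)
  have feq: "indicator (einterval 1 \<infinity>) u * f u = 2 * a * I 1 u - z * I 2 u + z * I 0 u" for u
    by (auto simp: f_def I_def einterval_def indicator_def algebra_simps)
  have int: "integrable lborel (\<lambda>u. indicator (einterval 1 \<infinity>) u * f u)"
    unfolding feq by (intro Bochner_Integration.integrable_add Bochner_Integration.integrable_diff integrable_mult_right I)
  have "(LBINT u=1..\<infinity>. f u) = 0 - 0"
  proof (rule interval_integral_FTC_integrable)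
    fix u :: real assume "1 < ereal u"
    then have u: "1 < u" by simp
    then have u2: "1 < u\<^sup>2" by (simp add: one_less_power)
    have p: "(u\<^sup>2 - 1) powr a = (u\<^sup>2 - 1) * (u\<^sup>2 - 1) powr (a - 1)"
      using u2 by (simp add: powr_mult_base)
    have "((\<lambda>u. (u\<^sup>2 - 1) powr a * exp (- z * u)) has_real_derivative
        (u\<^sup>2 - 1) powr a * (exp (- z * u) * (- z)) + (a * (u\<^sup>2 - 1) powr (a - 1) * (2 * u)) * exp (- z * u)) (at u)"
      using u2 by (auto intro!: derivative_eq_intros simp: powr_diff field_simps)
    also have "(u\<^sup>2 - 1) powr a * (exp (- z * u) * (- z)) + (a * (u\<^sup>2 - 1) powr (a - 1) * (2 * u)) * exp (- z * u) = f u"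
      unfolding p f_def by (simp add: algebra_simps)
    finally show "((\<lambda>u. (u\<^sup>2 - 1) powr a * exp (- z * u)) has_vector_derivative f u) (at u)"
      by (simp add: has_real_derivative_iff_has_vector_derivative)
    show "isCont f u" unfolding f_def using u2 by (intro continuous_intros) auto
  next
    show "set_integrable lborel (einterval 1 \<infinity>) f" using int by (simp add: set_integrable_def)
    have "((\<lambda>u. (u\<^sup>2 - 1) powr a * exp (- z * u)) \<longlongrightarrow> (1\<^sup>2 - 1) powr a * exp (- z * 1)) (at_right 1)"
      using assms by (intro tendsto_intros) (auto simp: eventually_at_right_less power2_eq_square intro!: eventually_mono[OF eventually_at_right_less[of "1::real"]] less_1_mult less_imp_le)
    then show "(((\<lambda>u. (u\<^sup>2 - 1) powr a * exp (- z * u)) \<circ> real_of_ereal) \<longlongrightarrow> 0) (at_right 1)"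
      unfolding one_ereal_def using assms by (simp add: ereal_tendsto_simps)
    have "((\<lambda>u. (u\<^sup>2 - 1) powr a * exp (- z * u)) \<longlongrightarrow> 0) at_top"
      using assms by real_asymp
    then show "(((\<lambda>u. (u\<^sup>2 - 1) powr a * exp (- z * u)) \<circ> real_of_ereal) \<longlongrightarrow> 0) (at_left \<infinity>)"
      by (simp add: ereal_tendsto_simps)
  qed simp
  moreover have "(LBINT u=1..\<infinity>. f u) = (LINT u|lborel. indicator (einterval 1 \<infinity>) u * f u)"
    by (simp add: interval_lebesgue_integral_def set_lebesgue_integral_def)
  moreover have "\<dots> = 2 * a * bessel_laplace 1 a z - z * bessel_laplace 2 a z + z * bessel_laplace 0 a z"
    unfolding feq I(2) by (simp add: I(1))
  ultimately show ?thesis by (simp add: algebra_simps)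
qed

text \<open>Both sides solve the same second order equation in \<open>z\<close> and both decay at infinity, so their
Wronskian vanishes and their quotient is constant. Of the constant, the later arguments use the sign.
In the proof \<open>P\<close> is the left-hand side, \<open>Q\<close> is \<open>- P'\<close> multiplied by a power of \<open>z\<close>, and \<open>W\<close> is the
Wronskian of \<open>P\<close> and \<open>bessel_laplace 0 a\<close> multiplied by \<open>(z / 2) powr (2 * a)\<close>.\<close>

lemma macdonald_eq_const_bessel_laplace:
  assumes "0 < a" "a < 1"
  obtains c where "0 < c" "\<And>z. 0 < z \<Longrightarrow> macdonald (1 / 2 - a) (z\<^sup>2 / 4) = c * bessel_laplace 0 a z"
proof -
  define P where "P z = macdonald (1 / 2 - a) (z\<^sup>2 / 4)" for z
  define Q where "Q z = macdonald (1 / 2 + a) (z\<^sup>2 / 4)" for z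
  have sq: "(z\<^sup>2 / 4) powr r = (z / 2) powr (2 * r)" if "z > 0" for z r :: real
  proof -
    have "z\<^sup>2 / 4 = (z / 2) powr 2" using that by (simp add: power_divide)
    then show ?thesis by (simp only: powr_powr)
  qed
  have q: "0 < z\<^sup>2 / 4" if "z > 0" for z :: real using that by simp
  have dP: "(P has_real_derivative - ((z / 2) powr (- 2 * a) * Q z)) (at z)" if "z > 0" for z
  proof -
    have "(P has_real_derivative - macdonald (1 / 2 - a - 1) (z\<^sup>2 / 4) * (z / 2)) (at z)"
      unfolding P_def by (rule DERIV_chain2[where g = "\<lambda>z. z\<^sup>2 / 4", OF DERIV_macdonald[OF q[OF that]]]) (auto intro!: derivative_eq_intros)
    moreover have "macdonald (1 / 2 - a - 1) (z\<^sup>2 / 4) = (z / 2) powr (- 2 * a - 1) * Q z"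
    proof -
      have e: "- (1 / 2 - a - 1) = 1 / 2 + a" "2 * (1 / 2 - a - 1) = - 2 * a - 1" by simp_all
      show ?thesis
        unfolding macdonald_reflect[OF q[OF that], of "1 / 2 - a - 1"] sq[OF that, of "1 / 2 - a - 1"] Q_def e ..
    qed
    moreover have "(z / 2) powr (- 2 * a - 1) * Q z * (z / 2) = (z / 2) powr (- 2 * a) * Q z"
      using powr_mult_base[of "z / 2" "- 2 * a - 1"] that by (simp add: mult_ac)
    ultimately show ?thesis by (simp only: mult_minus_left)
  qed
  have dQ: "(Q has_real_derivative - ((z / 2) powr (2 * a) * P z)) (at z)" if "z > 0" for z
  proof -
    have "(Q has_real_derivative - macdonald (1 / 2 + a - 1) (z\<^sup>2 / 4) * (z / 2)) (at z)"
      unfolding Q_def by (rule DERIV_chain2[where g = "\<lambda>z. z\<^sup>2 / 4", OF DERIV_macdonald[OF q[OF that]]]) (auto intro!: derivative_eq_intros)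
    moreover have "macdonald (1 / 2 + a - 1) (z\<^sup>2 / 4) = (z / 2) powr (2 * a - 1) * P z"
    proof -
      have "- (1 / 2 + a - 1) = 1 / 2 - a" "2 * (1 / 2 + a - 1) = 2 * a - 1" by simp_all
      then show ?thesis
        unfolding macdonald_reflect[OF q[OF that], of "1 / 2 + a - 1"] sq[OF that, of "1 / 2 + a - 1"] P_def by simp
    qed
    moreover have "(z / 2) powr (2 * a - 1) * P z * (z / 2) = (z / 2) powr (2 * a) * P z"
      using powr_mult_base[of "z / 2" "2 * a - 1"] that by (simp add: mult_ac)
    ultimately show ?thesis by (simp only: mult_minus_left)
  qed
  define W where "W z = Q z * bessel_laplace 0 a z - (z / 2) powr (2 * a) * P z * bessel_laplace 1 a z" for z
  have dW: "(W has_real_derivative 0) (at z)" if "z > 0" for z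
  proof -
    have c: "(z / 2) powr (2 * a) * (z / 2) powr (- 2 * a) = 1" using that by (simp flip: powr_add)
    have dz: "((\<lambda>z. (z / 2) powr (2 * a)) has_real_derivative (2 * a / z * (z / 2) powr (2 * a))) (at z)"
      using that by (auto intro!: derivative_eq_intros simp: powr_diff field_simps)
    have "(W has_real_derivative
        (- ((z / 2) powr (2 * a) * P z)) * bessel_laplace 0 a z + Q z * (- bessel_laplace 1 a z)
        - (((2 * a / z * (z / 2) powr (2 * a)) * P z + (z / 2) powr (2 * a) * (- ((z / 2) powr (- 2 * a) * Q z))) * bessel_laplace 1 a z
           + (z / 2) powr (2 * a) * P z * (- bessel_laplace 2 a z))) (at z)" (is "(_ has_real_derivative ?D) _")
      unfolding W_def
      using DERIV_diff[OF DERIV_mult[OF dQ DERIV_bessel_laplace[of a z 0]] DERIV_mult[OF DERIV_mult[OF dz dP] DERIV_bessel_laplace[of a z 1]]] that assms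
      by (simp add: numeral_2_eq_2 algebra_simps)
    also have "?D = (z / 2) powr (2 * a) * P z * (bessel_laplace 2 a z - bessel_laplace 0 a z - 2 * a / z * bessel_laplace 1 a z)
        + ((z / 2) powr (2 * a) * (z / 2) powr (- 2 * a) - 1) * Q z * bessel_laplace 1 a z" by (simp add: algebra_simps)
    also have "bessel_laplace 2 a z - bessel_laplace 0 a z - 2 * a / z * bessel_laplace 1 a z = 0"
      using bessel_laplace_recurrence[OF assms that] that by (simp add: field_simps)
    finally show ?thesis unfolding c by simp
  qed
  obtain k where k: "\<And>z. 0 < z \<Longrightarrow> W z = k"
    using has_field_derivative_zero_constant[of "{0<..}" W] dW
    by (meson convex_real_interval(3) greaterThan_iff has_field_derivative_at_within)
  have Fb: "macdonald \<nu> (z\<^sup>2 / 4) \<le> macdonald \<nu> (1 / 4)" if "1 \<le> z" for z \<nu>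
    by (rule macdonald_antimono) (use that in auto)
  have Pb: "0 < P z" if "0 < z" for z
    unfolding P_def by (rule macdonald_pos[OF q[OF that]])
  have Qb: "0 < Q z" if "0 < z" for z
    unfolding Q_def by (rule macdonald_pos[OF q[OF that]])
  have "(W \<longlongrightarrow> 0) at_top"
  proof (rule Lim_null_comparison)
    show "\<forall>\<^sub>F z in at_top. norm (W z) \<le> macdonald (1 / 2 + a) (1 / 4) * (exp (1 - z) * bessel_laplace 0 a 1) + (z / 2) powr (2 * a) * macdonald (1 / 2 - a) (1 / 4) * (exp (1 - z) * bessel_laplace 1 a 1)"
      using eventually_ge_at_top[of 1]
    proof eventually_elim
      case (elim z)
      have "\<bar>W z\<bar> \<le> \<bar>Q z * bessel_laplace 0 a z\<bar> + \<bar>(z / 2) powr (2 * a) * P z * bessel_laplace 1 a z\<bar>"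
        unfolding W_def by (rule abs_triangle_ineq4)
      also have "\<dots> = Q z * bessel_laplace 0 a z + (z / 2) powr (2 * a) * P z * bessel_laplace 1 a z"
        using Pb[of z] Qb[of z] bessel_laplace_le(2)[OF assms elim] elim by (simp add: abs_mult)
      also have "\<dots> \<le> macdonald (1 / 2 + a) (1 / 4) * (exp (1 - z) * bessel_laplace 0 a 1) + (z / 2) powr (2 * a) * macdonald (1 / 2 - a) (1 / 4) * (exp (1 - z) * bessel_laplace 1 a 1)"
        using Pb[of z] Qb[of z] bessel_laplace_le[OF assms elim] Fb[OF elim] elim macdonald_pos[of "1 / 4"]
        unfolding P_def Q_def
        by (intro add_mono mult_mono mult_left_mono mult_nonneg_nonneg) (auto simp: less_imp_le)
      finally show ?case by simp
    qed
    show "((\<lambda>z. macdonald (1 / 2 + a) (1 / 4) * (exp (1 - z) * bessel_laplace 0 a 1) + (z / 2) powr (2 * a) * macdonald (1 / 2 - a) (1 / 4) * (exp (1 - z) * bessel_laplace 1 a 1)) \<longlongrightarrow> 0) at_top"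
    proof -
      have e: "((\<lambda>z::real. exp (1 - z)) \<longlongrightarrow> 0) at_top" by real_asymp
      have pe: "((\<lambda>z::real. (z / 2) powr (2 * a) * exp (1 - z)) \<longlongrightarrow> 0) at_top"
        using assms by real_asymp
      show ?thesis
        using tendsto_add[OF tendsto_mult_left[OF e, of "macdonald (1 / 2 + a) (1 / 4) * bessel_laplace 0 a 1"] tendsto_mult_left[OF pe, of "macdonald (1 / 2 - a) (1 / 4) * bessel_laplace 1 a 1"]]
        by (simp add: mult_ac)
    qed
  qed
  moreover have "(W \<longlongrightarrow> k) at_top"
    by (intro tendsto_eventually eventually_mono[OF eventually_gt_at_top[of 0]] k)
  ultimately have "k = 0" using tendsto_unique trivial_limit_at_top_linorder by blast
  have dR: "((\<lambda>z. bessel_laplace 0 a z / P z) has_real_derivative 0) (at z)" if "z > 0" for z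
  proof -
    have "((\<lambda>z. bessel_laplace 0 a z / P z) has_real_derivative
        ((- bessel_laplace 1 a z) * P z - bessel_laplace 0 a z * (- ((z / 2) powr (- 2 * a) * Q z))) / (P z * P z)) (at z)"
      using DERIV_divide[OF DERIV_bessel_laplace[OF assms that, of 0] dP[OF that]] Pb[OF that] by simp
    also have "(- bessel_laplace 1 a z) * P z - bessel_laplace 0 a z * (- ((z / 2) powr (- 2 * a) * Q z)) = (z / 2) powr (- 2 * a) * W z"
      unfolding W_def using that by (simp add: algebra_simps flip: powr_add)
    finally show ?thesis using k[OF that] \<open>k = 0\<close> by simp
  qed
  obtain c where c: "\<And>z. 0 < z \<Longrightarrow> bessel_laplace 0 a z / P z = c"
    using has_field_derivative_zero_constant[of "{0<..}" "\<lambda>z. bessel_laplace 0 a z / P z"] dR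
    by (metis (no_types, lifting) convex_real_interval(3) greaterThan_iff has_field_derivative_at_within)
  have "c > 0" using c[of 1] bessel_laplace_pos[OF assms, of 1] Pb[of 1] by (metis divide_pos_pos zero_less_one)
  moreover have "macdonald (1 / 2 - a) (z\<^sup>2 / 4) = 1 / c * bessel_laplace 0 a z" if "0 < z" for z
    using c[OF that] Pb[OF that] \<open>c > 0\<close> by (auto simp: P_def field_simps)
  ultimately show thesis by (intro that[of "1 / c"]) auto
qed

section \<open>Integration against a weight with quadratic decay\<close>

lemma integrable_lborel_mult:
  fixes f :: "'a::euclidean_space \<Rightarrow> 'c::{real_normed_field,banach,second_countable_topology}"
    and g :: "'b::euclidean_space \<Rightarrow> 'c"
  assumes f: "integrable lborel f" and g: "integrable lborel g"
  shows "integrable (lborel \<Otimes>\<^sub>M lborel) (\<lambda>(x, y). f x * g y)"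
proof (rule lborel_pair.Fubini_integrable)
  have [measurable]: "f \<in> borel_measurable borel" "g \<in> borel_measurable borel"
    using f g by auto
  show "(\<lambda>(x, y). f x * g y) \<in> borel_measurable (lborel \<Otimes>\<^sub>M lborel)" by measurable
  show "integrable lborel (\<lambda>x. LINT y|lborel. norm (case (x, y) of (x, y) \<Rightarrow> f x * g y))"
    using f by (simp add: norm_mult)
  show "AE x in lborel. integrable lborel (\<lambda>y. case (x, y) of (x, y) \<Rightarrow> f x * g y)"
    using g by simp
qed

lemma integral_lborel_mult:
  fixes f :: "'a::euclidean_space \<Rightarrow> 'c::{real_normed_field,banach,second_countable_topology}"
    and g :: "'b::euclidean_space \<Rightarrow> 'c"
  assumes "integrable lborel f" "integrable lborel g"
  shows "integrable lborel (\<lambda>z. f (fst z) * g (snd z))"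
    and "(LINT z|lborel. f (fst z) * g (snd z)) = (LINT x|lborel. f x) * (LINT y|lborel. g y)"
proof -
  note i = integrable_lborel_mult[OF assms]
  have eq: "(\<lambda>z. f (fst z) * g (snd z)) = (\<lambda>(x, y). f x * g y)" by auto
  show "integrable lborel (\<lambda>z. f (fst z) * g (snd z))"
    using i unfolding eq lborel_prod .
  show "(LINT z|lborel. f (fst z) * g (snd z)) = (LINT x|lborel. f x) * (LINT y|lborel. g y)"
    using lborel_pair.integral_fst[OF i] assms unfolding eq lborel_prod by simp
qed

definition decay_weight :: "real \<times> real \<Rightarrow> real" where
  "decay_weight z = inverse (1 + (fst z)\<^sup>2) * inverse (1 + (snd z)\<^sup>2)"

lemma decay_weight_pos: "0 < decay_weight z"
  by (simp add: decay_weight_def add_pos_nonneg)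

lemma integrable_inverse_1_plus_square': "integrable lborel (\<lambda>x::real. inverse (1 + x\<^sup>2))"
  using integrable_inverse_1_plus_square by (simp add: set_integrable_def einterval_def)

lemma integrable_decay_weight: "integrable lborel decay_weight"
  using integral_lborel_mult(1)[OF integrable_inverse_1_plus_square' integrable_inverse_1_plus_square']
  by (simp add: decay_weight_def[abs_def])

lemma integrable_powr_decay_weight:
  fixes \<alpha> :: real assumes "0 \<le> \<alpha>" "\<alpha> < 1"
  shows "integrable lborel (\<lambda>x. \<bar>x\<bar> powr (- \<alpha>) * inverse (1 + x\<^sup>2))"
proof (rule Bochner_Integration.integrable_bound)
  let ?g = "\<lambda>u::real. indicator {0<..} u * u powr ((1 - \<alpha>) - 1) * exp (- 1 * u) :: real"
  have g: "integrable lborel ?g" using assms by (intro integrable_powr_exp) auto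
  have g': "integrable lborel (\<lambda>u. ?g (0 + (- 1) * u))" using g by (subst lborel_integrable_real_affine_iff) auto
  show "integrable lborel (\<lambda>x. exp 1 * (?g x + ?g (0 + (- 1) * x)) + inverse (1 + x\<^sup>2))"
    by (intro Bochner_Integration.integrable_add integrable_mult_right g g' integrable_inverse_1_plus_square')
  have main: "\<bar>x\<bar> powr (- \<alpha>) * inverse (1 + x\<^sup>2) \<le> exp 1 * (?g x + ?g (0 + (- 1) * x)) + inverse (1 + x\<^sup>2)" for x
  proof -
    (* On [-1, 1] the factor exp (1 - |x|) is at least 1, which makes the Gamma integrand a majorant. *)
    consider "x = 0" | "x \<noteq> 0" "\<bar>x\<bar> \<le> 1" | "\<bar>x\<bar> > 1" by force
    then show ?thesis
    proof cases
      case 2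
      have "\<bar>x\<bar> powr (- \<alpha>) * inverse (1 + x\<^sup>2) \<le> \<bar>x\<bar> powr (- \<alpha>) * 1"
        by (intro mult_left_mono) (auto simp: inverse_eq_divide add_pos_nonneg)
      also have "\<dots> \<le> \<bar>x\<bar> powr (- \<alpha>) * (exp 1 * exp (- \<bar>x\<bar>))"
        using 2 by (intro mult_left_mono) (auto simp flip: exp_add)
      also have "\<dots> = exp 1 * (?g x + ?g (0 + (- 1) * x))"
        using 2 by (auto simp: indicator_def abs_if)
      also have "\<dots> \<le> \<dots> + inverse (1 + x\<^sup>2)" by simp
      finally show ?thesis .
    next
      case 3
      have "\<bar>x\<bar> powr (- \<alpha>) \<le> \<bar>x\<bar> powr 0" using 3 assms by (intro powr_mono) auto
      then have "\<bar>x\<bar> powr (- \<alpha>) * inverse (1 + x\<^sup>2) \<le> 1 * inverse (1 + x\<^sup>2)"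
        using 3 by (intro mult_right_mono) (auto split: if_splits)
      then show ?thesis by (auto simp: add_increasing)
    qed simp
  qed
  then show "AE x in lborel. norm (\<bar>x\<bar> powr (- \<alpha>) * inverse (1 + x\<^sup>2)) \<le> norm (exp 1 * (?g x + ?g (0 + (- 1) * x)) + inverse (1 + x\<^sup>2))"
    by (intro AE_I2) (auto simp: abs_mult intro!: order_trans[OF main abs_ge_self] order_trans[OF _ abs_ge_self])
qed measurable

text \<open>Powers above \<open>- 1\<close> are integrable at the axes, and the weight takes care of infinity.\<close>

lemma integrable_powr_powr_decay_weight:
  fixes \<alpha> \<beta> :: real assumes "0 \<le> \<alpha>" "\<alpha> < 1" "0 \<le> \<beta>" "\<beta> < 1"
  shows "integrable lborel (\<lambda>z::real\<times>real. \<bar>fst z\<bar> powr (- \<alpha>) * \<bar>snd z\<bar> powr (- \<beta>) * decay_weight z)"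
  using integral_lborel_mult(1)[OF integrable_powr_decay_weight[OF assms(1,2)] integrable_powr_decay_weight[OF assms(3,4)]]
  by (simp add: decay_weight_def mult_ac)

lemma AE_lborel_axes: "AE z::real\<times>real in lborel. fst z \<noteq> 0 \<and> snd z \<noteq> 0"
proof -
  have 1: "emeasure lborel ({0::real} \<times> (UNIV::real set)) = 0" "emeasure lborel ((UNIV::real set) \<times> {0::real}) = 0"
    by (simp_all add: lborel_prod[symmetric] lborel.emeasure_pair_measure_Times)
  have "AE z::real\<times>real in lborel. z \<notin> {0} \<times> UNIV" "AE z::real\<times>real in lborel. z \<notin> UNIV \<times> {0}"
    by (intro AE_not_in null_setsI 1; simp add: borel_closed closed_Times)+
  then show ?thesis by eventually_elim (auto simp: mem_Times_iff)
qed

lemma fs_measurable [measurable]: "fs s \<in> borel_measurable borel"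
  unfolding fs_def borel_prod[symmetric] by measurable

lemma fs_nonneg: "0 \<le> fs s z"
  by (auto simp: fs_def split: prod.split)

text \<open>The weighted geometric mean with exponents \<open>1 / 3\<close> and \<open>2 / 3\<close> of \<open>x^4\<close> and \<open>t^2\<close> is at most
\<open>x^4 + t^2\<close>. These exponents give both variables the same power \<open>- s / 3\<close>, which stays above \<open>- 1\<close>
precisely for \<open>s < 3\<close>.\<close>

lemma fs_le_powr:
  assumes "0 < s" "fst z \<noteq> 0" "snd z \<noteq> 0"
  shows "fs s z \<le> \<bar>fst z\<bar> powr (- s / 3) * \<bar>snd z\<bar> powr (- s / 3)"
proof -
  obtain x t where z: "z = (x, t)" by (cases z)
  then have nz: "x \<noteq> 0" "t \<noteq> 0" using assms by auto
  define M where "M = x ^ 4 + t\<^sup>2"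
  have M: "x ^ 4 \<le> M" "t\<^sup>2 \<le> M" "0 < M" using nz by (auto simp: M_def add_pos_pos zero_less_power_eq)
  have eq: "\<bar>x\<bar> powr (s / 3) = (x ^ 4) powr (s / 12)" "\<bar>t\<bar> powr (s / 3) = (t\<^sup>2) powr (s / 6)"
  proof -
    have "x ^ 4 = \<bar>x\<bar> powr 4" "t\<^sup>2 = \<bar>t\<bar> powr 2"
      using nz powr_realpow[of "\<bar>x\<bar>" 4] powr_realpow[of "\<bar>t\<bar>" 2] by auto
    then show "\<bar>x\<bar> powr (s / 3) = (x ^ 4) powr (s / 12)" "\<bar>t\<bar> powr (s / 3) = (t\<^sup>2) powr (s / 6)"
      by (simp_all only: powr_powr) simp_all
  qed
  have "\<bar>x\<bar> powr (s / 3) * \<bar>t\<bar> powr (s / 3) \<le> M powr (s / 12) * M powr (s / 6)"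
    unfolding eq using assms M by (intro mult_mono powr_mono2) auto
  also have "\<dots> = M powr (s / 4)" by (simp flip: powr_add)
  finally have "inverse (M powr (s / 4)) \<le> inverse (\<bar>x\<bar> powr (s / 3) * \<bar>t\<bar> powr (s / 3))"
    using nz by (intro le_imp_inverse_le) auto
  then show ?thesis by (simp add: z fs_def M_def powr_minus field_simps)
qed

lemma integrable_fs_decay_weight:
  assumes "0 < s" "s < 3"
  shows "integrable lborel (\<lambda>z. fs s z * decay_weight z)"
proof (rule Bochner_Integration.integrable_bound)
  show "integrable lborel (\<lambda>z. \<bar>fst z\<bar> powr (- (s / 3)) * \<bar>snd z\<bar> powr (- (s / 3)) * decay_weight z)"
    using assms by (intro integrable_powr_powr_decay_weight) auto
  show "AE z in lborel. norm (fs s z * decay_weight z) \<le> norm (\<bar>fst z\<bar> powr (- (s / 3)) * \<bar>snd z\<bar> powr (- (s / 3)) * decay_weight z)"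
    using AE_lborel_axes
  proof eventually_elim
    case (elim z)
    then show ?case using fs_le_powr[of s z] fs_nonneg[of s z] decay_weight_pos[of z] assms by (simp add: abs_mult)
  qed
  have [measurable]: "decay_weight \<in> borel_measurable borel" using integrable_decay_weight by auto
  show "(\<lambda>z. fs s z * decay_weight z) \<in> borel_measurable lborel" by measurable
qed

section \<open>Schwartz functions and tempered distributions\<close>

text \<open>With \<open>z = (x, t)\<close> one has \<open>(1 + x^2) (1 + t^2) \<le> (1 + \<bar>z\<bar>^2)^2 \<le> 2 + 2 \<bar>z\<bar>^4\<close>, so two of the
Schwartz seminorms control the quotient by the weight.\<close>

lemma le_decay_weight:
  fixes c :: "'b::real_normed_vector"
  assumes "norm c \<le> A" "norm z ^ 4 * norm c \<le> B"
  shows "norm c \<le> 2 * (A + B) * decay_weight z"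
proof -
  have "(1 + (fst z)\<^sup>2) * (1 + (snd z)\<^sup>2) \<le> 2 + 2 * norm z ^ 4"
  proof -
    have n: "(norm z)\<^sup>2 = (fst z)\<^sup>2 + (snd z)\<^sup>2" by (cases z) (simp add: norm_Pair)
    have "(1 + (fst z)\<^sup>2) * (1 + (snd z)\<^sup>2) \<le> (1 + (norm z)\<^sup>2) * (1 + (norm z)\<^sup>2)"
      unfolding n by (intro mult_mono) auto
    also have "\<dots> = 2 + 2 * ((norm z)\<^sup>2)\<^sup>2 - (1 - (norm z)\<^sup>2)\<^sup>2" by (simp add: power2_eq_square algebra_simps)
    also have "\<dots> \<le> 2 + 2 * norm z ^ 4" by simp
    finally show ?thesis .
  qed
  then have "(1 + (fst z)\<^sup>2) * (1 + (snd z)\<^sup>2) * norm c \<le> (2 + 2 * norm z ^ 4) * norm c"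
    by (intro mult_right_mono) auto
  also have "\<dots> \<le> 2 * (A + B)" using assms by (simp add: algebra_simps)
  finally have "norm c * ((1 + (fst z)\<^sup>2) * (1 + (snd z)\<^sup>2)) \<le> 2 * (A + B)" by (simp add: mult_ac)
  moreover have "0 < (1 + (fst z)\<^sup>2) * (1 + (snd z)\<^sup>2)" by (intro mult_pos_pos add_pos_nonneg) auto
  ultimately have "norm c \<le> 2 * (A + B) / ((1 + (fst z)\<^sup>2) * (1 + (snd z)\<^sup>2))" by (subst pos_le_divide_eq)
  then show ?thesis by (simp add: decay_weight_def divide_inverse)
qed

lemma schwartz_differentiable:
  assumes "\<phi> \<in> schwartz_space" shows "\<phi> differentiable (at z)"
  using assms by (auto simp: schwartz_space_def smooth_def partial_derivs_def dest: spec[of _ "[]"])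

lemma schwartz_measurable:
  assumes "\<phi> \<in> schwartz_space" shows "\<phi> \<in> borel_measurable borel"
proof -
  have "continuous_on UNIV \<phi>"
    using schwartz_differentiable[OF assms] by (auto intro!: continuous_at_imp_continuous_on differentiable_imp_continuous_within)
  then show ?thesis by (rule borel_measurable_continuous_onI)
qed

lemma schwartz_bounded:
  assumes "\<phi> \<in> schwartz_space" "set bs \<subseteq> Basis"
  shows "bdd_above (range (\<lambda>z. norm z ^ k * norm (partial_derivs bs \<phi> z)))"
proof -
  have "bounded (range (\<lambda>z. norm z ^ k *\<^sub>R partial_derivs bs \<phi> z))"
    using assms by (auto simp: schwartz_space_def)
  then obtain B where "\<And>z. norm (norm z ^ k *\<^sub>R partial_derivs bs \<phi> z) \<le> B"
    by (auto simp: bounded_iff)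
  then show ?thesis by (intro bdd_aboveI[of _ B]) auto
qed

lemma partial_deriv_schwartz:
  assumes "\<phi> \<in> schwartz_space" "b \<in> Basis" shows "partial_deriv b \<phi> \<in> schwartz_space"
proof -
  have eq: "partial_derivs bs (partial_deriv b \<phi>) = partial_derivs (bs @ [b]) \<phi>" for bs
    by (simp add: partial_derivs_def)
  have "partial_derivs (bs @ [b]) \<phi> differentiable (at z)"
    "bounded (range (\<lambda>z. norm z ^ k *\<^sub>R partial_derivs (bs @ [b]) \<phi> z))" if "set bs \<subseteq> Basis" for bs k z
  proof -
    have "set (bs @ [b]) \<subseteq> Basis" using that assms(2) by simp
    then show "partial_derivs (bs @ [b]) \<phi> differentiable (at z)"
      "bounded (range (\<lambda>z. norm z ^ k *\<^sub>R partial_derivs (bs @ [b]) \<phi> z))"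
      using assms(1) unfolding schwartz_space_def smooth_def mem_Collect_eq by blast+
  qed
  then show ?thesis unfolding schwartz_space_def smooth_def mem_Collect_eq eq by blast
qed

lemma schwartz_le_decay_weight:
  fixes \<phi> :: "real \<times> real \<Rightarrow> complex"
  assumes "\<phi> \<in> schwartz_space"
  obtains C where "0 \<le> C" "\<And>z. norm (\<phi> z) \<le> C * decay_weight z"
proof -
  have b: "bdd_above (range (\<lambda>z. norm z ^ k * norm (\<phi> z)))" for k
    using schwartz_bounded[OF assms, of "[]" k] by (simp add: partial_derivs_def)
  obtain A where A: "\<And>z. norm (\<phi> z) \<le> A" using b[of 0] by (auto simp: bdd_above_def)
  obtain B where B: "\<And>z. norm z ^ 4 * norm (\<phi> z) \<le> B" using b[of 4] by (auto simp: bdd_above_def)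
  have "0 \<le> A" using order_trans[OF norm_ge_zero A] .
  moreover have "0 \<le> B" using order_trans[OF _ B[of 0]] by simp
  ultimately show thesis using le_decay_weight[OF A B] by (intro that[of "2 * (A + B)"]) auto
qed

lemma integrable_mult_decay_weight:
  fixes g \<psi> :: "real \<times> real \<Rightarrow> complex"
  assumes [measurable]: "g \<in> borel_measurable borel" "\<psi> \<in> borel_measurable borel"
    and g: "integrable lborel (\<lambda>z. norm (g z) * decay_weight z)"
    and \<psi>: "\<And>z. norm (\<psi> z) \<le> C * decay_weight z"
  shows "integrable lborel (\<lambda>z. g z * \<psi> z)"
    and "norm (LINT z|lborel. g z * \<psi> z) \<le> C * (LINT z|lborel. norm (g z) * decay_weight z)"
proof -
  have le: "norm (g z * \<psi> z) \<le> C * (norm (g z) * decay_weight z)" for z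
    using mult_left_mono[OF \<psi>, of "norm (g z)" z] by (simp add: norm_mult mult_ac)
  show i: "integrable lborel (\<lambda>z. g z * \<psi> z)"
  proof (rule Bochner_Integration.integrable_bound)
    show "integrable lborel (\<lambda>z. C * (norm (g z) * decay_weight z))" by (intro integrable_mult_right g)
    show "AE z in lborel. norm (g z * \<psi> z) \<le> norm (C * (norm (g z) * decay_weight z))"
      by (intro AE_I2 order_trans[OF le]) simp
  qed measurable
  have "norm (LINT z|lborel. g z * \<psi> z) \<le> (LINT z|lborel. norm (g z * \<psi> z))"
    by (rule integral_norm_bound)
  also have "\<dots> \<le> (LINT z|lborel. C * (norm (g z) * decay_weight z))"
    by (intro integral_mono integrable_norm i integrable_mult_right g le)
  finally show "norm (LINT z|lborel. g z * \<psi> z) \<le> C * (LINT z|lborel. norm (g z) * decay_weight z)" by simp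
qed

lemma schwartz_integrable:
  fixes \<phi> :: "real \<times> real \<Rightarrow> complex"
  assumes "\<phi> \<in> schwartz_space" shows "integrable lborel \<phi>"
proof -
  obtain C where "\<And>z. norm (\<phi> z) \<le> C * decay_weight z" using schwartz_le_decay_weight[OF assms] by blast
  from integrable_mult_decay_weight(1)[OF _ schwartz_measurable[OF assms] _ this, of "\<lambda>_. 1"]
  show ?thesis using integrable_decay_weight by simp
qed

text \<open>The value at \<open>\<phi>\<close> is bounded by a multiple of the sum of the seminorms without derivatives of
decay orders \<open>0\<close> and \<open>4\<close>. Hence around each \<open>\<phi>\<close> the intersection of two subbasic neighbourhoods is
mapped into a given disc.\<close>

lemma tempered_distribution_of_decay_weight:
  fixes g :: "real \<times> real \<Rightarrow> complex"
  assumes g[measurable]: "g \<in> borel_measurable borel"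
    and int: "integrable lborel (\<lambda>z. norm (g z) * decay_weight z)"
  shows "tempered_distribution (distribution_of g)"
proof -
  define T where "T = distribution_of g"
  define K where "K = (LINT z|lborel. norm (g z) * decay_weight z)"
  have "0 \<le> K" unfolding K_def using decay_weight_pos by (intro integral_nonneg_AE) (auto simp: less_imp_le)
  have i: "integrable lborel (\<lambda>z. g z * \<phi> z)" if "\<phi> \<in> schwartz_space" for \<phi>
  proof -
    from that have S: "\<phi> \<in> schwartz_space" .
    obtain C where "\<And>z. norm (\<phi> z) \<le> C * decay_weight z" using schwartz_le_decay_weight[OF S] by blast
    then show ?thesis by (rule integrable_mult_decay_weight(1)[OF g schwartz_measurable[OF S] int])
  qed
  have bound: "norm (T \<psi> - T \<phi>) \<le> 4 * \<delta> * K"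
    if \<phi>: "\<phi> \<in> schwartz_space" and \<psi>: "\<psi> \<in> schwartz_space"
      and s: "schwartz_seminorm 0 [] (\<lambda>z. \<psi> z - \<phi> z) < \<delta>" "schwartz_seminorm 4 [] (\<lambda>z. \<psi> z - \<phi> z) < \<delta>" for \<phi> \<psi> \<delta>
  proof -
    have b: "bdd_above (range (\<lambda>z. norm z ^ k * norm (\<psi> z - \<phi> z)))" for k
    proof -
      obtain A B where A: "\<And>z. norm z ^ k * norm (\<phi> z) \<le> A" and B: "\<And>z. norm z ^ k * norm (\<psi> z) \<le> B"
        using schwartz_bounded[OF \<phi>, of "[]" k] schwartz_bounded[OF \<psi>, of "[]" k]
        by (auto simp: partial_derivs_def bdd_above_def)
      have "norm z ^ k * norm (\<psi> z - \<phi> z) \<le> norm z ^ k * (norm (\<psi> z) + norm (\<phi> z))" for z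
        by (intro mult_left_mono norm_triangle_ineq4) auto
      then have "norm z ^ k * norm (\<psi> z - \<phi> z) \<le> B + A" for z
        using A[of z] B[of z] by (simp add: distrib_left) (meson add_mono order_trans)
      then show ?thesis by (intro bdd_aboveI[of _ "B + A"]) auto
    qed
    have le: "norm z ^ k * norm (\<psi> z - \<phi> z) \<le> \<delta>" if "schwartz_seminorm k [] (\<lambda>z. \<psi> z - \<phi> z) < \<delta>" for k z
      using cSUP_upper[OF UNIV_I b, of z k] that by (simp add: schwartz_seminorm_def partial_derivs_def)
    have "norm (\<psi> z - \<phi> z) \<le> 2 * (\<delta> + \<delta>) * decay_weight z" for z
      using le[OF s(1), of z] le[OF s(2), of z] by (intro le_decay_weight) auto
    from integrable_mult_decay_weight(2)[OF g _ int this]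
    have "norm (LINT z|lborel. g z * (\<psi> z - \<phi> z)) \<le> 4 * \<delta> * K"
      using schwartz_measurable[OF \<phi>] schwartz_measurable[OF \<psi>] by (simp add: K_def)
    moreover have "(LINT z|lborel. g z * (\<psi> z - \<phi> z)) = T \<psi> - T \<phi>"
      using i[OF \<phi>] i[OF \<psi>] by (simp add: T_def distribution_of_def right_diff_distrib)
    ultimately show ?thesis by simp
  qed
  have "continuous_map schwartz_topology euclidean T"
    unfolding continuous_map_def
  proof (intro conjI allI impI)
    fix U :: "complex set" assume "openin euclidean U"
    then have U: "open U" by simp
    show "openin schwartz_topology {\<phi> \<in> topspace schwartz_topology. T \<phi> \<in> U}"
    proof (subst openin_subopen, intro ballI)
      fix \<phi> assume "\<phi> \<in> {\<phi> \<in> topspace schwartz_topology. T \<phi> \<in> U}"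
      then have \<phi>: "\<phi> \<in> schwartz_space" "T \<phi> \<in> U"
        by (auto simp: schwartz_topology_def)
      obtain e where e: "0 < e" "ball (T \<phi>) e \<subseteq> U" using U \<phi>(2) by (auto simp: open_contains_ball)
      (* K may vanish, hence K + 1. *)
      define \<delta> where "\<delta> = e / (4 * (K + 1))"
      have \<delta>: "0 < \<delta>" "4 * \<delta> * K < e"
        using e \<open>0 \<le> K\<close> by (auto simp: \<delta>_def field_simps)
      define B where "B k = {\<psi> \<in> schwartz_space. schwartz_seminorm k [] (\<lambda>z. \<psi> z - \<phi> z) < \<delta>}" for k
      have B: "openin schwartz_topology (B k)" for k
        unfolding schwartz_topology_def B_def
        by (rule topology_generated_by_Basis) (use \<phi> \<delta> in \<open>auto intro!: exI[of _ k] exI[of _ "[]"] exI[of _ \<phi>] exI[of _ \<delta>]\<close>)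
      have "B 0 \<inter> B 4 \<subseteq> {\<psi> \<in> topspace schwartz_topology. T \<psi> \<in> U}"
      proof
        fix \<psi> assume \<psi>: "\<psi> \<in> B 0 \<inter> B 4"
        then have "norm (T \<psi> - T \<phi>) < e" using bound[OF \<phi>(1), of \<psi> \<delta>] \<delta>(2) by (auto simp: B_def)
        then have "T \<psi> \<in> U" using e(2) by (auto simp: dist_norm norm_minus_commute)
        then show "\<psi> \<in> {\<psi> \<in> topspace schwartz_topology. T \<psi> \<in> U}"
          using \<psi> openin_subset[OF B[of 0]] by auto
      qed
      moreover have "\<phi> \<in> B 0 \<inter> B 4"
        using \<phi> \<delta> by (auto simp: B_def schwartz_seminorm_def partial_derivs_def)
      ultimately show "\<exists>V. openin schwartz_topology V \<and> \<phi> \<in> V \<and> V \<subseteq> {\<phi> \<in> topspace schwartz_topology. T \<phi> \<in> U}"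
        using openin_Int[OF B B] by blast
    qed
  qed simp
  moreover have "T (\<lambda>z. \<phi> z + \<psi> z) = T \<phi> + T \<psi>" if "\<phi> \<in> schwartz_space" "\<psi> \<in> schwartz_space" for \<phi> \<psi>
    using i[OF that(1)] i[OF that(2)] by (simp add: T_def distribution_of_def distrib_left)
  moreover have "T (\<lambda>z. c * \<phi> z) = c * T \<phi>" for c \<phi>
    by (simp add: T_def distribution_of_def mult.left_commute)
  ultimately show ?thesis by (simp add: tempered_distribution_def T_def[symmetric])
qed

section \<open>The Fourier transform of Schwartz functions\<close>

lemma fourier_measurable:
  fixes \<phi> :: "'a::euclidean_space \<Rightarrow> complex"
  assumes [measurable]: "\<phi> \<in> borel_measurable borel"
  shows "fourier \<phi> \<in> borel_measurable borel"
  unfolding fourier_def[abs_def] by measurable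

lemma norm_exp_imaginary: "norm (exp (- 2 * pi * \<i> * complex_of_real r)) = 1"
proof -
  have "- 2 * pi * \<i> * complex_of_real r = \<i> * complex_of_real (- 2 * pi * r)" by simp
  then show ?thesis by (metis norm_exp_i_times)
qed

lemma fourier_integrable:
  fixes \<phi> :: "'a::euclidean_space \<Rightarrow> complex"
  assumes \<phi>: "integrable lborel \<phi>"
  shows "integrable lborel (\<lambda>x. exp (- 2 * pi * \<i> * complex_of_real (x \<bullet> \<xi>)) * \<phi> x)"
proof (rule Bochner_Integration.integrable_bound[OF \<phi>])
  have [measurable]: "\<phi> \<in> borel_measurable borel" using \<phi> by auto
  show "(\<lambda>x. exp (- 2 * pi * \<i> * complex_of_real (x \<bullet> \<xi>)) * \<phi> x) \<in> borel_measurable lborel" by measurable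
qed (simp add: norm_mult norm_exp_imaginary del: mult_minus_left)

lemma norm_fourier_le:
  assumes "integrable lborel \<phi>" shows "norm (fourier \<phi> \<xi>) \<le> (LINT x|lborel. norm (\<phi> x))"
proof -
  have "norm (fourier \<phi> \<xi>) \<le> (LINT x|lborel. norm (exp (- 2 * pi * \<i> * complex_of_real (x \<bullet> \<xi>)) * \<phi> x))"
    unfolding fourier_def by (rule integral_norm_bound)
  then show ?thesis by (simp add: norm_mult norm_exp_imaginary del: mult_minus_left)
qed

text \<open>Both sides are the same double integral.\<close>

lemma fourier_multiplication_formula:
  fixes k \<phi> :: "'a::euclidean_space \<Rightarrow> complex"
  assumes k: "integrable lborel k" and \<phi>: "integrable lborel \<phi>"
  shows "(LINT z|lborel. k z * fourier \<phi> z) = (LINT z|lborel. fourier k z * \<phi> z)"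
proof -
  have [measurable]: "k \<in> borel_measurable borel" "\<phi> \<in> borel_measurable borel" using k \<phi> by auto
  let ?e = "\<lambda>x y :: 'a. exp (- 2 * pi * \<i> * complex_of_real (x \<bullet> y))"
  have "integrable (lborel \<Otimes>\<^sub>M lborel) (\<lambda>(x, y). k x * \<phi> y * ?e y x)"
  proof (rule Bochner_Integration.integrable_bound[OF integrable_lborel_mult[OF k \<phi>]])
    show "(\<lambda>(x, y). k x * \<phi> y * ?e y x) \<in> borel_measurable (lborel \<Otimes>\<^sub>M lborel)" by measurable
  qed (auto simp: norm_mult norm_exp_imaginary simp del: mult_minus_left)
  then have "(LINT y|lborel. LINT x|lborel. k x * \<phi> y * ?e y x) = (LINT x|lborel. LINT y|lborel. k x * \<phi> y * ?e y x)"
    by (rule lborel_pair.Fubini_integral)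
  moreover have "(LINT y|lborel. k x * \<phi> y * ?e y x) = k x * fourier \<phi> x" for x
    unfolding fourier_def by (subst integral_mult_right_zero[symmetric]) (simp add: mult_ac)
  moreover have "(LINT x|lborel. k x * \<phi> y * ?e y x) = fourier k y * \<phi> y" for y
    unfolding fourier_def by (subst integral_mult_left_zero[symmetric]) (simp add: mult_ac inner_commute)
  ultimately show ?thesis by simp
qed

lemma integral_lborel_translate:
  fixes f :: "'a::euclidean_space \<Rightarrow> 'b::{banach,second_countable_topology}"
  assumes [measurable]: "f \<in> borel_measurable borel"
  shows "(LINT x|lborel. f (c + x)) = (LINT x|lborel. f x)"
    and "integrable lborel (\<lambda>x. f (c + x)) \<longleftrightarrow> integrable lborel f"
proof -
  have d: "distr lborel borel ((+) c) = (lborel :: 'a measure)" by (rule lborel_distr_plus)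
  show "(LINT x|lborel. f (c + x)) = (LINT x|lborel. f x)"
    by (subst (2) d[symmetric], subst integral_distr) auto
  show "integrable lborel (\<lambda>x. f (c + x)) \<longleftrightarrow> integrable lborel f"
    by (subst (2) d[symmetric], subst integrable_distr_eq) auto
qed

lemma decay_weight_translate:
  assumes b: "b \<in> Basis" and \<theta>: "\<bar>\<theta>\<bar> \<le> 1"
  shows "decay_weight (z + \<theta> *\<^sub>R b) \<le> 3 * decay_weight z"
proof -
  have 1: "inverse (1 + (x + \<theta>)\<^sup>2) \<le> 3 * inverse (1 + x\<^sup>2)" for x :: real
  proof -
    have "0 \<le> (2 * x + 3 * \<theta>)\<^sup>2" "\<theta>\<^sup>2 \<le> 1" using \<theta> by (auto simp: abs_square_le_1)
    then have "1 + x\<^sup>2 \<le> 3 * (1 + (x + \<theta>)\<^sup>2)" by (simp add: power2_eq_square algebra_simps)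
    then show ?thesis by (simp add: field_simps add_pos_nonneg)
  qed
  have 3: "inverse (1 + (x::real)\<^sup>2) \<ge> 0" for x by simp
  from b have "b = (1, 0) \<or> b = (0, 1)" by (auto simp: Basis_prod_def)
  then show ?thesis
    using 1[of "fst z"] 1[of "snd z"] mult_right_mono[OF 1 3] mult_left_mono[OF 1 3]
    by (auto simp: decay_weight_def mult_ac)
qed

lemma has_vector_derivative_along:
  fixes \<phi> :: "'a::euclidean_space \<Rightarrow> complex"
  assumes "\<phi> \<in> schwartz_space"
  shows "((\<lambda>r. \<phi> (z + r *\<^sub>R b)) has_vector_derivative partial_deriv b \<phi> (z + r *\<^sub>R b)) (at r)"
proof -
  let ?D = "frechet_derivative \<phi> (at (z + r *\<^sub>R b))"
  have D: "(\<phi> has_derivative ?D) (at (z + r *\<^sub>R b))"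
    using schwartz_differentiable[OF assms] frechet_derivative_works by blast
  have "((\<lambda>r. z + r *\<^sub>R b) has_derivative (\<lambda>h. h *\<^sub>R b)) (at r)"
    by (auto intro!: derivative_eq_intros)
  from has_derivative_compose[OF this D]
  have "((\<lambda>r. \<phi> (z + r *\<^sub>R b)) has_derivative (\<lambda>h. ?D (h *\<^sub>R b))) (at r)" .
  moreover have "?D (h *\<^sub>R b) = h *\<^sub>R ?D b" for h
    by (rule linear_scale) (rule has_derivative_linear[OF D])
  ultimately show ?thesis by (simp add: has_vector_derivative_def partial_deriv_def)
qed

text \<open>Instead of integrating by parts, translate: the transform of \<open>\<phi> (z + d b)\<close> is a phase times that of
\<open>\<phi>\<close>, and the difference quotients in \<open>d\<close> converge with a common integrable majorant, because the
weight changes at most by a factor \<open>3\<close> under unit translations.\<close>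

lemma fourier_partial_deriv:
  fixes \<phi> :: "real \<times> real \<Rightarrow> complex"
  assumes \<phi>: "\<phi> \<in> schwartz_space" and b: "b \<in> Basis"
  shows "fourier (partial_deriv b \<phi>) \<xi> = 2 * pi * \<i> * complex_of_real (b \<bullet> \<xi>) * fourier \<phi> \<xi>"
proof -
  define e where "e x = exp (- 2 * pi * \<i> * complex_of_real (x \<bullet> \<xi>))" for x
  have e: "norm (e x) = 1" "e (x + y) = e x * e y" for x y
    unfolding e_def using norm_exp_imaginary by (simp_all add: inner_add_left algebra_simps flip: exp_add)
  have [measurable]: "e \<in> borel_measurable borel" unfolding e_def[abs_def] by measurable
  have [measurable]: "\<phi> \<in> borel_measurable borel" by (rule schwartz_measurable[OF \<phi>])
  define \<psi> where "\<psi> = partial_deriv b \<phi>"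
  have \<psi>: "\<psi> \<in> schwartz_space" unfolding \<psi>_def by (rule partial_deriv_schwartz[OF \<phi> b])
  have [measurable]: "\<psi> \<in> borel_measurable borel" by (rule schwartz_measurable[OF \<psi>])
  obtain C where C: "0 \<le> C" "\<And>z. norm (\<psi> z) \<le> C * decay_weight z" using schwartz_le_decay_weight[OF \<psi>] by blast
  define d where "d n = 1 / real (Suc n)" for n
  have d: "0 < d n" "d n \<le> 1" "d \<longlonglongrightarrow> 0" for n
    using LIMSEQ_Suc[OF lim_1_over_n[where 'a = real]] by (auto simp: d_def[abs_def])
  define D where "D n z = (\<phi> (z + d n *\<^sub>R b) - \<phi> z) /\<^sub>R d n" for n z
  have D_lim: "(\<lambda>n. D n z) \<longlonglongrightarrow> \<psi> z" for z
  proof -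
    have "((\<lambda>r. \<phi> (z + r *\<^sub>R b)) has_vector_derivative \<psi> z) (at 0)"
      using has_vector_derivative_along[OF \<phi>, of z b 0] by (simp add: \<psi>_def)
    then have "((\<lambda>r. (\<phi> (z + r *\<^sub>R b) - \<phi> z) /\<^sub>R r) \<longlongrightarrow> \<psi> z) (at 0)"
      unfolding has_vector_derivative_def has_derivative_iff_norm
    proof (elim conjE)
      assume "((\<lambda>r. norm (\<phi> (z + r *\<^sub>R b) - \<phi> (z + 0 *\<^sub>R b) - (r - 0) *\<^sub>R \<psi> z) / norm (r - 0)) \<longlongrightarrow> 0) (at 0)"
      then have "((\<lambda>r. norm ((\<phi> (z + r *\<^sub>R b) - \<phi> z) /\<^sub>R r - \<psi> z)) \<longlongrightarrow> 0) (at 0)"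
      proof (rule Lim_transform_eventually)
        show "\<forall>\<^sub>F r in at 0. norm (\<phi> (z + r *\<^sub>R b) - \<phi> (z + 0 *\<^sub>R b) - (r - 0) *\<^sub>R \<psi> z) / norm (r - 0)
            = norm ((\<phi> (z + r *\<^sub>R b) - \<phi> z) /\<^sub>R r - \<psi> z)"
          unfolding eventually_at
        proof (intro exI[of _ 1] conjI ballI impI)
          fix r :: real assume "r \<noteq> 0 \<and> dist r 0 < 1"
          then have "(\<phi> (z + r *\<^sub>R b) - \<phi> z) /\<^sub>R r - \<psi> z = (\<phi> (z + r *\<^sub>R b) - \<phi> z - r *\<^sub>R \<psi> z) /\<^sub>R r"
            by (simp add: scaleR_diff_right)
          then show "norm (\<phi> (z + r *\<^sub>R b) - \<phi> (z + 0 *\<^sub>R b) - (r - 0) *\<^sub>R \<psi> z) / norm (r - 0)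
            = norm ((\<phi> (z + r *\<^sub>R b) - \<phi> z) /\<^sub>R r - \<psi> z)"
            by (simp add: divide_inverse mult.commute)
        qed simp
      qed
      then show "((\<lambda>r. (\<phi> (z + r *\<^sub>R b) - \<phi> z) /\<^sub>R r) \<longlongrightarrow> \<psi> z) (at 0)"
        by (rule LIM_zero_cancel[OF tendsto_norm_zero_cancel])
    qed
    then show ?thesis
      unfolding tendsto_at_iff_sequentially comp_def D_def using d by (auto simp: less_le)
  qed
  have D_le: "norm (D n z) \<le> 3 * C * decay_weight z" for n z
  proof -
    have "norm (\<phi> (z + d n *\<^sub>R b) - \<phi> (z + 0 *\<^sub>R b)) \<le> 3 * C * decay_weight z * d n - 3 * C * decay_weight z * 0"
    proof (rule differentiable_bound_general[OF d(1), where f = "\<lambda>r. \<phi> (z + r *\<^sub>R b)" and \<phi> = "\<lambda>r. 3 * C * decay_weight z * r"])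
      show "continuous_on {0..d n} (\<lambda>r. \<phi> (z + r *\<^sub>R b))"
        using has_vector_derivative_along[OF \<phi>]
        by (intro continuous_at_imp_continuous_on ballI has_vector_derivative_continuous)
      fix r assume "0 < r" "r < d n"
      then have "\<bar>r\<bar> \<le> 1" using d(2)[of n] by simp
      from mult_left_mono[OF decay_weight_translate[OF b this, of z] C(1)]
      show "norm (\<psi> (z + r *\<^sub>R b)) \<le> 3 * C * decay_weight z"
        using C(2)[of "z + r *\<^sub>R b"] by (simp add: mult_ac)
      show "((\<lambda>r. \<phi> (z + r *\<^sub>R b)) has_vector_derivative \<psi> (z + r *\<^sub>R b)) (at r)"
        unfolding \<psi>_def by (rule has_vector_derivative_along[OF \<phi>])
      show "((\<lambda>r. 3 * C * decay_weight z * r) has_vector_derivative 3 * C * decay_weight z) (at r)"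
        by (auto intro!: derivative_eq_intros simp: has_real_derivative_iff_has_vector_derivative[symmetric])
    qed (intro continuous_intros)
    then have "norm (\<phi> (z + d n *\<^sub>R b) - \<phi> z) / d n \<le> 3 * C * decay_weight z"
      using d(1)[of n] by (simp add: pos_divide_le_eq)
    then show ?thesis using d(1)[of n] by (simp add: D_def divide_inverse mult.commute)
  qed
  have "(\<lambda>n. LINT z|lborel. e z * D n z) \<longlonglongrightarrow> (LINT z|lborel. e z * \<psi> z)"
  proof (rule integral_dominated_convergence[where w = "\<lambda>z. 3 * C * decay_weight z"])
    show "integrable lborel (\<lambda>z. 3 * C * decay_weight z)" by (intro integrable_mult_right integrable_decay_weight)
    show "AE z in lborel. (\<lambda>n. e z * D n z) \<longlonglongrightarrow> e z * \<psi> z" by (intro AE_I2 tendsto_mult tendsto_const D_lim)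
    show "AE z in lborel. norm (e z * D n z) \<le> 3 * C * decay_weight z" for n using D_le by (simp add: norm_mult e)
  qed (simp_all add: D_def)
  moreover have "(LINT z|lborel. e z * D n z) = ((inverse (e (d n *\<^sub>R b)) - 1) / d n) * fourier \<phi> \<xi>" for n
  proof -
    have i: "integrable lborel (\<lambda>z. e z * \<phi> z)"
      using fourier_integrable[OF schwartz_integrable[OF \<phi>], of \<xi>] by (simp add: e_def)
    have "integrable lborel (\<lambda>z. e (d n *\<^sub>R b + z) * \<phi> (d n *\<^sub>R b + z))"
      by (subst integral_lborel_translate(2)[where f = "\<lambda>z. e z * \<phi> z"]) (auto simp: i)
    moreover have "e (d n *\<^sub>R b) \<noteq> 0" using e(1) by (metis norm_zero zero_neq_one)
    then have eq: "e z * \<phi> (z + d n *\<^sub>R b) = inverse (e (d n *\<^sub>R b)) * (e (d n *\<^sub>R b + z) * \<phi> (d n *\<^sub>R b + z))" for z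
      by (simp add: e(2) add.commute)
    ultimately have i2: "integrable lborel (\<lambda>z. e z * \<phi> (z + d n *\<^sub>R b))" by simp
    have "(LINT z|lborel. e z * \<phi> (z + d n *\<^sub>R b)) = inverse (e (d n *\<^sub>R b)) * (LINT z|lborel. e z * \<phi> z)"
      unfolding eq by (subst integral_mult_right_zero, subst integral_lborel_translate(1)[where f = "\<lambda>z. e z * \<phi> z"]) auto
    moreover have "(LINT z|lborel. e z * D n z) = (LINT z|lborel. (e z * \<phi> (z + d n *\<^sub>R b) - e z * \<phi> z) /\<^sub>R d n)"
      by (simp add: D_def algebra_simps)
    moreover have "\<dots> = ((LINT z|lborel. e z * \<phi> (z + d n *\<^sub>R b)) - (LINT z|lborel. e z * \<phi> z)) /\<^sub>R d n"
      using i i2 by simp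
    moreover have "fourier \<phi> \<xi> = (LINT z|lborel. e z * \<phi> z)" by (simp only: fourier_def e_def)
    ultimately show ?thesis by (simp add: scaleR_conv_of_real divide_inverse algebra_simps)
  qed
  moreover have "(\<lambda>n. ((inverse (e (d n *\<^sub>R b)) - 1) / d n) * fourier \<phi> \<xi>) \<longlonglongrightarrow> 2 * pi * \<i> * complex_of_real (b \<bullet> \<xi>) * fourier \<phi> \<xi>"
  proof (intro tendsto_mult tendsto_const)
    let ?c = "2 * pi * \<i> * complex_of_real (b \<bullet> \<xi>)"
    have "((\<lambda>r. exp (?c * r)) has_field_derivative ?c) (at 0)" by (auto intro!: derivative_eq_intros)
    then have "((\<lambda>r. (exp (?c * r) - 1) / r) \<longlongrightarrow> ?c) (at 0)" by (simp add: DERIV_def)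
    moreover have "(\<lambda>n. complex_of_real (d n)) \<longlonglongrightarrow> 0" using tendsto_of_real[OF d(3)] by simp
    ultimately have "(\<lambda>n. (exp (?c * d n) - 1) / d n) \<longlonglongrightarrow> ?c"
      unfolding tendsto_at_iff_sequentially comp_def using d(1) by (auto simp: less_le)
    moreover have "exp (?c * d n) = inverse (e (d n *\<^sub>R b))" for n
      by (simp add: e_def mult_ac flip: exp_minus)
    ultimately show "(\<lambda>n. (inverse (e (d n *\<^sub>R b)) - 1) / d n) \<longlonglongrightarrow> ?c" by simp
  qed
  ultimately have "(LINT z|lborel. e z * \<psi> z) = 2 * pi * \<i> * complex_of_real (b \<bullet> \<xi>) * fourier \<phi> \<xi>"
    using LIMSEQ_unique by simp
  then show ?thesis by (simp add: fourier_def e_def \<psi>_def)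
qed

text \<open>Multiplying the transform by \<open>(1 + (2 pi x)^2) (1 + (2 pi t)^2)\<close> amounts to applying
\<open>1 - L\<close> in each coordinate direction, where \<open>L\<close> is the second derivative, before transforming; the
transforms of the four resulting Schwartz functions are bounded.\<close>

lemma fourier_schwartz_le_decay_weight:
  fixes \<phi> :: "real \<times> real \<Rightarrow> complex"
  assumes \<phi>: "\<phi> \<in> schwartz_space"
  obtains C where "\<And>\<xi>. norm (fourier \<phi> \<xi>) \<le> C * decay_weight \<xi>"
proof -
  define L where "L b \<phi> = partial_deriv b (partial_deriv b \<phi>)" for b :: "real \<times> real" and \<phi>
  have b: "(1, 0) \<in> (Basis :: (real \<times> real) set)" "(0, 1) \<in> (Basis :: (real \<times> real) set)"
    by (auto simp: Basis_prod_def)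
  have LS: "L b \<phi> \<in> schwartz_space" if "\<phi> \<in> schwartz_space" "b \<in> Basis" for b \<phi>
    unfolding L_def using that by (intro partial_deriv_schwartz)
  have LF: "fourier (L b \<phi>) \<xi> = - complex_of_real ((2 * pi * (b \<bullet> \<xi>))\<^sup>2) * fourier \<phi> \<xi>"
    if "\<phi> \<in> schwartz_space" "b \<in> Basis" for b \<phi> \<xi>
    unfolding L_def using that
    by (simp add: fourier_partial_deriv partial_deriv_schwartz power2_eq_square algebra_simps)
  let ?n = "\<lambda>\<phi> :: real \<times> real \<Rightarrow> complex. LINT x|lborel. norm (\<phi> x)"
  define C where "C = ?n \<phi> + ?n (L (1, 0) \<phi>) + ?n (L (0, 1) \<phi>) + ?n (L (0, 1) (L (1, 0) \<phi>))"
  have "norm (fourier \<phi> \<xi>) \<le> C * decay_weight \<xi>" for \<xi>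
  proof -
    obtain x t where \<xi>: "\<xi> = (x, t)" by (cases \<xi>)
    define X where "X = (1 + (2 * pi * x)\<^sup>2) * (1 + (2 * pi * t)\<^sup>2)"
    have X_pos: "0 < X" unfolding X_def by (intro mult_pos_pos add_pos_nonneg) auto
    have "complex_of_real X * fourier \<phi> \<xi> =
        fourier \<phi> \<xi> - fourier (L (1, 0) \<phi>) \<xi> - fourier (L (0, 1) \<phi>) \<xi> + fourier (L (0, 1) (L (1, 0) \<phi>)) \<xi>"
      unfolding LF[OF LS[OF \<phi> b(1)] b(2)] LF[OF \<phi> b(1)] LF[OF \<phi> b(2)]
      by (simp add: \<xi> X_def algebra_simps)
    also have "norm \<dots> \<le> C"
      unfolding C_def using \<phi> b
      by (intro norm_triangle_mono norm_triangle_le_diff add_mono norm_fourier_le schwartz_integrable LS | rule order_trans[OF norm_triangle_ineq4 add_mono])+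
    finally have "X * norm (fourier \<phi> \<xi>) \<le> C"
      by (simp add: norm_mult X_pos less_imp_le)
    moreover have "(1 + x\<^sup>2) * (1 + t\<^sup>2) \<le> X"
    proof -
      have "1 + y\<^sup>2 \<le> 1 + (2 * pi * y)\<^sup>2" for y :: real
      proof -
        have "1 \<le> (2 * pi)\<^sup>2" using pi_gt3 by (intro one_le_power) simp
        then have "1 * y\<^sup>2 \<le> (2 * pi)\<^sup>2 * y\<^sup>2" by (intro mult_right_mono) auto
        then show ?thesis by (simp add: power_mult_distrib)
      qed
      then show ?thesis unfolding X_def by (intro mult_mono) auto
    qed
    ultimately have "((1 + x\<^sup>2) * (1 + t\<^sup>2)) * norm (fourier \<phi> \<xi>) \<le> C"
      by (meson mult_right_mono norm_ge_zero order_trans)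
    moreover have "0 < (1 + x\<^sup>2) * (1 + t\<^sup>2)" by (intro mult_pos_pos add_pos_nonneg) auto
    ultimately have "norm (fourier \<phi> \<xi>) \<le> C / ((1 + x\<^sup>2) * (1 + t\<^sup>2))" by (simp add: pos_le_divide_eq mult.commute)
    then show ?thesis by (simp add: decay_weight_def \<xi> divide_inverse)
  qed
  then show thesis by (rule that)
qed

section \<open>Gaussian and quartic exponentials\<close>

lemma gaussian_integrable:
  assumes "0 < \<tau>" shows "integrable lborel (\<lambda>t. exp (- \<tau> * t\<^sup>2) :: real)"
proof -
  define c where "c = sqrt (2 * \<tau>)"
  have c: "c > 0" "c\<^sup>2 = 2 * \<tau>" using assms by (auto simp: c_def)
  have "integrable lborel (\<lambda>t. sqrt (2 * pi) * std_normal_density (0 + c * t))"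
    using c by (intro integrable_mult_right) (subst lborel_integrable_real_affine_iff, auto)
  moreover have "sqrt (2 * pi) * std_normal_density (0 + c * t) = exp (- \<tau> * t\<^sup>2)" for t
    using c by (simp add: std_normal_density_def power_mult_distrib)
  ultimately show ?thesis by (simp only:)
qed

text \<open>The characteristic function of the standard normal distribution, rescaled.\<close>

lemma gaussian_fourier:
  assumes "0 < \<tau>"
  shows "(LINT t|lborel. exp (- 2 * pi * \<i> * complex_of_real (t * \<eta>)) * complex_of_real (exp (- \<tau> * t\<^sup>2)))
     = complex_of_real (sqrt (pi / \<tau>) * exp (- pi\<^sup>2 * \<eta>\<^sup>2 / \<tau>))"
proof -
  define c where "c = 1 / sqrt (2 * \<tau>)"
  have c: "c > 0" "\<tau> * (c * x)\<^sup>2 = x\<^sup>2 / 2" for x using assms by (auto simp: c_def power_mult_distrib power_divide)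
  define r where "r = - 2 * pi * \<eta> * c"
  have r: "r\<^sup>2 / 2 = pi\<^sup>2 * \<eta>\<^sup>2 / \<tau>" using assms by (simp add: r_def c_def power_mult_distrib power_divide)
  have pt: "exp (- 2 * pi * \<i> * complex_of_real ((0 + c * x) * \<eta>)) * complex_of_real (exp (- \<tau> * (0 + c * x)\<^sup>2))
     = complex_of_real (sqrt (2 * pi)) * (std_normal_density x *\<^sub>R iexp (r * x))" for x
    using c(2)[of x] by (simp add: std_normal_density_def r_def scaleR_conv_of_real mult_ac)
  have "complex_of_real (exp (- (r\<^sup>2) / 2)) = char std_normal_distribution r"
    by (simp add: char_std_normal_distribution)
  also have "\<dots> = (LINT x|lborel. std_normal_density x *\<^sub>R iexp (r * x))"
    unfolding char_def by (subst integral_density) (auto simp: normal_density_nonneg)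
  finally have st: "(LINT x|lborel. std_normal_density x *\<^sub>R iexp (r * x)) = complex_of_real (exp (- (r\<^sup>2) / 2))" ..
  have "(LINT t|lborel. exp (- 2 * pi * \<i> * complex_of_real (t * \<eta>)) * complex_of_real (exp (- \<tau> * t\<^sup>2)))
    = c *\<^sub>R (LINT x|lborel. exp (- 2 * pi * \<i> * complex_of_real ((0 + c * x) * \<eta>)) * complex_of_real (exp (- \<tau> * (0 + c * x)\<^sup>2)))"
    using c by (subst lborel_integral_real_affine[of c _ 0]) auto
  also have "\<dots> = c *\<^sub>R (LINT x|lborel. complex_of_real (sqrt (2 * pi)) * (std_normal_density x *\<^sub>R iexp (r * x)))"
    unfolding pt ..
  also have "\<dots> =
      complex_of_real (c * sqrt (2 * pi) * exp (- (r\<^sup>2) / 2))"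
    unfolding integral_mult_right_zero st by (simp add: scaleR_conv_of_real)
  also have "c * sqrt (2 * pi) = sqrt (pi / \<tau>)"
    using assms by (simp add: c_def real_sqrt_divide real_sqrt_mult)
  finally show ?thesis using r by simp
qed

lemma exp_exp_integral:
  fixes r A :: real assumes "0 < r" "0 < A"
  shows "integrable lborel (\<lambda>v. exp (r * v - A * exp v))"
    and "(LINT v|lborel. exp (r * v - A * exp v)) = A powr (- r) * Gamma r"
proof -
  have eq: "exp (r * (- ln A + 1 * v) - A * exp (- ln A + 1 * v)) = A powr (- r) * exp (r * v - exp v)" for v
  proof -
    have "A * exp (- ln A + 1 * v) = exp v" using assms by (simp add: exp_diff)
    then show ?thesis using assms by (simp add: powr_def algebra_simps flip: exp_add)
  qed
  have "integrable lborel (\<lambda>v. exp (r * (- ln A + 1 * v) - A * exp (- ln A + 1 * v)))"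
    unfolding eq by (intro integrable_mult_right Gamma_exp_integral assms)
  then show "integrable lborel (\<lambda>v. exp (r * v - A * exp v))"
    by (subst (asm) lborel_integrable_real_affine_iff) auto
  show "(LINT v|lborel. exp (r * v - A * exp v)) = A powr (- r) * Gamma r"
    by (subst lborel_integral_real_affine[of 1 _ "- ln A"]) (simp_all only: eq Gamma_exp_integral[OF assms(1)] integral_mult_right_zero, simp_all)
qed

lemma exp_exp_integral_neg:
  fixes r A :: real assumes "0 < r" "0 < A"
  shows "integrable lborel (\<lambda>v. exp (- r * v - A * exp (- v)))"
    and "(LINT v|lborel. exp (- r * v - A * exp (- v))) = A powr (- r) * Gamma r"
  using exp_exp_integral[OF assms] lborel_integrable_real_affine_iff[of "- 1" "\<lambda>v. exp (r * v - A * exp v)" 0]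
    lborel_integral_real_affine[of "- 1" "\<lambda>v. exp (r * v - A * exp v)" 0] by auto

lemma quartic_integrable: "integrable lborel (\<lambda>x::real. exp (- (x ^ 4)))"
proof (rule Bochner_Integration.integrable_bound)
  show "integrable lborel (\<lambda>x::real. exp 1 * exp (- 1 * x\<^sup>2))"
    by (intro integrable_mult_right gaussian_integrable) simp
  have "- (x ^ 4) \<le> 1 + - 1 * x\<^sup>2" for x :: real
  proof -
    have "0 \<le> (x\<^sup>2 - 1 / 2)\<^sup>2" by simp
    then show ?thesis by (simp add: power2_eq_square power4_eq_xxxx algebra_simps)
  qed
  then show "AE x::real in lborel. norm (exp (- (x ^ 4))) \<le> norm (exp 1 * exp (- 1 * x\<^sup>2))"
    unfolding exp_add[symmetric] by (intro AE_I2) simp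
qed measurable

lemma quartic_scaled:
  shows "integrable lborel (\<lambda>x::real. exp (- exp v * x ^ 4))"
    and "(LINT x|lborel. exp (- exp v * x ^ 4)) = exp (- v / 4) * (LINT x|lborel. exp (- ((x::real) ^ 4)))"
proof -
  have eq: "exp (- exp v * (0 + exp (- v / 4) * x) ^ 4) = exp (- (x ^ 4))" for x
  proof -
    have "exp (- v / 4) ^ 4 = exp (4 * (- v / 4))" by (simp only: exp_of_nat_mult[symmetric] of_nat_numeral)
    then have "exp v * exp (- v / 4) ^ 4 = 1" by (simp flip: exp_add)
    then show ?thesis by (simp add: power_mult_distrib mult.assoc[symmetric])
  qed
  have "integrable lborel (\<lambda>x. exp (- exp v * (0 + exp (- v / 4) * x) ^ 4))" unfolding eq by (rule quartic_integrable)
  then show "integrable lborel (\<lambda>x::real. exp (- exp v * x ^ 4))"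
    by (subst (asm) lborel_integrable_real_affine_iff) auto
  show "(LINT x|lborel. exp (- exp v * x ^ 4)) = exp (- v / 4) * (LINT x|lborel. exp (- ((x::real) ^ 4)))"
    by (subst lborel_integral_real_affine[of "exp (- v / 4)" _ 0]) (simp_all only: eq, simp_all)
qed

definition quartic_mass :: real where "quartic_mass = (LINT x|lborel. exp (- ((x::real) ^ 4)))"

lemma quartic_mass_nonneg: "0 \<le> quartic_mass" unfolding quartic_mass_def by (rule integral_nonneg_AE) simp

definition quartic_fourier :: "real \<Rightarrow> real \<Rightarrow> complex" where
  "quartic_fourier v \<xi> = (LINT x|lborel. exp (- 2 * pi * \<i> * complex_of_real (x * \<xi>)) * complex_of_real (exp (- exp v * x ^ 4)))"

lemma quartic_fourier_measurable [measurable (raw)]: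
  assumes [measurable]: "f \<in> borel_measurable N" "h \<in> borel_measurable N"
  shows "(\<lambda>z. quartic_fourier (f z) (h z)) \<in> borel_measurable N"
  unfolding quartic_fourier_def by measurable

lemma norm_quartic_fourier_le: "norm (quartic_fourier v \<xi>) \<le> exp (- v / 4) * quartic_mass"
proof -
  have "norm (quartic_fourier v \<xi>) \<le> (LINT x|lborel. norm (exp (- 2 * pi * \<i> * complex_of_real (x * \<xi>)) * complex_of_real (exp (- exp v * x ^ 4))))"
    unfolding quartic_fourier_def by (rule integral_norm_bound)
  also have "\<dots> = (LINT x|lborel. exp (- exp v * x ^ 4))"
    by (simp add: norm_mult norm_exp_imaginary del: of_real_mult mult_minus_left)
  finally show ?thesis unfolding quartic_scaled(2) quartic_mass_def .
qed

section \<open>The candidate for the transform of fs and its Bessel kernel\<close>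

text \<open>The superposition of the Fourier transforms of \<open>exp (- exp v * x^4) * exp (- exp v * t^2)\<close> with the
weights of the Gamma integral for \<open>fs\<close>. The Gaussian factor has been evaluated, which
contributes \<open>sqrt pi\<close> and lowers the exponent from \<open>a\<close> to \<open>a - 1 / 2\<close>. Written in this order of
integration the function is visibly measurable.\<close>

definition fs_transform :: "real \<Rightarrow> real \<times> real \<Rightarrow> complex" where
  "fs_transform a z = complex_of_real (sqrt pi / Gamma a) *
     (LINT v|lborel. complex_of_real (exp ((a - 1 / 2) * v - (pi * snd z)\<^sup>2 * exp (- v))) * quartic_fourier v (fst z))"

lemma fs_transform_measurable [measurable]: "fs_transform a \<in> borel_measurable borel"
  unfolding fs_transform_def[abs_def] borel_prod[symmetric] by measurable

text \<open>At \<open>x = 0\<close> the integral may diverge, and the value is then \<open>0\<close>; only \<open>x \<noteq> 0\<close> matters.\<close>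

definition bessel_kernel :: "real \<Rightarrow> real \<Rightarrow> real \<Rightarrow> real" where
  "bessel_kernel a A x = (LINT v|lborel. exp ((a - 1 / 2) * v - A * exp (- v) - exp v * x ^ 4))"

text \<open>Integrating over \<open>x\<close> first contributes \<open>exp (- v / 4)\<close>, and what remains is a Gamma integral of order
\<open>3 / 4 - a\<close>.\<close>

lemma bessel_kernel_product_integrable:
  fixes a A :: real
  assumes "0 < a" "a < 3 / 4" "0 < A"
  shows "integrable (lborel \<Otimes>\<^sub>M lborel) (\<lambda>(v, x). exp ((a - 1 / 2) * v - A * exp (- v) - exp v * x ^ 4))"
proof (rule lborel_pair.Fubini_integrable)
  show "(\<lambda>(v, x). exp ((a - 1 / 2) * v - A * exp (- v) - exp v * x ^ 4)) \<in> borel_measurable (lborel \<Otimes>\<^sub>M lborel)"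
    by measurable
  have eq: "exp ((a - 1 / 2) * v - A * exp (- v) - exp v * x ^ 4) = exp ((a - 1 / 2) * v - A * exp (- v)) * exp (- exp v * x ^ 4)" for v x
    by (simp flip: exp_add)
  have "(LINT x|lborel. exp ((a - 1 / 2) * v - A * exp (- v) - exp v * x ^ 4)) = quartic_mass * exp (- (3 / 4 - a) * v - A * exp (- v))" for v
    unfolding eq integral_mult_right_zero quartic_scaled(2) quartic_mass_def[symmetric]
    by (simp add: algebra_simps flip: exp_add)
  then show "integrable lborel (\<lambda>v. LINT x|lborel. norm (case (v, x) of (v, x) \<Rightarrow> exp ((a - 1 / 2) * v - A * exp (- v) - exp v * x ^ 4)))"
    using assms exp_exp_integral_neg(1)[of "3 / 4 - a" A] by simp
  show "AE v in lborel. integrable lborel (\<lambda>x. case (v, x) of (v, x) \<Rightarrow> exp ((a - 1 / 2) * v - A * exp (- v) - exp v * x ^ 4))"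
    unfolding prod.case eq by (intro AE_I2 integrable_mult_right quartic_scaled)
qed

lemma bessel_kernel_integrable:
  assumes "0 < a" "a < 3 / 4" "0 < A"
  shows "integrable lborel (bessel_kernel a A)"
  unfolding bessel_kernel_def[abs_def] using lborel_pair.integrable_snd[OF bessel_kernel_product_integrable[OF assms]] .

lemma fs_transform_eq_kernel:
  assumes "0 < a" "a < 3 / 4" "\<eta> \<noteq> 0"
  shows "integrable lborel (\<lambda>x. exp (- 2 * pi * \<i> * complex_of_real (x * \<xi>)) * complex_of_real (bessel_kernel a ((pi * \<eta>)\<^sup>2) x))"
    and "fs_transform a (\<xi>, \<eta>) = complex_of_real (sqrt pi / Gamma a) *
      (LINT x|lborel. exp (- 2 * pi * \<i> * complex_of_real (x * \<xi>)) * complex_of_real (bessel_kernel a ((pi * \<eta>)\<^sup>2) x))"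
proof -
  define A where "A = (pi * \<eta>)\<^sup>2"
  have A: "0 < A" using assms by (simp add: A_def)
  let ?e = "\<lambda>x. exp (- 2 * pi * \<i> * complex_of_real (x * \<xi>))"
  let ?k = "\<lambda>v x. exp ((a - 1 / 2) * v - A * exp (- v) - exp v * x ^ 4) :: real"
  have [measurable]: "bessel_kernel a A \<in> borel_measurable borel" using bessel_kernel_integrable[OF assms(1,2) A] by simp
  show "integrable lborel (\<lambda>x. ?e x * complex_of_real (bessel_kernel a ((pi * \<eta>)\<^sup>2) x))"
    unfolding A_def[symmetric]
    by (rule Bochner_Integration.integrable_bound[OF bessel_kernel_integrable[OF assms(1,2) A]])
       (auto simp: norm_mult norm_exp_imaginary simp del: of_real_mult mult_minus_left)
  have "integrable (lborel \<Otimes>\<^sub>M lborel) (\<lambda>(v, x). ?e x * complex_of_real (?k v x))"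
    by (rule Bochner_Integration.integrable_bound[OF bessel_kernel_product_integrable[OF assms(1,2) A]])
       (auto simp: norm_mult norm_exp_imaginary simp del: of_real_mult mult_minus_left)
  then have "(LINT x|lborel. LINT v|lborel. ?e x * complex_of_real (?k v x)) = (LINT v|lborel. LINT x|lborel. ?e x * complex_of_real (?k v x))"
    by (rule lborel_pair.Fubini_integral)
  moreover have "(LINT v|lborel. ?e x * complex_of_real (?k v x)) = ?e x * complex_of_real (bessel_kernel a A x)" for x
    unfolding bessel_kernel_def integral_mult_right_zero integral_complex_of_real ..
  ultimately have 1: "(LINT x|lborel. ?e x * complex_of_real (bessel_kernel a A x)) = (LINT v|lborel. LINT x|lborel. ?e x * complex_of_real (?k v x))" by (simp only:)
  have 2: "(LINT x|lborel. ?e x * complex_of_real (?k v x)) = complex_of_real (exp ((a - 1 / 2) * v - A * exp (- v))) * quartic_fourier v \<xi>" for v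
  proof -
    have "?e x * complex_of_real (?k v x) = complex_of_real (exp ((a - 1 / 2) * v - A * exp (- v))) * (?e x * complex_of_real (exp (- exp v * x ^ 4)))" for x
    proof -
      have "?k v x = exp ((a - 1 / 2) * v - A * exp (- v)) * exp (- exp v * x ^ 4)" by (simp flip: exp_add)
      then show ?thesis by (simp only: of_real_mult mult_ac)
    qed
    then show ?thesis unfolding quartic_fourier_def by (simp only: integral_mult_right_zero)
  qed
  show "fs_transform a (\<xi>, \<eta>) = complex_of_real (sqrt pi / Gamma a) * (LINT x|lborel. ?e x * complex_of_real (bessel_kernel a ((pi * \<eta>)\<^sup>2) x))"
    unfolding fs_transform_def fst_conv snd_conv A_def[symmetric] 1 2 ..
qed

text \<open>The indicator is needed because the integrand vanishes at \<open>x = 0\<close>, where \<open>0 powr (1 - s / 2) = 0\<close>,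
whereas the kernel need not vanish there.\<close>

lemma fs_hat_integrand_eq:
  assumes "0 < s" "s < 3" "\<eta> \<noteq> 0"
  shows "fs_hat_integrand s \<xi> \<eta> x = indicator (- {0}) x *\<^sub>R (complex_of_real ((pi * \<bar>\<eta>\<bar>) powr (- (s - 2) / 4) / 2) *
    (exp (- 2 * pi * \<i> * complex_of_real (x * \<xi>)) * complex_of_real (bessel_kernel (s / 4) ((pi * \<eta>)\<^sup>2) x)))"
proof (cases "x = 0")
  case True then show ?thesis by (simp add: fs_hat_integrand_def)
next
  case False
  define \<nu> where "\<nu> = (s - 2) / 4"
  have \<nu>: "s / 4 - 1 / 2 = \<nu>" "\<bar>\<nu>\<bar> < 1" "1 - s / 2 = - 2 * \<nu>" "- (s - 2) / 4 = - \<nu>" using assms by (auto simp: \<nu>_def field_simps)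
  define z where "z = 2 * pi * \<bar>\<eta>\<bar> * x\<^sup>2"
  have z: "0 < z" using assms False by (simp add: z_def)
  have zq: "z\<^sup>2 / 4 = (pi * \<eta>)\<^sup>2 * x ^ 4" by (simp add: z_def power_mult_distrib flip: power_mult)
  have zh: "(z / 2) powr (- \<nu>) = (pi * \<bar>\<eta>\<bar>) powr (- \<nu>) * \<bar>x\<bar> powr (- 2 * \<nu>)"
  proof -
    have "z / 2 = (pi * \<bar>\<eta>\<bar>) * \<bar>x\<bar> powr 2" using False by (simp add: z_def)
    then have "(z / 2) powr (- \<nu>) = ((pi * \<bar>\<eta>\<bar>) * \<bar>x\<bar> powr 2) powr (- \<nu>)" by (simp only:)
    also have "\<dots> = (pi * \<bar>\<eta>\<bar>) powr (- \<nu>) * \<bar>x\<bar> powr (2 * (- \<nu>))"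
      by (simp only: powr_mult powr_powr)
    finally show ?thesis by simp
  qed
  have x4: "x ^ 4 = \<bar>x\<bar> powr 4" using False powr_realpow[of "\<bar>x\<bar>" 4] by auto
  have kernel: "bessel_kernel (s / 4) ((pi * \<eta>)\<^sup>2) x = \<bar>x\<bar> powr (- 4 * \<nu>) * macdonald \<nu> (z\<^sup>2 / 4)"
  proof -
    have "bessel_kernel (s / 4) ((pi * \<eta>)\<^sup>2) x = (x ^ 4) powr (- \<nu>) * macdonald \<nu> ((pi * \<eta>)\<^sup>2 * x ^ 4)"
      unfolding bessel_kernel_def \<nu> using macdonald_two_parameters(2)[of "(pi * \<eta>)\<^sup>2" "x ^ 4" \<nu>] assms False by (simp add: mult.commute zero_less_power_eq)
    moreover have "(x ^ 4) powr (- \<nu>) = \<bar>x\<bar> powr (- 4 * \<nu>)" unfolding x4 powr_powr by simp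
    ultimately show ?thesis by (simp only: zq)
  qed
  have "\<bar>x\<bar> powr (1 - s / 2) * bessel_K \<nu> z = (pi * \<bar>\<eta>\<bar>) powr (- \<nu>) / 2 * bessel_kernel (s / 4) ((pi * \<eta>)\<^sup>2) x"
  proof -
    have p: "\<bar>x\<bar> powr (- 2 * \<nu>) * \<bar>x\<bar> powr (- 2 * \<nu>) = \<bar>x\<bar> powr (- 4 * \<nu>)" by (simp flip: powr_add)
    show ?thesis unfolding bessel_K_eq_macdonald[OF \<nu>(2) z] zh kernel \<nu>(3) p[symmetric] by simp
  qed
  from arg_cong[OF this, of complex_of_real]
  have "complex_of_real (\<bar>x\<bar> powr (1 - s / 2) * bessel_K \<nu> z) =
      complex_of_real ((pi * \<bar>\<eta>\<bar>) powr (- \<nu>) / 2) * complex_of_real (bessel_kernel (s / 4) ((pi * \<eta>)\<^sup>2) x)"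
    by (simp only: of_real_mult)
  moreover have "exp (- 2 * pi * \<i> * x * \<xi>) = exp (- 2 * pi * \<i> * complex_of_real (x * \<xi>))" by (simp add: mult_ac)
  ultimately show ?thesis using False unfolding fs_hat_integrand_def \<nu>(4) \<nu>_def[symmetric] z_def[symmetric]
    by (simp only: mult_ac) simp
qed

lemma fs_transform_eq_fs_hat_integrand:
  assumes "0 < s" "s < 3" "\<eta> \<noteq> 0"
  shows "integrable lborel (fs_hat_integrand s \<xi> \<eta>)"
    and "fs_transform (s / 4) (\<xi>, \<eta>) = complex_of_real (2 * pi powr (s / 4) * \<bar>\<eta>\<bar> powr ((s - 2) / 4) / Gamma (s / 4)) *
            (LINT x|lborel. fs_hat_integrand s \<xi> \<eta> x)"
proof -
  have a: "0 < s / 4" "s / 4 < 3 / 4" using assms by auto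
  let ?f = "\<lambda>x. exp (- 2 * pi * \<i> * complex_of_real (x * \<xi>)) * complex_of_real (bessel_kernel (s / 4) ((pi * \<eta>)\<^sup>2) x)"
  let ?c = "complex_of_real ((pi * \<bar>\<eta>\<bar>) powr (- (s - 2) / 4) / 2)"
  note i = fs_transform_eq_kernel(1)[OF a assms(3), of \<xi>]
  have e: "fs_hat_integrand s \<xi> \<eta> = (\<lambda>x. indicator (- {0}) x *\<^sub>R (?c * ?f x))"
    using fs_hat_integrand_eq[OF assms] by blast
  have "integrable lborel (\<lambda>x. ?c * ?f x)" by (intro integrable_mult_right i)
  then have "integrable lborel (\<lambda>x. indicator (- {0}) x *\<^sub>R (?c * ?f x))"
    by (intro integrable_mult_indicator) auto
  then show "integrable lborel (fs_hat_integrand s \<xi> \<eta>)" unfolding e .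
  have "(LINT x|lborel. fs_hat_integrand s \<xi> \<eta> x) = (LINT x|lborel. ?c * ?f x)"
    unfolding e
  proof (rule integral_cong_AE)
    show "AE x in lborel. indicator (- {0}) x *\<^sub>R (?c * ?f x) = ?c * ?f x"
      using AE_lborel_singleton[of 0] by eventually_elim simp
  qed (use i in auto)
  also have "\<dots> = ?c * (LINT x|lborel. ?f x)" by (rule integral_mult_right_zero)
  finally have I: "(LINT x|lborel. fs_hat_integrand s \<xi> \<eta> x) = ?c * (LINT x|lborel. ?f x)" .
  have "2 * pi powr (s / 4) * \<bar>\<eta>\<bar> powr ((s - 2) / 4) / Gamma (s / 4) * ((pi * \<bar>\<eta>\<bar>) powr (- (s - 2) / 4) / 2) = sqrt pi / Gamma (s / 4)"
  proof -
    have 1: "(pi * \<bar>\<eta>\<bar>) powr (- (s - 2) / 4) = pi powr (- (s - 2) / 4) * \<bar>\<eta>\<bar> powr (- (s - 2) / 4)"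
      by (rule powr_mult)
    have 2: "\<bar>\<eta>\<bar> powr ((s - 2) / 4) * \<bar>\<eta>\<bar> powr (- (s - 2) / 4) = 1"
    proof -
      have "(s - 2) / 4 + - (s - 2) / 4 = 0" by (simp add: field_simps)
      then show ?thesis unfolding powr_add[symmetric] using assms by simp
    qed
    have 3: "pi powr (s / 4) * pi powr (- (s - 2) / 4) = sqrt pi"
    proof -
      have e: "s / 4 + - (s - 2) / 4 = 1 / 2" by (simp add: field_simps)
      show ?thesis unfolding powr_add[symmetric] e by (simp add: powr_half_sqrt)
    qed
    have "2 * pi powr (s / 4) * \<bar>\<eta>\<bar> powr ((s - 2) / 4) / Gamma (s / 4) * ((pi * \<bar>\<eta>\<bar>) powr (- (s - 2) / 4) / 2)
       = (pi powr (s / 4) * pi powr (- (s - 2) / 4)) * (\<bar>\<eta>\<bar> powr ((s - 2) / 4) * \<bar>\<eta>\<bar> powr (- (s - 2) / 4)) / Gamma (s / 4)"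
      unfolding 1 by (simp add: mult_ac)
    then show ?thesis unfolding 2 3 by simp
  qed
  from arg_cong[OF this, of complex_of_real]
  show "fs_transform (s / 4) (\<xi>, \<eta>) = complex_of_real (2 * pi powr (s / 4) * \<bar>\<eta>\<bar> powr ((s - 2) / 4) / Gamma (s / 4)) *
            (LINT x|lborel. fs_hat_integrand s \<xi> \<eta> x)"
    unfolding fs_transform_eq_kernel(2)[OF a assms(3)] I by (simp only: of_real_mult mult.assoc[symmetric])
qed

section \<open>Positivity and the upper bound\<close>

text \<open>The density of the Laplace representation, with the factor \<open>1 / sqrt u\<close> that the Fourier transform of
a Gaussian of variance proportional to \<open>1 / u\<close> contributes.\<close>

definition mixing_density :: "real \<Rightarrow> real \<Rightarrow> real" where
  "mixing_density a u = indicator {1<..} u * (u\<^sup>2 - 1) powr (a - 1) / sqrt u"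

lemma mixing_density_measurable [measurable]: "mixing_density a \<in> borel_measurable borel"
  unfolding mixing_density_def[abs_def] by measurable

lemma mixing_density_nonneg: "0 \<le> mixing_density a u" by (auto simp: mixing_density_def indicator_def)

definition profile :: "real \<Rightarrow> real \<Rightarrow> real" where
  "profile a w = (LINT u|lborel. mixing_density a u * exp (- (pi * w / (2 * u))))"

text \<open>For fixed \<open>\<eta>\<close> the Bessel kernel is a positive superposition of the Gaussians
\<open>exp (- 2 pi \<bar>\<eta>\<bar> u x^2)\<close> over \<open>u > 1\<close>, and each of them has a positive Gaussian as its Fourier
transform. The integrability that Fubini needs comes for free: by Tonelli the double integral is the
integral of the kernel over \<open>x\<close>, which is known to be finite. The same argument shows that the mixing
density is integrable.\<close>

lemma fs_transform_eq_profile: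
  assumes a: "0 < a" "a < 3 / 4"
  obtains K where "0 < K"
    "\<And>\<xi> \<eta>. \<eta> \<noteq> 0 \<Longrightarrow> fs_transform a (\<xi>, \<eta>) = complex_of_real (K * \<bar>\<eta>\<bar> powr (2 * a - 3 / 2) * profile a (\<xi>\<^sup>2 / \<bar>\<eta>\<bar>))"
    "integrable lborel (mixing_density a)"
proof -
  obtain c where c: "0 < c" "\<And>z. 0 < z \<Longrightarrow> macdonald (1 / 2 - a) (z\<^sup>2 / 4) = c * bessel_laplace 0 a z"
    using macdonald_eq_const_bessel_laplace[of a] a by auto
  define w where "w u = indicator {1<..} u * (u\<^sup>2 - 1) powr (a - 1)" for u :: real
  have [measurable]: "w \<in> borel_measurable borel" unfolding w_def[abs_def] by measurable
  have w0: "0 \<le> w u" "u \<le> 1 \<Longrightarrow> w u = 0" for u by (auto simp: w_def)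
  have nu: "mixing_density a u = w u / sqrt u" for u by (simp add: mixing_density_def w_def)
  have kernel: "bessel_kernel a ((pi * \<eta>)\<^sup>2) x = (pi * \<bar>\<eta>\<bar>) powr (2 * a - 1) * c * (LINT u|lborel. w u * exp (- (2 * pi * \<bar>\<eta>\<bar> * u) * x\<^sup>2))"
    "integrable lborel (\<lambda>u. w u * exp (- (2 * pi * \<bar>\<eta>\<bar> * u) * x\<^sup>2))"
    if "\<eta> \<noteq> 0" "x \<noteq> 0" for \<eta> x
  proof -
    define z where "z = 2 * pi * \<bar>\<eta>\<bar> * x\<^sup>2"
    have z: "0 < z" using that by (simp add: z_def)
    have zq: "z\<^sup>2 / 4 = (pi * \<eta>)\<^sup>2 * x ^ 4" by (simp add: z_def power_mult_distrib flip: power_mult)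
    have x4: "0 < x ^ 4" "0 < (pi * \<eta>)\<^sup>2" using that by (auto simp: zero_less_power_eq)
    have "bessel_kernel a ((pi * \<eta>)\<^sup>2) x = (x ^ 4) powr (- (a - 1 / 2)) * macdonald (a - 1 / 2) ((pi * \<eta>)\<^sup>2 * x ^ 4)"
      unfolding bessel_kernel_def using macdonald_two_parameters(2)[OF x4(2,1), of "a - 1 / 2"] by (simp only: mult.commute)
    also have "macdonald (a - 1 / 2) ((pi * \<eta>)\<^sup>2 * x ^ 4) = ((pi * \<eta>)\<^sup>2 * x ^ 4) powr (a - 1 / 2) * macdonald (1 / 2 - a) ((pi * \<eta>)\<^sup>2 * x ^ 4)"
      using macdonald_reflect[of "(pi * \<eta>)\<^sup>2 * x ^ 4" "a - 1 / 2"] x4 by simp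
    also have "((pi * \<eta>)\<^sup>2 * x ^ 4) powr (a - 1 / 2) = ((pi * \<eta>)\<^sup>2) powr (a - 1 / 2) * (x ^ 4) powr (a - 1 / 2)"
      by (rule powr_mult)
    also have "(x ^ 4) powr (- (a - 1 / 2)) * (((pi * \<eta>)\<^sup>2) powr (a - 1 / 2) * (x ^ 4) powr (a - 1 / 2) * macdonald (1 / 2 - a) ((pi * \<eta>)\<^sup>2 * x ^ 4))
      = ((x ^ 4) powr (- (a - 1 / 2)) * (x ^ 4) powr (a - 1 / 2)) * ((pi * \<eta>)\<^sup>2) powr (a - 1 / 2) * macdonald (1 / 2 - a) ((pi * \<eta>)\<^sup>2 * x ^ 4)"
      by (simp only: mult_ac)
    also have "(x ^ 4) powr (- (a - 1 / 2)) * (x ^ 4) powr (a - 1 / 2) = 1" using that by (simp flip: powr_add)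
    also have "((pi * \<eta>)\<^sup>2) powr (a - 1 / 2) = (pi * \<bar>\<eta>\<bar>) powr (2 * a - 1)"
    proof -
      have "(pi * \<eta>)\<^sup>2 = (pi * \<bar>\<eta>\<bar>) powr 2" using that by (simp add: power_mult_distrib)
      moreover have "2 * (a - 1 / 2) = 2 * a - 1" by simp
      ultimately show ?thesis by (simp only: powr_powr)
    qed
    also have "macdonald (1 / 2 - a) ((pi * \<eta>)\<^sup>2 * x ^ 4) = c * bessel_laplace 0 a z" using c(2)[OF z] by (simp only: zq)
    also have "bessel_laplace 0 a z = (LINT u|lborel. w u * exp (- (2 * pi * \<bar>\<eta>\<bar> * u) * x\<^sup>2))"
      unfolding bessel_laplace_def by (rule Bochner_Integration.integral_cong) (simp_all add: z_def w_def mult_ac)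
    finally show "bessel_kernel a ((pi * \<eta>)\<^sup>2) x = (pi * \<bar>\<eta>\<bar>) powr (2 * a - 1) * c * (LINT u|lborel. w u * exp (- (2 * pi * \<bar>\<eta>\<bar> * u) * x\<^sup>2))"
      by simp
    have "integrable lborel (\<lambda>u. w u * exp (- z * u))"
      using bessel_laplace_integrable_0[of a z] a z by (simp add: w_def)
    then show "integrable lborel (\<lambda>u. w u * exp (- (2 * pi * \<bar>\<eta>\<bar> * u) * x\<^sup>2))"
      by (simp add: z_def mult_ac)
  qed
  have prod: "integrable (lborel \<Otimes>\<^sub>M lborel) (\<lambda>(x, u). w u * exp (- (2 * pi * \<bar>\<eta>\<bar> * u) * x\<^sup>2))" if "\<eta> \<noteq> 0" for \<eta>
  proof (rule lborel_pair.Fubini_integrable)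
    show "(\<lambda>(x, u). w u * exp (- (2 * pi * \<bar>\<eta>\<bar> * u) * x\<^sup>2)) \<in> borel_measurable (lborel \<Otimes>\<^sub>M lborel)"
      by measurable
    have ae: "AE x in lborel. x \<noteq> (0::real)" by (rule AE_lborel_singleton)
    show "AE x in lborel. integrable lborel (\<lambda>u. case (x, u) of (x, u) \<Rightarrow> w u * exp (- (2 * pi * \<bar>\<eta>\<bar> * u) * x\<^sup>2))"
      using ae by eventually_elim (use kernel(2) that in auto)
    have J0: "integrable lborel (bessel_kernel a ((pi * \<eta>)\<^sup>2))" using a that by (intro bessel_kernel_integrable) auto
    define k where "k = (pi * \<bar>\<eta>\<bar>) powr (2 * a - 1) * c"
    have k: "0 < k" using c that by (simp add: k_def)
    have "integrable lborel (\<lambda>x. bessel_kernel a ((pi * \<eta>)\<^sup>2) x / k)" by (intro integrable_divide J0)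
    then show "integrable lborel (\<lambda>x. LINT u|lborel. norm (case (x, u) of (x, u) \<Rightarrow> w u * exp (- (2 * pi * \<bar>\<eta>\<bar> * u) * x\<^sup>2)))"
    proof (rule integrable_cong_AE_imp)
      show "AE x in lborel. bessel_kernel a ((pi * \<eta>)\<^sup>2) x / k = (LINT u|lborel. norm (case (x, u) of (x, u) \<Rightarrow> w u * exp (- (2 * pi * \<bar>\<eta>\<bar> * u) * x\<^sup>2)))"
        using ae
      proof eventually_elim
        case (elim x)
        have "(\<lambda>u. norm (case (x, u) of (x, u) \<Rightarrow> w u * exp (- (2 * pi * \<bar>\<eta>\<bar> * u) * x\<^sup>2))) = (\<lambda>u. w u * exp (- (2 * pi * \<bar>\<eta>\<bar> * u) * x\<^sup>2))"
          using w0 by (auto simp: abs_mult)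
        then show ?case using kernel(1)[OF that elim] k unfolding k_def[symmetric] by simp
      qed
    qed measurable
  qed
  have gx: "(LINT x|lborel. w u * exp (- (2 * pi * \<bar>\<eta>\<bar> * u) * x\<^sup>2)) = mixing_density a u / sqrt (2 * \<bar>\<eta>\<bar>)" if "\<eta> \<noteq> 0" for \<eta> u
  proof (cases "u > 1")
    case True
    have "complex_of_real (LINT x|lborel. exp (- (2 * pi * \<bar>\<eta>\<bar> * u) * x\<^sup>2)) = complex_of_real (sqrt (pi / (2 * pi * \<bar>\<eta>\<bar> * u)))"
      using gaussian_fourier[of "2 * pi * \<bar>\<eta>\<bar> * u" 0] True that by simp
    then have "(LINT x|lborel. exp (- (2 * pi * \<bar>\<eta>\<bar> * u) * x\<^sup>2)) = sqrt (pi / (2 * pi * \<bar>\<eta>\<bar> * u))"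
      by (simp only: of_real_eq_iff)
    then show ?thesis by (simp add: nu real_sqrt_divide real_sqrt_mult)
  qed (simp add: nu w0)
  show thesis
  proof
    define K where "K = sqrt pi / Gamma a * (pi powr (2 * a - 1) * c) / sqrt 2"
    show "0 < K" using c Gamma_real_pos[of a] a by (simp add: K_def)
    have "integrable lborel (\<lambda>u. mixing_density a u / sqrt (2 * \<bar>1\<bar>))"
      using lborel_pair.integrable_snd[OF prod[of 1]] unfolding gx[of 1, simplified] by (simp add: gx[of 1, simplified])
    from integrable_mult_right[OF this, of "sqrt 2"] show "integrable lborel (mixing_density a)" by simp
    fix \<xi> \<eta> :: real assume \<eta>: "\<eta> \<noteq> 0"
    define k where "k = (pi * \<bar>\<eta>\<bar>) powr (2 * a - 1) * c"
    let ?e = "\<lambda>x. exp (- 2 * pi * \<i> * complex_of_real (x * \<xi>))"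
    let ?g = "\<lambda>u x. exp (- (2 * pi * \<bar>\<eta>\<bar> * u) * x\<^sup>2) :: real"
    have int: "integrable (lborel \<Otimes>\<^sub>M lborel) (\<lambda>(x, u). ?e x * complex_of_real (w u * ?g u x))"
      by (rule Bochner_Integration.integrable_bound[OF prod[OF \<eta>]])
         (auto simp: norm_mult norm_exp_imaginary simp del: of_real_mult mult_minus_left)
    have inner: "(LINT x|lborel. ?e x * complex_of_real (w u * ?g u x)) =
        complex_of_real (mixing_density a u * exp (- (pi * (\<xi>\<^sup>2 / \<bar>\<eta>\<bar>) / (2 * u))) / sqrt (2 * \<bar>\<eta>\<bar>))" for u
    proof (cases "u > 1")
      case True
      have "?e x * complex_of_real (w u * ?g u x) = complex_of_real (w u) * (?e x * complex_of_real (?g u x))" for x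
        by (simp only: of_real_mult mult_ac)
      then have "(LINT x|lborel. ?e x * complex_of_real (w u * ?g u x)) = complex_of_real (w u) * (LINT x|lborel. ?e x * complex_of_real (?g u x))"
        by (simp only: integral_mult_right_zero)
      also have "(LINT x|lborel. ?e x * complex_of_real (?g u x)) =
          complex_of_real (sqrt (pi / (2 * pi * \<bar>\<eta>\<bar> * u)) * exp (- pi\<^sup>2 * \<xi>\<^sup>2 / (2 * pi * \<bar>\<eta>\<bar> * u)))"
        using True \<eta> by (intro gaussian_fourier) simp
      also have "- pi\<^sup>2 * \<xi>\<^sup>2 / (2 * pi * \<bar>\<eta>\<bar> * u) = - (pi * (\<xi>\<^sup>2 / \<bar>\<eta>\<bar>) / (2 * u))"
        using True \<eta> by (simp add: power2_eq_square field_simps)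
      also have "sqrt (pi / (2 * pi * \<bar>\<eta>\<bar> * u)) = 1 / (sqrt (2 * \<bar>\<eta>\<bar>) * sqrt u)"
        by (simp add: real_sqrt_divide real_sqrt_mult)
      finally show ?thesis by (simp add: nu)
    qed (simp add: w0 nu)
    have "(LINT x|lborel. ?e x * complex_of_real (bessel_kernel a ((pi * \<eta>)\<^sup>2) x)) = (LINT x|lborel. complex_of_real k * (LINT u|lborel. ?e x * complex_of_real (w u * ?g u x)))"
    proof (rule integral_cong_AE)
      show "AE x in lborel. ?e x * complex_of_real (bessel_kernel a ((pi * \<eta>)\<^sup>2) x) = complex_of_real k * (LINT u|lborel. ?e x * complex_of_real (w u * ?g u x))"
        using AE_lborel_singleton[of 0]
      proof eventually_elim
        case (elim x)
        have "(LINT u|lborel. ?e x * complex_of_real (w u * ?g u x)) = ?e x * complex_of_real (LINT u|lborel. w u * ?g u x)"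
          unfolding integral_mult_right_zero integral_complex_of_real ..
        then show ?case unfolding kernel(1)[OF \<eta> elim] k_def by (simp only: of_real_mult mult_ac)
      qed
      show "(\<lambda>x. ?e x * complex_of_real (bessel_kernel a ((pi * \<eta>)\<^sup>2) x)) \<in> borel_measurable lborel"
        using fs_transform_eq_kernel(1)[OF a \<eta>] by (rule borel_measurable_integrable)
    qed measurable
    also have "\<dots> = complex_of_real k * (LINT u|lborel. LINT x|lborel. ?e x * complex_of_real (w u * ?g u x))"
      unfolding integral_mult_right_zero lborel_pair.Fubini_integral[OF int] ..
    also have "\<dots> = complex_of_real (k * profile a (\<xi>\<^sup>2 / \<bar>\<eta>\<bar>) / sqrt (2 * \<bar>\<eta>\<bar>))"
      unfolding inner profile_def integral_complex_of_real by simp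
    finally have L: "(LINT x|lborel. ?e x * complex_of_real (bessel_kernel a ((pi * \<eta>)\<^sup>2) x)) = complex_of_real (k * profile a (\<xi>\<^sup>2 / \<bar>\<eta>\<bar>) / sqrt (2 * \<bar>\<eta>\<bar>))" .
    have "sqrt pi / Gamma a * (k * profile a (\<xi>\<^sup>2 / \<bar>\<eta>\<bar>) / sqrt (2 * \<bar>\<eta>\<bar>)) = K * \<bar>\<eta>\<bar> powr (2 * a - 3 / 2) * profile a (\<xi>\<^sup>2 / \<bar>\<eta>\<bar>)"
    proof -
      have "\<bar>\<eta>\<bar> powr (2 * a - 3 / 2) = \<bar>\<eta>\<bar> powr (2 * a - 1) / \<bar>\<eta>\<bar> powr (1 / 2)" by (simp flip: powr_diff)
      also have "\<bar>\<eta>\<bar> powr (1 / 2) = sqrt \<bar>\<eta>\<bar>" by (simp add: powr_half_sqrt)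
      finally show ?thesis by (simp add: K_def k_def powr_mult real_sqrt_mult mult_ac)
    qed
    then show "fs_transform a (\<xi>, \<eta>) = complex_of_real (K * \<bar>\<eta>\<bar> powr (2 * a - 3 / 2) * profile a (\<xi>\<^sup>2 / \<bar>\<eta>\<bar>))"
      unfolding fs_transform_eq_kernel(2)[OF a \<eta>] L by (simp only: of_real_mult[symmetric])
  qed
qed

text \<open>For the decay, split the integral at \<open>u = 2\<close>. Near the singularity \<open>u = 1\<close> of the density use
\<open>exp (- y) \<le> y powr (- p)\<close> with \<open>p = 3 / 2 - 2 * a\<close>; for large \<open>u\<close> the density is comparable with
\<open>u powr (- p - 1)\<close>, whose integral against \<open>exp (- B / u)\<close> is \<open>B powr (- p) * Gamma p\<close>. Using the
first bound throughout would make the integral diverge logarithmically.\<close>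

lemma profile_properties:
  assumes a: "0 < a" "a < 3 / 4" "1 / 4 < a" and nu: "integrable lborel (mixing_density a)"
  shows profile_pos: "0 \<le> w \<Longrightarrow> 0 < profile a w"
    and profile_le: "0 \<le> w \<Longrightarrow> profile a w \<le> profile a 0"
    and profile_decay: "\<exists>C>0. \<forall>w>0. profile a w \<le> C * w powr (2 * a - 3 / 2)"
proof -
  have damped: "mixing_density a u * exp (- (pi * w / (2 * u))) \<le> mixing_density a u" if "0 \<le> w" for w u
  proof (cases "u > 1")
    case True
    then have "exp (- (pi * w / (2 * u))) \<le> 1" using that by simp
    then show ?thesis using mixing_density_nonneg by (intro mult_left_le) auto
  qed (simp add: mixing_density_def)
  have i: "integrable lborel (\<lambda>u. mixing_density a u * exp (- (pi * w / (2 * u))))" if "0 \<le> w" for w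
  proof (rule Bochner_Integration.integrable_bound[OF nu])
    have "mixing_density a u * exp (- (pi * w / (2 * u))) \<le> mixing_density a u" for u
      by (rule damped[OF that])
    then show "AE u in lborel. norm (mixing_density a u * exp (- (pi * w / (2 * u)))) \<le> norm (mixing_density a u)"
      using mixing_density_nonneg[of a] by (intro AE_I2) (auto simp: abs_mult)
  qed measurable
  show "0 < profile a w" if "0 \<le> w"
  proof -
    let ?f = "\<lambda>u. mixing_density a u * exp (- (pi * w / (2 * u)))"
    have "profile a w \<noteq> 0"
    proof
      assume "profile a w = 0"
      then have "AE u in lborel. ?f u = 0"
        using integral_nonneg_eq_0_iff_AE[OF i[OF that]] mixing_density_nonneg[of a] by (auto simp: profile_def)
      then have "AE u in lborel. u \<notin> {1<..<2::real}"
      proof (eventually_elim, intro notI)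
        fix u :: real assume u: "?f u = 0" "u \<in> {1<..<2}"
        then show False by (auto simp: mixing_density_def power2_eq_1_iff)
      qed
      then have "emeasure lborel {1<..<2::real} = 0"
        by (subst (asm) AE_iff_measurable[of "{1<..<2}"]) auto
      then show False by simp
    qed
    moreover have "0 \<le> profile a w" unfolding profile_def using mixing_density_nonneg[of a] by (intro integral_nonneg_AE) auto
    ultimately show ?thesis by simp
  qed
  show "profile a w \<le> profile a 0" if "0 \<le> w"
    unfolding profile_def
  proof (rule integral_mono[OF i[OF that] i])
    show "mixing_density a u * exp (- (pi * w / (2 * u))) \<le> mixing_density a u * exp (- (pi * 0 / (2 * u)))" for u
      using damped[OF that] by simp
  qed simp
  define p where "p = 3 / 2 - 2 * a"
  have p: "0 < p" "p < 1" using a by (auto simp: p_def)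
  define N where "N = (LINT u|lborel. mixing_density a u)"
  have "0 \<le> N" unfolding N_def using mixing_density_nonneg[of a] by (intro integral_nonneg_AE) auto
  (* The first summand bounds the part u <= 2, the second one the part u > 2; the common factor
     w powr (- p) has been taken out. *)
  define C where "C = (4 / pi) powr p * N + (3 / 4) powr (a - 1) * ((pi / 2) powr (- p) * Gamma p)"
  have "0 < C" unfolding C_def using \<open>0 \<le> N\<close> Gamma_real_pos[OF p(1)] by (intro add_nonneg_pos mult_pos_pos mult_nonneg_nonneg) auto
  moreover have "profile a w \<le> C * w powr (2 * a - 3 / 2)" if w: "0 < w" for w
  proof -
    define B where "B = pi * w / 2"
    have B: "0 < B" using w by (simp add: B_def)
    let ?h = "\<lambda>u. u powr (- p - 1) * exp (- (B / u))"
    have hsub: "(\<lambda>v. exp v * ?h (exp v)) = (\<lambda>v. exp (- p * v - B * exp (- v)))"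
    proof
      fix v
      have "exp v powr (- p - 1) = exp ((- p - 1) * v)" by (simp add: powr_def)
      moreover have "B / exp v = B * exp (- v)" by (simp add: exp_minus divide_inverse)
      ultimately show "exp v * ?h (exp v) = exp (- p * v - B * exp (- v))"
        by (simp add: algebra_simps flip: exp_add)
    qed
    have hi: "integrable lborel (\<lambda>u. indicator {0<..} u * ?h u)"
      "(LINT u|lborel. indicator {0<..} u * ?h u) = B powr (- p) * Gamma p"
      using exp_substitution[of ?h] exp_exp_integral_neg[OF p(1) B] unfolding hsub by auto
    have pw: "mixing_density a u * exp (- (pi * w / (2 * u))) \<le> ((4 / pi) powr p * w powr (- p)) * mixing_density a u + (3 / 4) powr (a - 1) * (indicator {0<..} u * ?h u)" for u
    proof -
      consider "u \<le> 1" | "1 < u" "u \<le> 2" | "2 < u" by linarith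
      then show ?thesis
      proof cases
        case 1 then show ?thesis by (simp add: mixing_density_def)
      next
        case 2
        define y where "y = pi * w / (2 * u)"
        have y: "0 < y" using 2 w by (simp add: y_def)
        have yp: "y powr p * exp (- y) \<le> 1"
        proof (cases "y \<le> 1")
          case True
          have "y powr p \<le> 1 powr p" using True y p by (intro powr_mono2) auto
          then show ?thesis using y by (intro mult_le_one) auto
        next
          case False
          have "y powr p \<le> y powr 1" using False p by (intro powr_mono) auto
          also have "y powr 1 = y" using y by simp
          also have "\<dots> \<le> exp y" using exp_ge_add_one_self[of y] by linarith
          finally show ?thesis by (simp add: exp_minus field_simps)
        qed
        then have "exp (- y) \<le> y powr (- p)" using y by (simp add: powr_minus field_simps)
        also have "\<dots> \<le> (pi * w / 4) powr (- p)"
          using 2 w p y by (intro powr_mono2') (auto simp: y_def field_simps)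
        also have "\<dots> = (4 / pi) powr p * w powr (- p)"
          using w by (simp add: powr_mult powr_divide powr_minus field_simps)
        finally have "mixing_density a u * exp (- y) \<le> mixing_density a u * ((4 / pi) powr p * w powr (- p))"
          by (rule mult_left_mono) (rule mixing_density_nonneg)
        then show ?thesis unfolding y_def[symmetric] by (simp add: mult_ac add_increasing2)
      next
        case 3
        have "2 * 2 \<le> u * u" using 3 by (intro mult_mono) auto
        then have "3 / 4 * u\<^sup>2 \<le> u\<^sup>2 - 1" by (simp add: power2_eq_square)
        then have "(u\<^sup>2 - 1) powr (a - 1) \<le> (3 / 4 * u\<^sup>2) powr (a - 1)"
          using 3 a by (intro powr_mono2') auto
        also have "\<dots> = (3 / 4) powr (a - 1) * u powr (2 * (a - 1))"
        proof -
          have "u\<^sup>2 = u powr 2" using 3 by simp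
          then show ?thesis by (simp only: powr_mult[of "3 / 4" "u powr 2"] powr_powr)
        qed
        finally have "(u\<^sup>2 - 1) powr (a - 1) / sqrt u \<le> (3 / 4) powr (a - 1) * u powr (2 * (a - 1)) / sqrt u"
          using 3 by (intro divide_right_mono) auto
        also have "\<dots> = (3 / 4) powr (a - 1) * u powr (- p - 1)"
        proof -
          have "sqrt u = u powr (1 / 2)" using 3 by (simp add: powr_half_sqrt)
          moreover have e: "- p - 1 = 2 * (a - 1) - 1 / 2" by (simp add: p_def)
          ultimately show ?thesis unfolding e powr_diff by simp
        qed
        finally have "mixing_density a u \<le> (3 / 4) powr (a - 1) * u powr (- p - 1)" using 3 by (simp add: mixing_density_def)
        then have "mixing_density a u * exp (- (B / u)) \<le> (3 / 4) powr (a - 1) * u powr (- p - 1) * exp (- (B / u))"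
          by (rule mult_right_mono) simp
        then have "mixing_density a u * exp (- (B / u)) \<le> (3 / 4) powr (a - 1) * (indicator {0<..} u * ?h u)" using 3 by simp
        moreover have e: "pi * w / (2 * u) = B / u" by (simp add: B_def)
        moreover have "0 \<le> ((4 / pi) powr p * w powr (- p)) * mixing_density a u" using mixing_density_nonneg by simp
        ultimately show ?thesis unfolding e by linarith
      qed
    qed
    have "profile a w \<le> (LINT u|lborel. ((4 / pi) powr p * w powr (- p)) * mixing_density a u + (3 / 4) powr (a - 1) * (indicator {0<..} u * ?h u))"
      unfolding profile_def using w
      by (intro integral_mono i pw Bochner_Integration.integrable_add integrable_mult_right nu hi(1)) auto
    also have "\<dots> = ((4 / pi) powr p * w powr (- p)) * N + (3 / 4) powr (a - 1) * (B powr (- p) * Gamma p)"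
      using nu hi by (simp add: N_def)
    also have "B powr (- p) = (pi / 2) powr (- p) * w powr (- p)"
      using w powr_mult[of "pi / 2" w "- p"] by (simp add: B_def)
    also have "((4 / pi) powr p * w powr (- p)) * N + (3 / 4) powr (a - 1) * ((pi / 2) powr (- p) * w powr (- p) * Gamma p) = C * w powr (2 * a - 3 / 2)"
      by (simp add: C_def p_def algebra_simps)
    finally show ?thesis .
  qed
  ultimately show "\<exists>C>0. \<forall>w>0. profile a w \<le> C * w powr (2 * a - 3 / 2)" by blast
qed

text \<open>According to which of \<open>\<xi>^4\<close> and \<open>\<eta>^2\<close> is the larger, the decay or the boundedness of the profile
gives the estimate; the larger one is at least half of \<open>\<xi>^4 + \<eta>^2\<close>.\<close>

lemma fs_transform_bounds:
  assumes s: "1 < s" "s < 3"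
  obtains C where "0 < C"
    "\<And>\<xi> \<eta>. \<eta> \<noteq> 0 \<Longrightarrow> fs_transform (s / 4) (\<xi>, \<eta>) \<in> \<real> \<and> 0 < Re (fs_transform (s / 4) (\<xi>, \<eta>)) \<and> Re (fs_transform (s / 4) (\<xi>, \<eta>)) \<le> C * fs (3 - s) (\<xi>, \<eta>)"
proof -
  define a where "a = s / 4"
  have a: "0 < a" "a < 3 / 4" "1 / 4 < a" using s by (auto simp: a_def)
  obtain K where K: "0 < K" "\<And>\<xi> \<eta>. \<eta> \<noteq> 0 \<Longrightarrow> fs_transform a (\<xi>, \<eta>) = complex_of_real (K * \<bar>\<eta>\<bar> powr (2 * a - 3 / 2) * profile a (\<xi>\<^sup>2 / \<bar>\<eta>\<bar>))"
    and nu: "integrable lborel (mixing_density a)"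
    using fs_transform_eq_profile[OF a(1,2)] by metis
  obtain D where D: "0 < D" "\<And>w. 0 < w \<Longrightarrow> profile a w \<le> D * w powr (2 * a - 3 / 2)"
    using profile_decay[OF a nu] by blast
  have P0: "0 < profile a 0" using profile_pos[OF a nu] by simp
  define p where "p = 3 / 2 - 2 * a"
  have p: "0 < p" "2 * a - 3 / 2 = - p" "(3 - s) / 4 = p / 2" using a by (auto simp: p_def a_def field_simps)
  (* The factor lost when xi^4 + eta^2 is replaced by twice the larger summand. *)
  define e2 where "e2 = 2 powr (p / 2)"
  have e2: "0 < e2" by (simp add: e2_def)
  have f: "m powr (- (p / 2)) \<le> e2 * fs (3 - s) (\<xi>, \<eta>)" if "0 < m" "\<xi> ^ 4 + \<eta>\<^sup>2 \<le> 2 * m" "\<eta> \<noteq> 0" for m \<xi> \<eta>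
  proof -
    have pos: "0 < \<xi> ^ 4 + \<eta>\<^sup>2" using that by (intro add_nonneg_pos) (auto simp: zero_le_even_power)
    have "(2 * m) powr (- (p / 2)) \<le> (\<xi> ^ 4 + \<eta>\<^sup>2) powr (- (p / 2))"
      using pos that p by (intro powr_mono2') auto
    moreover have "m powr (- (p / 2)) = e2 * (2 * m) powr (- (p / 2))"
      using that by (simp add: e2_def powr_mult powr_minus)
    moreover have "fs (3 - s) (\<xi>, \<eta>) = (\<xi> ^ 4 + \<eta>\<^sup>2) powr (- (p / 2))"
      unfolding fs_def p(3) by (simp add: powr_minus_divide)
    ultimately show ?thesis using e2 by simp
  qed
  show thesis
  proof
    show "0 < K * (profile a 0 + D) * e2" using K D P0 e2 by simp
    fix \<xi> \<eta> :: real assume \<eta>: "\<eta> \<noteq> 0"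
    have eta: "(\<eta>\<^sup>2) powr (- (p / 2)) = \<bar>\<eta>\<bar> powr (- p)"
    proof -
      have "\<eta>\<^sup>2 = \<bar>\<eta>\<bar> powr 2" using \<eta> by simp
      then show ?thesis by (simp only: powr_powr) simp
    qed
    have main: "\<bar>\<eta>\<bar> powr (- p) * profile a (\<xi>\<^sup>2 / \<bar>\<eta>\<bar>) \<le> (profile a 0 + D) * (e2 * fs (3 - s) (\<xi>, \<eta>))"
    proof (cases "\<xi> ^ 4 \<le> \<eta>\<^sup>2")
      case True
      have "\<bar>\<eta>\<bar> powr (- p) * profile a (\<xi>\<^sup>2 / \<bar>\<eta>\<bar>) \<le> \<bar>\<eta>\<bar> powr (- p) * profile a 0"
        using profile_le[OF a nu] by (intro mult_left_mono) auto
      also have "\<dots> \<le> (e2 * fs (3 - s) (\<xi>, \<eta>)) * (profile a 0 + D)"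
        using f[of "\<eta>\<^sup>2" \<xi> \<eta>] True \<eta> P0 D e2 fs_nonneg[of "3 - s"] unfolding eta by (intro mult_mono) auto
      finally show ?thesis by (simp add: mult_ac)
    next
      case False
      then have \<xi>: "\<xi> \<noteq> 0" using \<eta> by auto
      then have x4: "0 < \<xi> ^ 4" by (simp add: zero_less_power_eq)
      have "\<bar>\<eta>\<bar> powr (- p) * profile a (\<xi>\<^sup>2 / \<bar>\<eta>\<bar>) \<le> \<bar>\<eta>\<bar> powr (- p) * (D * (\<xi>\<^sup>2 / \<bar>\<eta>\<bar>) powr (- p))"
        using D(2)[of "\<xi>\<^sup>2 / \<bar>\<eta>\<bar>"] \<xi> \<eta> unfolding p by (intro mult_left_mono) auto
      also have "\<dots> = D * (\<xi>\<^sup>2) powr (- p)"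
        using \<eta> by (simp add: powr_divide)
      also have "(\<xi>\<^sup>2) powr (- p) = (\<xi> ^ 4) powr (- (p / 2))"
      proof -
        have "\<xi> ^ 4 = (\<xi>\<^sup>2) powr 2" using \<xi> by (simp flip: power_mult)
        then show ?thesis by (simp only: powr_powr) simp
      qed
      also have "D * (\<xi> ^ 4) powr (- (p / 2)) \<le> (profile a 0 + D) * (e2 * fs (3 - s) (\<xi>, \<eta>))"
        using f[OF x4 _ \<eta>] False P0 D e2 fs_nonneg[of "3 - s"] by (intro mult_mono) auto
      finally show ?thesis .
    qed
    have "0 < profile a (\<xi>\<^sup>2 / \<bar>\<eta>\<bar>)" using profile_pos[OF a nu] by simp
    moreover have "K * (\<bar>\<eta>\<bar> powr (- p) * profile a (\<xi>\<^sup>2 / \<bar>\<eta>\<bar>)) \<le> K * ((profile a 0 + D) * (e2 * fs (3 - s) (\<xi>, \<eta>)))"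
      using main K by (intro mult_left_mono) auto
    ultimately show "fs_transform (s / 4) (\<xi>, \<eta>) \<in> \<real> \<and> 0 < Re (fs_transform (s / 4) (\<xi>, \<eta>)) \<and> Re (fs_transform (s / 4) (\<xi>, \<eta>)) \<le> K * (profile a 0 + D) * e2 * fs (3 - s) (\<xi>, \<eta>)"
      unfolding a_def[symmetric] K(2)[OF \<eta>] p using K \<eta> by (simp add: mult_ac del: of_real_mult)
  qed
qed

lemma integrable_fs_transform_weight:
  assumes s: "1 < s" "s < 3"
  shows "integrable lborel (\<lambda>z. norm (fs_transform (s / 4) z) * decay_weight z)"
proof -
  obtain C where C: "0 < C"
    "\<And>\<xi> \<eta>. \<eta> \<noteq> 0 \<Longrightarrow> fs_transform (s / 4) (\<xi>, \<eta>) \<in> \<real> \<and> 0 < Re (fs_transform (s / 4) (\<xi>, \<eta>)) \<and> Re (fs_transform (s / 4) (\<xi>, \<eta>)) \<le> C * fs (3 - s) (\<xi>, \<eta>)"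
    using fs_transform_bounds[OF s] by metis
  show ?thesis
  proof (rule Bochner_Integration.integrable_bound)
    show "integrable lborel (\<lambda>z. C * (fs (3 - s) z * decay_weight z))"
      using s by (intro integrable_mult_right integrable_fs_decay_weight) auto
    show "AE z in lborel. norm (norm (fs_transform (s / 4) z) * decay_weight z) \<le> norm (C * (fs (3 - s) z * decay_weight z))"
      using AE_lborel_axes
    proof eventually_elim
      case (elim z)
      have "norm (fs_transform (s / 4) z) \<le> C * fs (3 - s) z"
        using C(2)[of "snd z" "fst z"] elim by (auto simp: in_Reals_norm)
      then have "norm (fs_transform (s / 4) z) * decay_weight z \<le> C * fs (3 - s) z * decay_weight z"
        using decay_weight_pos[of z] by (intro mult_right_mono) auto
      then show ?case using decay_weight_pos[of z] C(1) fs_nonneg[of "3 - s" z] by (simp add: abs_mult mult_ac)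
    qed
    have [measurable]: "decay_weight \<in> borel_measurable borel" using integrable_decay_weight by auto
    show "(\<lambda>z. norm (fs_transform (s / 4) z) * decay_weight z) \<in> borel_measurable lborel" by measurable
  qed
qed

lemma locally_integrable_of_decay_weight:
  fixes g :: "real \<times> real \<Rightarrow> complex"
  assumes [measurable]: "g \<in> borel_measurable borel" and int: "integrable lborel (\<lambda>z. norm (g z) * decay_weight z)"
  shows "locally_integrable g"
  unfolding locally_integrable_def
proof (intro allI impI)
  fix K :: "(real \<times> real) set" assume K: "compact K"
  then obtain R where R: "\<And>z. z \<in> K \<Longrightarrow> norm z \<le> R" using compact_imp_bounded[OF K] unfolding bounded_iff by blast
  have [measurable]: "K \<in> sets borel" using K by (intro borel_compact)
  define c where "c = (1 + R\<^sup>2) * (1 + R\<^sup>2)"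
  show "set_integrable lborel K g" unfolding set_integrable_def
  proof (rule Bochner_Integration.integrable_bound)
    show "integrable lborel (\<lambda>z. c * (norm (g z) * decay_weight z))" by (intro integrable_mult_right int)
    have "norm (indicator K z *\<^sub>R g z) \<le> c * (norm (g z) * decay_weight z)" for z
    proof (cases "z \<in> K")
      case True
      have "\<bar>fst z\<bar> \<le> R" "\<bar>snd z\<bar> \<le> R"
        using R[OF True] norm_fst_le[of "fst z" "snd z"] norm_snd_le[of "snd z" "fst z"] by auto
      then have "(1 + (fst z)\<^sup>2) * (1 + (snd z)\<^sup>2) \<le> c"
        unfolding c_def by (intro mult_mono add_left_mono) (auto simp: abs_le_square_iff[symmetric])
      moreover have "0 < (1 + (fst z)\<^sup>2) * (1 + (snd z)\<^sup>2)" by (intro mult_pos_pos add_pos_nonneg) auto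
      ultimately have "1 \<le> c / ((1 + (fst z)\<^sup>2) * (1 + (snd z)\<^sup>2))" by (simp add: pos_le_divide_eq)
      then have "1 \<le> c * decay_weight z" by (simp add: decay_weight_def divide_inverse)
      from mult_left_mono[OF this, of "norm (g z)"] show ?thesis using True by (simp add: mult_ac)
    next
      case False
      then show ?thesis using decay_weight_pos[of z] by (simp add: c_def)
    qed
    then show "AE z in lborel. norm (indicator K z *\<^sub>R g z) \<le> norm (c * (norm (g z) * decay_weight z))"
      by (intro AE_I2) (simp only: real_norm_def, rule order_trans[OF _ abs_ge_self])
  qed measurable
qed

section \<open>The distributional Fourier transform of fs\<close>

lemma fs_eq_integral:
  assumes "0 < s" "fst z \<noteq> 0"
  shows "integrable lborel (\<lambda>v. exp (s / 4 * v - ((fst z) ^ 4 + (snd z)\<^sup>2) * exp v))"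
    and "(LINT v|lborel. exp (s / 4 * v - ((fst z) ^ 4 + (snd z)\<^sup>2) * exp v)) = Gamma (s / 4) * fs s z"
proof -
  have m: "0 < (fst z) ^ 4 + (snd z)\<^sup>2" using assms by (intro add_pos_nonneg) (auto simp: zero_less_power_eq)
  show "integrable lborel (\<lambda>v. exp (s / 4 * v - ((fst z) ^ 4 + (snd z)\<^sup>2) * exp v))"
    using exp_exp_integral(1)[OF _ m, of "s / 4"] assms by simp
  show "(LINT v|lborel. exp (s / 4 * v - ((fst z) ^ 4 + (snd z)\<^sup>2) * exp v)) = Gamma (s / 4) * fs s z"
  proof -
    have "fs s z = (fst z ^ 4 + (snd z)\<^sup>2) powr (- (s / 4))"
      by (cases z) (simp add: fs_def powr_minus_divide)
    then show ?thesis using exp_exp_integral(2)[OF _ m, of "s / 4"] assms by (simp only:) simp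
  qed
qed

lemma fourier_gaussian_quartic:
  fixes v :: real
  defines "k \<equiv> \<lambda>z :: real \<times> real. complex_of_real (exp (- exp v * (fst z) ^ 4)) * complex_of_real (exp (- exp v * (snd z)\<^sup>2))"
  shows "integrable lborel k"
    and "fourier k \<zeta> = quartic_fourier v (fst \<zeta>) * complex_of_real (sqrt (pi / exp v) * exp (- pi\<^sup>2 * (snd \<zeta>)\<^sup>2 / exp v))"
proof -
  let ?e = "\<lambda>r. exp (- 2 * pi * \<i> * complex_of_real r)"
  have q: "integrable lborel (\<lambda>x. complex_of_real (exp (- exp v * x ^ 4)))"
    using quartic_scaled(1)[of v] by (rule integrable_of_real)
  have g: "integrable lborel (\<lambda>x. complex_of_real (exp (- exp v * x\<^sup>2)))"
    using gaussian_integrable[of "exp v"] by (intro integrable_of_real) simp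
  show "integrable lborel k" unfolding k_def by (rule integral_lborel_mult(1)[OF q g])
  have bd: "integrable lborel (\<lambda>x. ?e (x * y) * f x)" if "integrable lborel f" for f :: "real \<Rightarrow> complex" and y
    using fourier_integrable[OF that, of y] by simp
  have "?e (z \<bullet> \<zeta>) * k z = (?e (fst z * fst \<zeta>) * complex_of_real (exp (- exp v * (fst z) ^ 4))) * (?e (snd z * snd \<zeta>) * complex_of_real (exp (- exp v * (snd z)\<^sup>2)))" for z
  proof -
    have "?e (z \<bullet> \<zeta>) = ?e (fst z * fst \<zeta>) * ?e (snd z * snd \<zeta>)"
      by (cases z; cases \<zeta>) (simp add: algebra_simps flip: exp_add)
    then show ?thesis unfolding k_def by (simp only: mult_ac)
  qed
  then have "fourier k \<zeta> = (LINT z|lborel. (?e (fst z * fst \<zeta>) * complex_of_real (exp (- exp v * (fst z) ^ 4))) * (?e (snd z * snd \<zeta>) * complex_of_real (exp (- exp v * (snd z)\<^sup>2))))"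
    unfolding fourier_def by (simp only:)
  also have "\<dots> = quartic_fourier v (fst \<zeta>) * complex_of_real (sqrt (pi / exp v) * exp (- pi\<^sup>2 * (snd \<zeta>)\<^sup>2 / exp v))"
    unfolding integral_lborel_mult(2)[OF bd[OF q] bd[OF g]] quartic_fourier_def
    by (subst gaussian_fourier) simp_all
  finally show "fourier k \<zeta> = quartic_fourier v (fst \<zeta>) * complex_of_real (sqrt (pi / exp v) * exp (- pi\<^sup>2 * (snd \<zeta>)\<^sup>2 / exp v))" .
qed

text \<open>Superpose the multiplication formula for the functions \<open>exp (- exp v * x^4) * exp (- exp v * t^2)\<close>
over \<open>v\<close>. On the left the interchange of integrals is justified by the integrability of
\<open>fs s\<close> times the transformed test function; on the right by the majorant
\<open>\<bar>\<eta>\<bar> powr (2 * a - 3 / 2)\<close> times the test function.\<close>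

lemma distr_fourier_fs:
  fixes \<phi> :: "real \<times> real \<Rightarrow> complex"
  assumes s: "1 < s" "s < 3" and \<phi>: "\<phi> \<in> schwartz_space"
  shows "distr_fourier (distribution_of (\<lambda>z. complex_of_real (fs s z))) \<phi> = distribution_of (fs_transform (s / 4)) \<phi>"
proof -
  define a where "a = s / 4"
  have a: "0 < a" "a < 3 / 4" "1 / 4 < a" using s by (auto simp: a_def)
  define p where "p = 3 / 4 - a"
  have p: "0 < p" "2 * p < 1" using a by (auto simp: p_def)
  define m where "m z = (fst z) ^ 4 + (snd z)\<^sup>2" for z :: "real \<times> real"
  have [measurable]: "m \<in> borel_measurable borel" unfolding m_def[abs_def] borel_prod[symmetric] by measurable
  have [measurable]: "\<phi> \<in> borel_measurable borel" by (rule schwartz_measurable[OF \<phi>])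
  have [measurable]: "fourier \<phi> \<in> borel_measurable borel" by (rule fourier_measurable) measurable
  obtain C where C: "0 \<le> C" "\<And>z. norm (\<phi> z) \<le> C * decay_weight z" using schwartz_le_decay_weight[OF \<phi>] by blast
  obtain C' where C': "\<And>z. norm (fourier \<phi> z) \<le> C' * decay_weight z" using fourier_schwartz_le_decay_weight[OF \<phi>] by blast
  have Gpos: "0 < Gamma a" using a by (intro Gamma_real_pos) auto
  let ?k = "\<lambda>z v. exp (a * v - m z * exp v)"
  have int_f: "integrable lborel (\<lambda>z. complex_of_real (fs s z) * fourier \<phi> z)"
    using C' integrable_fs_decay_weight[of s] s fs_nonneg[of s]
    by (intro integrable_mult_decay_weight(1)[where C = C']) auto
  have kint: "integrable lborel (?k z)" "(LINT v|lborel. ?k z v) = Gamma a * fs s z" if "fst z \<noteq> 0" for z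
    using fs_eq_integral[of s z] that s by (simp_all add: a_def m_def)
  have int1: "integrable (lborel \<Otimes>\<^sub>M lborel) (\<lambda>(z, v). complex_of_real (?k z v) * fourier \<phi> z)"
  proof (rule lborel_pair.Fubini_integrable)
    show "(\<lambda>(z, v). complex_of_real (?k z v) * fourier \<phi> z) \<in> borel_measurable (lborel \<Otimes>\<^sub>M lborel)" by measurable
    show "AE z in lborel. integrable lborel (\<lambda>v. case (z, v) of (z, v) \<Rightarrow> complex_of_real (?k z v) * fourier \<phi> z)"
      using AE_lborel_axes
    proof eventually_elim
      case (elim z)
      have "integrable lborel (\<lambda>v. complex_of_real (?k z v) * fourier \<phi> z)"
        using kint(1)[of z] elim by (intro integrable_mult_left integrable_of_real) auto
      then show ?case by simp
    qed
    have "integrable lborel (\<lambda>z. Gamma a * norm (complex_of_real (fs s z) * fourier \<phi> z))"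
      by (intro integrable_mult_right integrable_norm int_f)
    then show "integrable lborel (\<lambda>z. LINT v|lborel. norm (case (z, v) of (z, v) \<Rightarrow> complex_of_real (?k z v) * fourier \<phi> z))"
    proof (rule integrable_cong_AE_imp)
      show "AE z in lborel. Gamma a * norm (complex_of_real (fs s z) * fourier \<phi> z) = (LINT v|lborel. norm (case (z, v) of (z, v) \<Rightarrow> complex_of_real (?k z v) * fourier \<phi> z))"
        using AE_lborel_axes
      proof eventually_elim
        case (elim z)
        then show ?case using kint(2)[of z] fs_nonneg[of s z] by (simp add: norm_mult)
      qed
    qed measurable
  qed
  have inner1: "(LINT z|lborel. complex_of_real (?k z v) * fourier \<phi> z) =
      complex_of_real (sqrt pi) * (LINT \<zeta>|lborel. complex_of_real (exp ((a - 1 / 2) * v - (pi * snd \<zeta>)\<^sup>2 * exp (- v))) * quartic_fourier v (fst \<zeta>) * \<phi> \<zeta>)" for v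
  proof -
    define k where "k z = complex_of_real (exp (- exp v * (fst z) ^ 4)) * complex_of_real (exp (- exp v * (snd z)\<^sup>2))" for z :: "real \<times> real"
    have ki: "integrable lborel k" and kf: "fourier k \<zeta> = quartic_fourier v (fst \<zeta>) * complex_of_real (sqrt (pi / exp v) * exp (- pi\<^sup>2 * (snd \<zeta>)\<^sup>2 / exp v))" for \<zeta>
      using fourier_gaussian_quartic[of v] by (simp_all only: k_def[abs_def])
    have pt: "complex_of_real (exp (a * v)) * (fourier k \<zeta> * \<phi> \<zeta>) =
      complex_of_real (sqrt pi) * (complex_of_real (exp ((a - 1 / 2) * v - (pi * snd \<zeta>)\<^sup>2 * exp (- v))) * quartic_fourier v (fst \<zeta>) * \<phi> \<zeta>)" for \<zeta>
    proof -
      have "sqrt (exp v) = exp (v / 2)" by (intro real_sqrt_unique) (simp_all add: power2_eq_square flip: exp_add)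
      then have "sqrt (pi / exp v) = sqrt pi * exp (- (v / 2))"
        by (simp add: real_sqrt_divide exp_minus field_simps)
      moreover have "- pi\<^sup>2 * (snd \<zeta>)\<^sup>2 / exp v = - ((pi * snd \<zeta>)\<^sup>2 * exp (- v))"
        by (simp add: power_mult_distrib exp_minus field_simps)
      moreover have "exp ((a - 1 / 2) * v - (pi * snd \<zeta>)\<^sup>2 * exp (- v)) = exp (a * v) * exp (- (v / 2)) * exp (- ((pi * snd \<zeta>)\<^sup>2 * exp (- v)))"
        unfolding exp_add[symmetric] by (rule arg_cong[where f = exp]) (simp add: algebra_simps)
      ultimately have "exp (a * v) * (sqrt (pi / exp v) * exp (- pi\<^sup>2 * (snd \<zeta>)\<^sup>2 / exp v)) = sqrt pi * exp ((a - 1 / 2) * v - (pi * snd \<zeta>)\<^sup>2 * exp (- v))"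
        by (simp only: mult_ac)
      from arg_cong[OF this, of complex_of_real]
      have "complex_of_real (exp (a * v)) * complex_of_real (sqrt (pi / exp v) * exp (- pi\<^sup>2 * (snd \<zeta>)\<^sup>2 / exp v)) = complex_of_real (sqrt pi) * complex_of_real (exp ((a - 1 / 2) * v - (pi * snd \<zeta>)\<^sup>2 * exp (- v)))"
        by (simp only: of_real_mult)
      then show ?thesis unfolding kf by (simp only: mult_ac)
    qed
    have "complex_of_real (?k z v) * fourier \<phi> z = complex_of_real (exp (a * v)) * (k z * fourier \<phi> z)" for z
    proof -
      have "?k z v = exp (a * v) * (exp (- exp v * (fst z) ^ 4) * exp (- exp v * (snd z)\<^sup>2))"
        by (simp add: m_def algebra_simps flip: exp_add)
      then show ?thesis unfolding k_def by (simp only: of_real_mult mult.assoc)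
    qed
    then have "(LINT z|lborel. complex_of_real (?k z v) * fourier \<phi> z) = complex_of_real (exp (a * v)) * (LINT z|lborel. k z * fourier \<phi> z)"
      by (simp only: integral_mult_right_zero)
    also have "(LINT z|lborel. k z * fourier \<phi> z) = (LINT \<zeta>|lborel. fourier k \<zeta> * \<phi> \<zeta>)"
      by (rule fourier_multiplication_formula[OF ki schwartz_integrable[OF \<phi>]])
    also have "complex_of_real (exp (a * v)) * \<dots> = (LINT \<zeta>|lborel. complex_of_real (exp (a * v)) * (fourier k \<zeta> * \<phi> \<zeta>))"
      by simp
    finally show ?thesis unfolding pt by (simp only: integral_mult_right_zero)
  qed
  have [measurable]: "(fst :: real \<times> real \<Rightarrow> real) \<in> borel_measurable borel" "(snd :: real \<times> real \<Rightarrow> real) \<in> borel_measurable borel"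
    by (intro borel_measurable_continuous_onI continuous_intros)+
  let ?h = "\<lambda>\<zeta> v. complex_of_real (exp ((a - 1 / 2) * v - (pi * snd \<zeta>)\<^sup>2 * exp (- v))) * quartic_fourier v (fst \<zeta>) * \<phi> \<zeta>"
  let ?maj = "\<lambda>\<zeta> v. quartic_mass * exp (- p * v - (pi * snd \<zeta>)\<^sup>2 * exp (- v)) * norm (\<phi> \<zeta>)"
  have maj: "integrable (lborel \<Otimes>\<^sub>M lborel) (\<lambda>(\<zeta>, v). ?maj \<zeta> v)"
  proof (rule lborel_pair.Fubini_integrable)
    show "(\<lambda>(\<zeta>, v). ?maj \<zeta> v) \<in> borel_measurable (lborel \<Otimes>\<^sub>M lborel)" by measurable
    show "AE \<zeta> in lborel. integrable lborel (\<lambda>v. case (\<zeta>, v) of (\<zeta>, v) \<Rightarrow> ?maj \<zeta> v)"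
      using AE_lborel_axes
    proof eventually_elim
      case (elim \<zeta>)
      have "integrable lborel (?maj \<zeta>)"
        using elim p by (intro integrable_mult_left integrable_mult_right exp_exp_integral_neg) auto
      then show ?case by simp
    qed
    define c where "c = quartic_mass * (pi powr (- 2 * p) * Gamma p) * C"
    have "0 \<le> c" using quartic_mass_nonneg Gamma_real_pos[OF p(1)] C by (simp add: c_def)
    show "integrable lborel (\<lambda>\<zeta>. LINT v|lborel. norm (case (\<zeta>, v) of (\<zeta>, v) \<Rightarrow> ?maj \<zeta> v))"
    proof (rule Bochner_Integration.integrable_bound)
      show "integrable lborel (\<lambda>\<zeta>. c * (\<bar>fst \<zeta>\<bar> powr (- 0) * \<bar>snd \<zeta>\<bar> powr (- (2 * p)) * decay_weight \<zeta>))"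
        using p by (intro integrable_mult_right integrable_powr_powr_decay_weight) auto
      show "(\<lambda>\<zeta>. LINT v|lborel. norm (case (\<zeta>, v) of (\<zeta>, v) \<Rightarrow> ?maj \<zeta> v)) \<in> borel_measurable lborel" by measurable
      show "AE \<zeta> in lborel. norm (LINT v|lborel. norm (case (\<zeta>, v) of (\<zeta>, v) \<Rightarrow> ?maj \<zeta> v))
          \<le> norm (c * (\<bar>fst \<zeta>\<bar> powr (- 0) * \<bar>snd \<zeta>\<bar> powr (- (2 * p)) * decay_weight \<zeta>))"
        using AE_lborel_axes
      proof eventually_elim
        case (elim \<zeta>)
        have A: "0 < (pi * snd \<zeta>)\<^sup>2" using elim by simp
        have "(LINT v|lborel. norm (case (\<zeta>, v) of (\<zeta>, v) \<Rightarrow> ?maj \<zeta> v)) = (LINT v|lborel. ?maj \<zeta> v)"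
          using quartic_mass_nonneg by (simp add: abs_mult)
        also have "\<dots> = quartic_mass * (((pi * snd \<zeta>)\<^sup>2) powr (- p) * Gamma p) * norm (\<phi> \<zeta>)"
          unfolding exp_exp_integral_neg(2)[OF p(1) A, symmetric] by simp
        also have "((pi * snd \<zeta>)\<^sup>2) powr (- p) = pi powr (- 2 * p) * \<bar>snd \<zeta>\<bar> powr (- (2 * p))"
        proof -
          have "(pi * snd \<zeta>)\<^sup>2 = (pi * \<bar>snd \<zeta>\<bar>) powr 2" using elim by (simp add: power_mult_distrib)
          then have "((pi * snd \<zeta>)\<^sup>2) powr (- p) = (pi * \<bar>snd \<zeta>\<bar>) powr (- 2 * p)" by (simp only: powr_powr) simp
          then show ?thesis by (simp add: powr_mult)
        qed
        also have "quartic_mass * (pi powr (- 2 * p) * \<bar>snd \<zeta>\<bar> powr (- (2 * p)) * Gamma p) * norm (\<phi> \<zeta>)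
            \<le> quartic_mass * (pi powr (- 2 * p) * \<bar>snd \<zeta>\<bar> powr (- (2 * p)) * Gamma p) * (C * decay_weight \<zeta>)"
          using quartic_mass_nonneg Gamma_real_pos[OF p(1)] C by (intro mult_left_mono mult_nonneg_nonneg) auto
        also have "\<dots> = c * (\<bar>fst \<zeta>\<bar> powr (- 0) * \<bar>snd \<zeta>\<bar> powr (- (2 * p)) * decay_weight \<zeta>)"
          using elim by (simp add: c_def)
        finally have le: "(LINT v|lborel. norm (case (\<zeta>, v) of (\<zeta>, v) \<Rightarrow> ?maj \<zeta> v)) \<le> c * (\<bar>fst \<zeta>\<bar> powr (- 0) * \<bar>snd \<zeta>\<bar> powr (- (2 * p)) * decay_weight \<zeta>)" .
        have "0 \<le> (LINT v|lborel. norm (case (\<zeta>, v) of (\<zeta>, v) \<Rightarrow> ?maj \<zeta> v))"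
          by (rule integral_nonneg_AE) simp
        then show ?case using le unfolding real_norm_def by linarith
      qed
    qed
  qed
  have int2: "integrable (lborel \<Otimes>\<^sub>M lborel) (\<lambda>(\<zeta>, v). ?h \<zeta> v)"
  proof (rule Bochner_Integration.integrable_bound[OF maj])
    show "(\<lambda>(\<zeta>, v). ?h \<zeta> v) \<in> borel_measurable (lborel \<Otimes>\<^sub>M lborel)" by measurable
    have "norm (?h \<zeta> v) \<le> ?maj \<zeta> v" for \<zeta> v
    proof -
      have "norm (?h \<zeta> v) = exp ((a - 1 / 2) * v - (pi * snd \<zeta>)\<^sup>2 * exp (- v)) * norm (quartic_fourier v (fst \<zeta>)) * norm (\<phi> \<zeta>)"
        by (simp add: norm_mult)
      also have "\<dots> \<le> exp ((a - 1 / 2) * v - (pi * snd \<zeta>)\<^sup>2 * exp (- v)) * (exp (- v / 4) * quartic_mass) * norm (\<phi> \<zeta>)"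
        by (intro mult_right_mono mult_left_mono norm_quartic_fourier_le) auto
      also have "\<dots> = ?maj \<zeta> v"
        by (simp add: p_def algebra_simps flip: exp_add)
      finally show ?thesis .
    qed
    then show "AE x in lborel \<Otimes>\<^sub>M lborel. norm (case x of (\<zeta>, v) \<Rightarrow> ?h \<zeta> v) \<le> norm (case x of (\<zeta>, v) \<Rightarrow> ?maj \<zeta> v)"
      by (intro AE_I2) (simp only: split_beta real_norm_def, rule order_trans[OF _ abs_ge_self])
  qed
  have "complex_of_real (Gamma a) * distr_fourier (distribution_of (\<lambda>z. complex_of_real (fs s z))) \<phi> =
      (LINT z|lborel. complex_of_real (Gamma a) * (complex_of_real (fs s z) * fourier \<phi> z))"
    by (simp add: distr_fourier_def distribution_of_def)
  also have "\<dots> = (LINT z|lborel. LINT v|lborel. complex_of_real (?k z v) * fourier \<phi> z)"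
  proof (rule integral_cong_AE)
    show "AE z in lborel. complex_of_real (Gamma a) * (complex_of_real (fs s z) * fourier \<phi> z) = (LINT v|lborel. complex_of_real (?k z v) * fourier \<phi> z)"
      using AE_lborel_axes
    proof eventually_elim
      case (elim z)
      have "(LINT v|lborel. complex_of_real (?k z v) * fourier \<phi> z) = complex_of_real (LINT v|lborel. ?k z v) * fourier \<phi> z"
        unfolding integral_mult_left_zero integral_complex_of_real ..
      then show ?case using kint(2)[of z] elim by simp
    qed
  qed measurable
  also have "\<dots> = (LINT v|lborel. LINT z|lborel. complex_of_real (?k z v) * fourier \<phi> z)"
    by (rule lborel_pair.Fubini_integral[OF int1, symmetric])
  also have "\<dots> = complex_of_real (sqrt pi) * (LINT v|lborel. LINT \<zeta>|lborel. ?h \<zeta> v)"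
    unfolding inner1 integral_mult_right_zero ..
  also have "(LINT v|lborel. LINT \<zeta>|lborel. ?h \<zeta> v) = (LINT \<zeta>|lborel. LINT v|lborel. ?h \<zeta> v)"
    by (rule lborel_pair.Fubini_integral[OF int2])
  also have "complex_of_real (sqrt pi) * \<dots> = (LINT \<zeta>|lborel. complex_of_real (sqrt pi) * (LINT v|lborel. ?h \<zeta> v))"
    by simp
  also have "\<dots> = (LINT \<zeta>|lborel. complex_of_real (Gamma a) * (fs_transform a \<zeta> * \<phi> \<zeta>))"
  proof -
    have "complex_of_real (sqrt pi) * (LINT v|lborel. ?h \<zeta> v) = complex_of_real (Gamma a) * (fs_transform a \<zeta> * \<phi> \<zeta>)" for \<zeta>
    proof -
      have "complex_of_real (sqrt pi) = complex_of_real (Gamma a) * complex_of_real (sqrt pi / Gamma a)"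
        using Gpos by simp
      then show ?thesis unfolding integral_mult_left_zero fs_transform_def by (simp only: mult.assoc)
    qed
    then show ?thesis by (simp only:)
  qed
  also have "(LINT \<zeta>|lborel. complex_of_real (Gamma a) * (fs_transform a \<zeta> * \<phi> \<zeta>)) = complex_of_real (Gamma a) * distribution_of (fs_transform a) \<phi>"
    by (simp add: distribution_of_def)
  finally show ?thesis using Gpos by (simp add: a_def)
qed

theorem lemma3p2:
  fixes s :: real
  assumes "0 < s" and "s < 3"
  shows "(\<forall>\<phi>\<in>schwartz_space. integrable lborel (\<lambda>z. complex_of_real (fs s z) * \<phi> z)) \<and>
    tempered_distribution (distribution_of (\<lambda>z. complex_of_real (fs s z))) \<and>
    (1 < s \<longrightarrow>
      (\<exists>g :: real \<times> real \<Rightarrow> complex.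
        locally_integrable g \<and>
        is_function (distr_fourier (distribution_of (\<lambda>z. complex_of_real (fs s z)))) g \<and>
        (\<forall>\<xi>\<^sub>1 \<xi>\<^sub>2. \<xi>\<^sub>2 \<noteq> 0 \<longrightarrow>
          integrable lborel (fs_hat_integrand s \<xi>\<^sub>1 \<xi>\<^sub>2) \<and>
          g (\<xi>\<^sub>1, \<xi>\<^sub>2) =
            complex_of_real (2 * pi powr (s / 4) * \<bar>\<xi>\<^sub>2\<bar> powr ((s - 2) / 4) / Gamma (s / 4)) *
            (LINT x|lborel. fs_hat_integrand s \<xi>\<^sub>1 \<xi>\<^sub>2 x)) \<and>
        (\<exists>C>0. \<forall>\<xi>\<^sub>1 \<xi>\<^sub>2. \<xi>\<^sub>2 \<noteq> 0 \<longrightarrow>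
          g (\<xi>\<^sub>1, \<xi>\<^sub>2) \<in> \<real> \<and> 0 < Re (g (\<xi>\<^sub>1, \<xi>\<^sub>2)) \<and>
          Re (g (\<xi>\<^sub>1, \<xi>\<^sub>2)) \<le> C * fs (3 - s) (\<xi>\<^sub>1, \<xi>\<^sub>2))))"
proof (intro conjI impI ballI)
  have f: "(\<lambda>z. complex_of_real (fs s z)) \<in> borel_measurable borel" by measurable
  have fw: "integrable lborel (\<lambda>z. norm (complex_of_real (fs s z)) * decay_weight z)"
    using integrable_fs_decay_weight[OF assms] fs_nonneg[of s] by simp
  show "integrable lborel (\<lambda>z. complex_of_real (fs s z) * \<phi> z)" if "\<phi> \<in> schwartz_space" for \<phi>
  proof -
    from that have \<phi>: "\<phi> \<in> schwartz_space" .
    obtain C where "\<And>z. norm (\<phi> z) \<le> C * decay_weight z" using schwartz_le_decay_weight[OF \<phi>] by blast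
    then show ?thesis by (rule integrable_mult_decay_weight(1)[OF f schwartz_measurable[OF \<phi>] fw])
  qed
  show "tempered_distribution (distribution_of (\<lambda>z. complex_of_real (fs s z)))"
    by (rule tempered_distribution_of_decay_weight[OF f fw])
  assume s: "1 < s"
  have Gw: "integrable lborel (\<lambda>z. norm (fs_transform (s / 4) z) * decay_weight z)" by (rule integrable_fs_transform_weight[OF s assms(2)])
  have "is_function (distr_fourier (distribution_of (\<lambda>z. complex_of_real (fs s z)))) (fs_transform (s / 4))"
    unfolding is_function_def
  proof (intro ballI conjI)
    fix \<phi> :: "real \<times> real \<Rightarrow> complex" assume \<phi>: "\<phi> \<in> schwartz_space"
    obtain C where "\<And>z. norm (\<phi> z) \<le> C * decay_weight z" using schwartz_le_decay_weight[OF \<phi>] by blast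
    then show "integrable lborel (\<lambda>z. fs_transform (s / 4) z * \<phi> z)"
      by (rule integrable_mult_decay_weight(1)[OF fs_transform_measurable schwartz_measurable[OF \<phi>] Gw])
    show "distr_fourier (distribution_of (\<lambda>z. complex_of_real (fs s z))) \<phi> = distribution_of (fs_transform (s / 4)) \<phi>"
      by (rule distr_fourier_fs[OF s assms(2) \<phi>])
  qed
  moreover have "locally_integrable (fs_transform (s / 4))" by (rule locally_integrable_of_decay_weight[OF fs_transform_measurable Gw])
  moreover obtain C where "0 < C"
    "\<And>\<xi> \<eta>. \<eta> \<noteq> 0 \<Longrightarrow> fs_transform (s / 4) (\<xi>, \<eta>) \<in> \<real> \<and> 0 < Re (fs_transform (s / 4) (\<xi>, \<eta>)) \<and> Re (fs_transform (s / 4) (\<xi>, \<eta>)) \<le> C * fs (3 - s) (\<xi>, \<eta>)"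
    using fs_transform_bounds[OF s assms(2)] by metis
  ultimately show "\<exists>g :: real \<times> real \<Rightarrow> complex.
        locally_integrable g \<and>
        is_function (distr_fourier (distribution_of (\<lambda>z. complex_of_real (fs s z)))) g \<and>
        (\<forall>\<xi>\<^sub>1 \<xi>\<^sub>2. \<xi>\<^sub>2 \<noteq> 0 \<longrightarrow>
          integrable lborel (fs_hat_integrand s \<xi>\<^sub>1 \<xi>\<^sub>2) \<and>
          g (\<xi>\<^sub>1, \<xi>\<^sub>2) =
            complex_of_real (2 * pi powr (s / 4) * \<bar>\<xi>\<^sub>2\<bar> powr ((s - 2) / 4) / Gamma (s / 4)) *
            (LINT x|lborel. fs_hat_integrand s \<xi>\<^sub>1 \<xi>\<^sub>2 x)) \<and>
        (\<exists>C>0. \<forall>\<xi>\<^sub>1 \<xi>\<^sub>2. \<xi>\<^sub>2 \<noteq> 0 \<longrightarrow>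
          g (\<xi>\<^sub>1, \<xi>\<^sub>2) \<in> \<real> \<and> 0 < Re (g (\<xi>\<^sub>1, \<xi>\<^sub>2)) \<and>
          Re (g (\<xi>\<^sub>1, \<xi>\<^sub>2)) \<le> C * fs (3 - s) (\<xi>\<^sub>1, \<xi>\<^sub>2))"
    using fs_transform_eq_fs_hat_integrand[OF assms] by (intro exI[of _ "fs_transform (s / 4)"] conjI allI impI exI[of _ C]) auto
qed

end
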